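(* Consider the Stage-I procedure and setting described in the context, run with regression sample size $n_\mu$ and discovery sample size $n_{\mathrm{disc}}$, returning $(\hat{\mathcal{D}},T)$. Assume the margin condition and the bounded-design OLS conditions stated in the context. Fix $\delta_\mu,\delta\in(0,1)$ with $n_\mu\ge\frac{8}{\kappa}\log\frac{2p}{\delta_\mu}$ and define $$r_{\mu,\delta_\mu}:=C_{\mathrm{reg}}\cdot\frac{\sigma}{\sqrt{\kappa}}\sqrt{\frac{d\bigl(p+\log\frac{4d}{\delta_\mu}\bigr)}{n_\mu}},\qquad C_{\mathrm{reg}}=4\sqrt2.$$ Then, with probability at least $1-\delta_\mu-\delta$ over the regression sample and the i.i.d. discovery contexts, $$\mathbb{P}_\xi\bigl[x^\star(\tilde\mu(\xi))\ne x^\star(\mu(\xi))\bigr]\le\frac{4}{n_{\mathrm{disc}}}\bigl(6|T|+\log(e/\delta)\bigr)+C_{\mathrm{marg}}\,r_{\mu,\delta_\mu}^{\alpha}.$$ In particular, since $|T|\le|\hat{\mathcal{D}}|\le d^\star$, $\frac{4}{n_{\mathrm{disc}}}(6|T|+\log(e/\delta))\le\frac{4}{n_{\mathrm{disc}}}(6d^\star+\log(e/\delta))$. Moreover, letting $f_\star(\xi):=\mu(\xi)$ be a Bayes-optimal SPO predictor and letting $\hat f_\star\in\operatorname{argmin}_{f\in\mathcal{H}_{\hat U,t}}R_{\mathrm{SPO}}(f)$, we have (on the same event) $$0\le R_{\mathrm{SPO}}(\hat f_\star)-R_{\mathrm{SPO}}(f_\star)\le\omega_{\mathcal{X}}(\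mathcal{C})\cdot\Bigl[\frac{4}{n_{\mathrm{disc}}}\bigl(6d^\star+\log(e/\delta)\bigr)+C_{\mathrm{marg}}\,r_{\mu,\delta_\mu}^{\alpha}\Bigr].$$
   Context: LP setting. $\mathcal{X}=\{x\in\mathbb{R}^d:Ax=b,\ x\ge0\}$ is nonempty, bounded, with $A\in\mathbb{R}^{m\times d}$ of full row rank, and nondegenerate (every extreme point has exactly $m$ strictly positive components). $\mathcal{X}^\angle$: extreme points; $\mathcal{X}^\star(c):=\operatorname{argmin}_{x\in\mathcal{X}}c^\top x$; $x^\star:\mathbb{R}^d\to\mathcal{X}^\angle$ is a fixed deterministic oracle with $x^\star(v)\in\mathcal{X}^\star(v)$. $\mathcal{C}=\{c\in\mathbb{R}^d:(c-c_0)^\top\Sigma^{-1}(c-c_0)\le1\}$, $\Sigma\succ0$. $\mathcal{X}^\star(\mathcal{C}):=\bigcup_{c\in\mathcal{C}}(\mathcal{X}^\star(c)\cap\mathcal{X}^\angle)$ and $d^\star:=\dim\operatorname{span}\{x-x':x,x'\in\mathcal{X}^\star(\mathcal{C})\}$. $(\xi,c)\sim P$ with $\xi\in\Xi\subseteq\mathbb{R}^p$, $c\in\mathcal{C}$ a.s.; $\mu(\xi):=\mathbb{E}[c\mid\xi]$. $R_{\mathrm{SPO}}(f):=\mathbb{E}[c^\top x^\star(f(\xi))-c^\top x^\star(c)]$; $\omega_{\mathcal{X}}(\mathcal{C}):=\sup_{c\in\mathcal{C}}(\max_{x\in\mathcal{X}}c^\top x-\min_{x\in\mathcal{X}}c^\top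 x)$. $\mathbb{P}_\xi$ is probability over a fresh $\xi$, independent of the Stage-I samples, which are held fixed. Datasets and algorithms. A dataset is a finite set $\mathcal{D}=\{q_1,\dots,q_l\}\subset\mathbb{R}^d$; $s(c;\mathcal{D}):=(q_i^\top c)_{i}$; $\mathcal{C}(\mathcal{D},s):=\{c'\in\mathcal{C}:q_i^\top c'=s_i\ \forall i\}$. For a basis $B$ ($|B|=m$, $A_B$ invertible) with complement $N$ and $j\in N$, $\delta(B,j)$ has $\delta_N(B,j)=e_j$, $\delta_B(B,j)=-A_B^{-1}A_j$. Algorithm 1 (input $c\in\mathcal{C}$, finite $\mathcal{D}_{\mathrm{init}}$): set $\mathcal{D}\leftarrow\mathcal{D}_{\mathrm{init}}$ and repeat: let $\mathcal{C}_k:=\mathcal{C}(\mathcal{D},s(c;\mathcal{D}))$, $k=|\mathcal{D}|$; find an optimal feasible basis $B$ of $\min_{x\in\mathcal{X}}c^\top x$; for $j\in N$ let $\delta_j:=\delta(B,j)$, $m_j:=\min_{c'\in\mathcal{C}_k}(c')^\top\delta_j$ with minimizer $c_j^{\mathrm{out}}$; let $j_0\in\operatorname{argmin}_jm_j$, $c^{\mathrm{out}}:=c^{\mathrm{out}}_{j_0}$; if $m_{j_0}\ge0$ return $\mathcal{D}$; otherwise, for $j\in N$ with $(c^{\mathrm{out}})^\top\delta_j<0$ set $\alpha_j:=\frac{c^\top\delta_j}{c^\top\delta_j-(c^{\mathrm{out}})^\top\delta_j}$, pick $j^\star\in\operatorname{argmin}\alpha_j$ and set $\mathcal{D}\leftarrow\mathcal{D}\cup\{\delta_{j^\star}\}$.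 Ties are broken by a fixed deterministic rule. Algorithm 2 (input $c_1,\dots,c_n\in\mathcal{C}$): $\mathcal{D}_0=\emptyset$; for $i=1,\dots,n$, $\mathcal{D}_i$ is the output of Algorithm 1 on $c_i$ with $\mathcal{D}_{\mathrm{init}}=\mathcal{D}_{i-1}$; return $\mathcal{D}_n$ and $T:=\{i:\mathcal{D}_i\ne\mathcal{D}_{i-1}\}$. Stage I: from a regression sample $\{(\xi_i,c_i)\}_{i=1}^{n_\mu}$ i.i.d. from $P$, compute the multi-response ordinary least squares estimator $\hat A_\mu$ regressing $c_i-c_0$ on $\xi_i$ and set $\hat\mu(\xi):=c_0+\hat A_\mu\xi$. With independent i.i.d. discovery contexts $\xi^{\mathrm{disc}}_1,\dots,\xi^{\mathrm{disc}}_{n_{\mathrm{disc}}}$ (same law as $\xi$), run Algorithm 2 on the pseudo-costs $\hat c_j:=\hat\mu(\xi^{\mathrm{disc}}_j)$ and return $(\hat{\mathcal{D}},T)$. Lifted predictor. $\hat W:=\operatorname{span}(\hat{\mathcal{D}})$, $t:=\dim\hat W$, $\hat U\in\mathbb{R}^{d\times t}$ an orthonormal basis of $\hat W$, $\mathcal{L}_{\hat U}:=\Sigma\hat U(\hat U^\top\Sigma\hat U)^{-1}$, $\tilde\mu(\xi):=c_0+\mathcal{L}_{\hat U}\hat U^\top(\hat\mu(\xi)-c_0)$, and $\mathcal{H}_{\hat U,t}:=\{f_B(\xi)=c_0+\mathcal{L}_{\hat U}B\xi:B\in\mathbb{R}^{t\times p}\}$. Margin condition. Let $\mathcal{B}_{\mathcal{X}}:=\{c\in\mathbb{R}^d:\exists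 x\ne x'\in\mathcal{X}^\angle,\ x,x'\in\mathcal{X}^\star(c)\}$. There are constants $C_{\mathrm{marg}}>0$, $\alpha>0$ such that $\mathbb{P}_\xi[\operatorname{dist}(\mu(\xi),\mathcal{B}_{\mathcal{X}})\le\eta]\le C_{\mathrm{marg}}\eta^\alpha$ for all $\eta>0$; moreover, almost surely over the Stage-I samples, $\mathbb{P}_\xi[\hat\mu(\xi)\in\mathcal{C}]=1$ and $\mathbb{P}_\xi[\tilde\mu(\xi)\in\mathcal{B}_{\mathcal{X}}]=0$. Bounded-design OLS conditions. $c-c_0=A_\mu\xi+\epsilon$ with $\mathbb{E}[\epsilon\mid\xi]=0$ (so $\mu(\xi)=c_0+A_\mu\xi$); $\|\xi\|_2\le1$ a.s.; $\mathbb{E}[\xi\xi^\top]\succeq\kappa I_p$ for some $\kappa>0$; and $\mathbb{E}[\exp(\lambda u^\top\epsilon)\mid\xi]\le\exp(\lambda^2\sigma^2/2)$ for all $\lambda\in\mathbb{R}$ and unit vectors $u\in\mathbb{R}^d$. *)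

theory Defs
  imports "HOL-Probability.Probability" "HOL-Library.While_Combinator"
begin

definition argmin_set :: "('a \<Rightarrow> real) \<Rightarrow> 'a set \<Rightarrow> 'a set" where
  "argmin_set f S = {x. is_arg_min f (\<lambda>x. x \<in> S) x}"

definition pos_def_mat :: "real^'n^'n \<Rightarrow> bool" where
  "pos_def_mat M \<longleftrightarrow> transpose M = M \<and> (\<forall>x. x \<noteq> 0 \<longrightarrow> 0 < x \<bullet> (M *v x))"

definition pos_semidef_mat :: "real^'n^'n \<Rightarrow> bool" where
  "pos_semidef_mat M \<longleftrightarrow> transpose M = M \<and> (\<forall>x. 0 \<le> x \<bullet> (M *v x))"


section \<open>The linear program\<close>

definition lp_feasible :: "real^'d^'m \<Rightarrow> real^'m \<Rightarrow> (real^'d) set" where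
  "lp_feasible A b = {x. A *v x = b \<and> (\<forall>i. 0 \<le> x $ i)}"

definition lp_vertices :: "real^'d^'m \<Rightarrow> real^'m \<Rightarrow> (real^'d) set" where
  "lp_vertices A b = {x. x extreme_point_of lp_feasible A b}"

definition lp_opt :: "real^'d^'m \<Rightarrow> real^'m \<Rightarrow> real^'d \<Rightarrow> (real^'d) set" where
  "lp_opt A b c = argmin_set (\<lambda>x. c \<bullet> x) (lp_feasible A b)"

definition lp_setting :: "real^'d^'m \<Rightarrow> real^'m \<Rightarrow> bool" where
  "lp_setting A b \<longleftrightarrow>
     lp_feasible A b \<noteq> {} \<and> bounded (lp_feasible A b) \<and> rank A = CARD('m) \<and>
     (\<forall>x\<in>lp_vertices A b. card {i. 0 < x $ i} = CARD('m))"

text \<open>Borel measurability of the oracle is the implicit condition under which the SPO risk below is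
  a genuine expectation.\<close>

definition lp_oracle :: "real^'d^'m \<Rightarrow> real^'m \<Rightarrow> (real^'d \<Rightarrow> real^'d) \<Rightarrow> bool" where
  "lp_oracle A b xs \<longleftrightarrow>
     xs \<in> borel_measurable borel \<and> (\<forall>v. xs v \<in> lp_vertices A b \<and> xs v \<in> lp_opt A b v)"

definition ellipsoid :: "real^'d \<Rightarrow> real^'d^'d \<Rightarrow> (real^'d) set" where
  "ellipsoid c0 Sig = {c. (c - c0) \<bullet> (matrix_inv Sig *v (c - c0)) \<le> 1}"

definition reachable_vertices :: "real^'d^'m \<Rightarrow> real^'m \<Rightarrow> (real^'d) set \<Rightarrow> (real^'d) set" where
  "reachable_vertices A b C = (\<Union>c\<in>C. lp_opt A b c \<inter> lp_vertices A b)"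

definition dstar :: "real^'d^'m \<Rightarrow> real^'m \<Rightarrow> (real^'d) set \<Rightarrow> nat" where
  "dstar A b C =
     dim (span {x - x' | x x'. x \<in> reachable_vertices A b C \<and> x' \<in> reachable_vertices A b C})"

definition omega_X :: "real^'d^'m \<Rightarrow> real^'m \<Rightarrow> (real^'d) set \<Rightarrow> real" where
  "omega_X A b C =
     (SUP c\<in>C. (SUP x\<in>lp_feasible A b. c \<bullet> x) - (INF x\<in>lp_feasible A b. c \<bullet> x))"

definition tie_costs :: "real^'d^'m \<Rightarrow> real^'m \<Rightarrow> (real^'d) set" where
  "tie_costs A b =
     {c. \<exists>x\<in>lp_vertices A b. \<exists>x'\<in>lp_vertices A b. x \<noteq> x' \<and> x \<in> lp_opt A b c \<and> x' \<in> lp_opt A b c}"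

text \<open>The distance to the empty set is infinite; the library's \<open>infdist\<close> would make it zero and
  so exclude the case of a one-point feasible set from the margin condition.\<close>

definition edist_set :: "real^'d \<Rightarrow> (real^'d) set \<Rightarrow> ereal" where
  "edist_set v S = (INF s\<in>S. ereal (dist v s))"


section \<open>Bases and edge directions\<close>

text \<open>\<open>A\<^sub>B\<close> is treated as the linear map \<open>v \<mapsto> A v\<close> on the coordinate subspace of vectors supported in
  \<open>B\<close>, so \<open>A\<^sub>B\<^sup>-\<^sup>1 y\<close> appears as a vector of the full space with zero entries outside \<open>B\<close>.\<close>

definition supported :: "'d set \<Rightarrow> (real^'d) set" where
  "supported B = {v. \<forall>k. k \<notin> B \<longrightarrow> v $ k = 0}"

definition is_basis :: "real^'d^'m \<Rightarrow> 'd set \<Rightarrow> bool" where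
  "is_basis A B \<longleftrightarrow> card B = CARD('m) \<and> bij_betw (\<lambda>v. A *v v) (supported B) UNIV"

definition basis_solve :: "real^'d^'m \<Rightarrow> 'd set \<Rightarrow> real^'m \<Rightarrow> real^'d" where
  "basis_solve A B = inv_into (supported B) (\<lambda>v. A *v v)"

definition optimal_bases :: "real^'d^'m \<Rightarrow> real^'m \<Rightarrow> real^'d \<Rightarrow> 'd set set" where
  "optimal_bases A b c =
     {B. is_basis A B \<and> basis_solve A B b \<in> lp_feasible A b \<and> basis_solve A B b \<in> lp_opt A b c}"

definition edge_dir :: "real^'d^'m \<Rightarrow> 'd set \<Rightarrow> 'd \<Rightarrow> real^'d" where
  "edge_dir A B j = axis j 1 - basis_solve A B (column j A)"


section \<open>The discovery algorithms\<close>

definition measurements :: "real^'d \<Rightarrow> (real^'d \<Rightarrow> real)" where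
  "measurements c = (\<lambda>q. q \<bullet> c)"

definition consistent_costs :: "(real^'d) set \<Rightarrow> (real^'d) set \<Rightarrow> (real^'d \<Rightarrow> real) \<Rightarrow> (real^'d) set" where
  "consistent_costs C D s = {c'\<in>C. \<forall>q\<in>D. q \<bullet> c' = s q}"

text \<open>Deterministic tie-breaking: each field receives the current cost, the current dataset (and, for
  the minimizing cost, the index \<open>j\<close>) and the set of tied candidates. Since the finite choices may
  depend on the cost vector in an arbitrary way, they are required to be measurable in it.\<close>

record ('d::finite) tie_rule =
  pick_basis :: "real^'d \<Rightarrow> (real^'d) set \<Rightarrow> 'd set set \<Rightarrow> 'd set"
  pick_out :: "real^'d \<Rightarrow> (real^'d) set \<Rightarrow> 'd \<Rightarrow> (real^'d) set \<Rightarrow> real^'d"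
  pick_min :: "real^'d \<Rightarrow> (real^'d) set \<Rightarrow> 'd set \<Rightarrow> 'd"
  pick_pivot :: "real^'d \<Rightarrow> (real^'d) set \<Rightarrow> 'd set \<Rightarrow> 'd"

definition valid_tie_rule :: "('d::finite) tie_rule \<Rightarrow> bool" where
  "valid_tie_rule R \<longleftrightarrow>
     (\<forall>c D S. S \<noteq> {} \<longrightarrow> pick_basis R c D S \<in> S) \<and>
     (\<forall>c D j S. S \<noteq> {} \<longrightarrow> pick_out R c D j S \<in> S) \<and>
     (\<forall>c D S. S \<noteq> {} \<longrightarrow> pick_min R c D S \<in> S) \<and>
     (\<forall>c D S. S \<noteq> {} \<longrightarrow> pick_pivot R c D S \<in> S) \<and>
     (\<forall>D S. (\<lambda>c. pick_basis R c D S) \<in> measurable borel (count_space UNIV)) \<and>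
     (\<forall>D S. (\<lambda>c. pick_min R c D S) \<in> measurable borel (count_space UNIV)) \<and>
     (\<forall>D S. (\<lambda>c. pick_pivot R c D S) \<in> measurable borel (count_space UNIV))"

text \<open>One pass through the loop of the discovery algorithm \<open>alg1\<close>: \<open>None\<close> means that the algorithm returns the
  current dataset, \<open>Some q\<close> that it adds the query \<open>q\<close>. If \<open>N\<close> is empty there is nothing to check and
  the algorithm returns.\<close>

definition alg1_query ::
  "real^'d^'m \<Rightarrow> real^'m \<Rightarrow> (real^'d) set \<Rightarrow> 'd tie_rule \<Rightarrow> real^'d \<Rightarrow> (real^'d) set \<Rightarrow> (real^'d) option"
where
  "alg1_query A b C R c D =
    (let B = pick_basis R c D (optimal_bases A b c);
         N = - B;
         Ck = consistent_costs C D (measurements c);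
         \<delta> = edge_dir A B;
         m = (\<lambda>j. INF c'\<in>Ck. c' \<bullet> \<delta> j);
         cj = (\<lambda>j. pick_out R c D j (argmin_set (\<lambda>c'. c' \<bullet> \<delta> j) Ck));
         j0 = pick_min R c D (argmin_set m N);
         cout = cj j0
     in if N = {} \<or> m j0 \<ge> 0 then None
        else
          (let J = {j\<in>N. cout \<bullet> \<delta> j < 0};
               \<alpha> = (\<lambda>j. (c \<bullet> \<delta> j) / (c \<bullet> \<delta> j - cout \<bullet> \<delta> j));
               jstar = pick_pivot R c D (argmin_set \<alpha> J)
           in Some (\<delta> jstar)))"

definition alg1 ::
  "real^'d^'m \<Rightarrow> real^'m \<Rightarrow> (real^'d) set \<Rightarrow> 'd tie_rule \<Rightarrow> real^'d \<Rightarrow> (real^'d) set \<Rightarrow> (real^'d) set"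
where
  "alg1 A b C R c =
     while (\<lambda>D. alg1_query A b C R c D \<noteq> None) (\<lambda>D. D \<union> {the (alg1_query A b C R c D)})"

primrec alg2_state ::
  "real^'d^'m \<Rightarrow> real^'m \<Rightarrow> (real^'d) set \<Rightarrow> 'd tie_rule \<Rightarrow> (nat \<Rightarrow> real^'d) \<Rightarrow> nat \<Rightarrow> (real^'d) set"
where
  "alg2_state A b C R cs 0 = {}"
| "alg2_state A b C R cs (Suc i) = alg1 A b C R (cs (Suc i)) (alg2_state A b C R cs i)"

definition alg2 ::
  "real^'d^'m \<Rightarrow> real^'m \<Rightarrow> (real^'d) set \<Rightarrow> 'd tie_rule \<Rightarrow> (nat \<Rightarrow> real^'d) \<Rightarrow> nat \<Rightarrow>
     (real^'d) set \<times> nat set"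
where
  "alg2 A b C R cs n =
     (alg2_state A b C R cs n,
      {i\<in>{1..n}. alg2_state A b C R cs i \<noteq> alg2_state A b C R cs (i - 1)})"


section \<open>Least squares and the lifted predictor\<close>

definition is_ols :: "real^'d \<Rightarrow> nat \<Rightarrow> (nat \<Rightarrow> (real^'p) \<times> (real^'d)) \<Rightarrow> real^'p^'d \<Rightarrow> bool" where
  "is_ols c0 n z M \<longleftrightarrow>
     is_arg_min (\<lambda>M. \<Sum>i=1..n. (norm (snd (z i) - c0 - M *v fst (z i)))\<^sup>2) (\<lambda>_. True) M"

text \<open>The dimension \<open>t\<close> of the discovered subspace is random, so \<open>d \<times> t\<close> matrices are given by
  their columns \<open>U 0, \<dots>, U (t - 1)\<close>, \<open>t \<times> p\<close> matrices by their rows, and \<open>t \<times> t\<close> matrices by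
  entries with indices below \<open>t\<close>.\<close>

definition orthonormal_basis_of :: "(nat \<Rightarrow> real^'d) \<Rightarrow> (real^'d) set \<Rightarrow> bool" where
  "orthonormal_basis_of U W \<longleftrightarrow>
     (\<forall>i<dim W. \<forall>j<dim W. U i \<bullet> U j = of_bool (i = j)) \<and> span (U ` {..<dim W}) = W"

definition mat_inv_upto :: "nat \<Rightarrow> (nat \<Rightarrow> nat \<Rightarrow> real) \<Rightarrow> (nat \<Rightarrow> nat \<Rightarrow> real)" where
  "mat_inv_upto t G =
     (SOME H. \<forall>i<t. \<forall>j<t. (\<Sum>k<t. G i k * H k j) = of_bool (i = j) \<and>
                             (\<Sum>k<t. H i k * G k j) = of_bool (i = j))"

text \<open>\<open>lift Sig U t s\<close> is \<open>\<Sigma> U (U\<^sup>T \<Sigma> U)\<^sup>-\<^sup>1 s\<close> for \<open>s\<close> with \<open>t\<close> entries.\<close>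

definition lift :: "real^'d^'d \<Rightarrow> (nat \<Rightarrow> real^'d) \<Rightarrow> nat \<Rightarrow> (nat \<Rightarrow> real) \<Rightarrow> real^'d" where
  "lift Sig U t s =
     (let H = mat_inv_upto t (\<lambda>i j. U i \<bullet> (Sig *v U j))
      in Sig *v (\<Sum>i<t. (\<Sum>j<t. H i j * s j) *\<^sub>R U i))"

definition lifted_predictor ::
  "real^'d \<Rightarrow> real^'d^'d \<Rightarrow> (nat \<Rightarrow> real^'d) \<Rightarrow> nat \<Rightarrow> (real^'p \<Rightarrow> real^'d) \<Rightarrow> real^'p \<Rightarrow> real^'d"
where
  "lifted_predictor c0 Sig U t f \<xi> = c0 + lift Sig U t (\<lambda>i. U i \<bullet> (f \<xi> - c0))"

definition lifted_class ::
  "real^'d \<Rightarrow> real^'d^'d \<Rightarrow> (nat \<Rightarrow> real^'d) \<Rightarrow> nat \<Rightarrow> (real^'p \<Rightarrow> real^'d) set"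
where
  "lifted_class c0 Sig U t =
     {f. \<exists>B :: nat \<Rightarrow> real^'p. f = (\<lambda>\<xi>. c0 + lift Sig U t (\<lambda>i. B i \<bullet> \<xi>))}"


section \<open>The statistical model\<close>

text \<open>\<open>P\<close> is the joint law of \<open>(\<xi>, c)\<close>.\<close>

definition xi_law :: "((real^'p) \<times> (real^'d)) measure \<Rightarrow> (real^'p) measure" where
  "xi_law P = distr P borel fst"

definition xi_algebra :: "((real^'p) \<times> (real^'d)) measure \<Rightarrow> ((real^'p) \<times> (real^'d)) measure" where
  "xi_algebra P = vimage_algebra (space P) fst borel"

definition is_cond_mean :: "((real^'p) \<times> (real^'d)) measure \<Rightarrow> (real^'p \<Rightarrow> real^'d) \<Rightarrow> bool" where
  "is_cond_mean P mu \<longleftrightarrow>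
     mu \<in> borel_measurable borel \<and>
     (\<forall>k. AE z in P. real_cond_exp P (xi_algebra P) (\<lambda>z. snd z $ k) z = mu (fst z) $ k)"

definition spo_risk ::
  "((real^'p) \<times> (real^'d)) measure \<Rightarrow> (real^'d \<Rightarrow> real^'d) \<Rightarrow> (real^'p \<Rightarrow> real^'d) \<Rightarrow> real"
where
  "spo_risk P xs f = (\<integral>z. snd z \<bullet> xs (f (fst z)) - snd z \<bullet> xs (snd z) \<partial>P)"

definition bounded_design_ols ::
  "((real^'p) \<times> (real^'d)) measure \<Rightarrow> real^'d \<Rightarrow> real^'p^'d \<Rightarrow> real \<Rightarrow> real \<Rightarrow> bool"
where
  "bounded_design_ols P c0 Amu \<kappa> \<sigma> \<longleftrightarrow>
     (let \<epsilon> = (\<lambda>z. snd z - c0 - Amu *v fst z) in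
       (\<forall>k. AE z in P. real_cond_exp P (xi_algebra P) (\<lambda>z. \<epsilon> z $ k) z = 0) \<and>
       (AE z in P. norm (fst z) \<le> 1) \<and>
       0 < \<kappa> \<and>
       pos_semidef_mat ((\<chi> i j. \<integral>z. fst z $ i * fst z $ j \<partial>P) - \<kappa> *\<^sub>R mat 1) \<and>
       0 \<le> \<sigma> \<and>
       (\<forall>l u. norm u = 1 \<longrightarrow>
         (AE z in P. real_cond_exp P (xi_algebra P) (\<lambda>z. exp (l * (u \<bullet> \<epsilon> z))) z
                       \<le> exp (l\<^sup>2 * \<sigma>\<^sup>2 / 2))))"

text \<open>The joint law of the regression sample and the discovery contexts.\<close>

definition stage1_law ::
  "((real^'p) \<times> (real^'d)) measure \<Rightarrow> nat \<Rightarrow> nat \<Rightarrow>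
     ((nat \<Rightarrow> (real^'p) \<times> (real^'d)) \<times> (nat \<Rightarrow> real^'p)) measure"
where
  "stage1_law P n_mu n_disc =
     (PiM {1..n_mu} (\<lambda>_. P)) \<Otimes>\<^sub>M (PiM {1..n_disc} (\<lambda>_. xi_law P))"

definition ols_radius :: "real \<Rightarrow> real \<Rightarrow> nat \<Rightarrow> nat \<Rightarrow> nat \<Rightarrow> real \<Rightarrow> real" where
  "ols_radius \<sigma> \<kappa> d p n \<delta> =
     4 * sqrt 2 * (\<sigma> / sqrt \<kappa>) * sqrt (real d * (real p + ln (4 * real d / \<delta>)) / real n)"

end

theory Submission
  imports Defs
begin

text \<open>
  A fresh context can be decided differently by the lifted predictor and by the conditional mean
  only if the discovered data do not resolve its pseudo-cost, or if its mean cost lies within the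
  estimation error of a tie. The bound adds the probabilities of these two events.

  \<^bold>\<open>Geometry.\<close> Data \<open>D\<close> resolve a cost if one vertex is optimal for all costs of the ellipsoid with the
  same measurements on \<open>D\<close>. Discovery stops only at data that resolve the current cost
  (\<open>alg1_sufficient\<close>). The lifted prediction is the projection of the plug-in prediction for the
  inner product of the ellipsoid, so it stays in the ellipsoid and has the same measurements
  (\<open>lifted_cost\<close>): both predictions share an optimal vertex, which the oracle must choose at a cost
  without ties. If the mean cost is farther from the ties than from the plug-in prediction, the same
  vertex is optimal for it, because the segment between the two costs is connected
  (\<open>decision_stable\<close>). Each query is an optimal edge at a cost of the ellipsoid and is linearly
  independent of the earlier ones (\<open>alg1_query_Some\<close>), which gives \<open>|T| \<le> |D| \<le> d\<^sup>\<star>\<close>.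

  \<^bold>\<open>Generalization.\<close> Discovery is stable: dropping the contexts that caused no update does not change
  the data. The indices fall into \<open>2 k\<close> residue classes; \<open>k\<close> updating indices meet at most \<open>k\<close> of
  them, and the other classes form an independent test sample of at least a quarter of the points, on
  which the data make no mistake. A union bound over the at most \<open>4\<^sup>k\<close> choices of classes and over
  \<open>k\<close> yields \<open>compression_bound\<close>.

  \<^bold>\<open>Least squares.\<close> The smallest eigenvalue of the design matrix has to be bounded below with a
  failure probability that is only linear in the dimension. The potential
  \<open>tr (I - t \<Sum> x x\<^sup>T)\<^sup>q\<close> with \<open>q\<close> proportional to the sample size does this: a rank-one step lowers it
  by a fixed fraction in expectation (\<open>potential_step\<close>), and a small eigenvalue would keep it large.
  The rank-one estimate needs only that the moments \<open>v \<bullet> Q\<^sup>k v\<close> of a positive operator are positively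
  associated (\<open>mom_association\<close>). For the noise, the exponential supermartingale in a direction \<open>w\<close> is
  integrated against a Gaussian density in \<open>w\<close> whose covariance is that of the design
  (\<open>mixture_expectation\<close>); completing the square turns the mixture into an exponential of the
  estimation error in the norm of the design (\<open>good_noise_bound\<close>).

  Finally, a predictor is replaced by another at a cost of at most \<open>\<omega>\<close> per disagreement
  (\<open>spo_risk_le_disagreement\<close>), and the best lifted predictor is no worse than the one just analysed.
\<close>


section \<open>Vertices and bases of the linear program\<close>

lemma argmin_set_iff: "x \<in> argmin_set f S \<longleftrightarrow> x \<in> S \<and> (\<forall>y\<in>S. f x \<le> f y)"
  by (auto simp: argmin_set_def is_arg_min_linorder)

lemma argmin_set_nonempty:
  assumes "finite S" "S \<noteq> {}"
  shows "argmin_set f S \<noteq> {}"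
proof -
  obtain x where "is_arg_min f (\<lambda>x. x \<in> S) x"
    using ex_is_arg_min_if_finite[OF assms] by blast
  then show ?thesis by (auto simp: argmin_set_def)
qed

lemma lp_opt_iff: "x \<in> lp_opt A b c \<longleftrightarrow> x \<in> lp_feasible A b \<and> (\<forall>y\<in>lp_feasible A b. c \<bullet> x \<le> c \<bullet> y)"
  by (simp add: lp_opt_def argmin_set_iff)

lemma polyhedron_lp_feasible: "polyhedron (lp_feasible A b)"
proof -
  have *: "lp_feasible A b = \<Inter> ((\<lambda>i. {x. row i A \<bullet> x = b $ i}) ` UNIV \<union> (\<lambda>i. {x. axis i 1 \<bullet> x \<ge> 0}) ` UNIV)"
    unfolding lp_feasible_def vec_eq_iff matrix_vector_mul_component row_def vec_nth_inverse inner_axis'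
    by auto
  show ?thesis
    unfolding * by (intro polyhedron_Inter) (auto simp: polyhedron_hyperplane polyhedron_halfspace_ge)
qed

lemma finite_lp_vertices: "finite (lp_vertices A b)"
  unfolding lp_vertices_def by (rule finite_polyhedron_extreme_points[OF polyhedron_lp_feasible])

lemma lp_vertices_feasible: "x \<in> lp_vertices A b \<Longrightarrow> x \<in> lp_feasible A b"
  by (simp add: lp_vertices_def extreme_point_of_def)

lemma compact_lp_feasible: "bounded (lp_feasible A b) \<Longrightarrow> compact (lp_feasible A b)"
  by (simp add: compact_eq_bounded_closed polyhedron_imp_closed polyhedron_lp_feasible)

lemma convex_lp_feasible: "convex (lp_feasible A b)"
  by (simp add: polyhedron_imp_convex polyhedron_lp_feasible)

lemma lp_opt_nonempty:
  assumes "lp_feasible A b \<noteq> {}" "bounded (lp_feasible A b)"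
  shows "lp_opt A b c \<noteq> {}"
proof -
  have "continuous_on (lp_feasible A b) (\<lambda>x. c \<bullet> x)" by (intro continuous_intros)
  then obtain x where "x \<in> lp_feasible A b" "\<forall>y\<in>lp_feasible A b. c \<bullet> x \<le> c \<bullet> y"
    using continuous_attains_inf[OF compact_lp_feasible[OF assms(2)] assms(1)] by blast
  then have "x \<in> lp_opt A b c" by (simp add: lp_opt_iff)
  then show ?thesis by auto
qed

lemma lp_opt_face: "lp_opt A b c face_of lp_feasible A b"
proof (cases "lp_opt A b c = {}")
  case False
  then obtain x where x: "x \<in> lp_opt A b c" by auto
  have *: "lp_opt A b c = lp_feasible A b \<inter> {y. c \<bullet> y = c \<bullet> x}"
    using x by (force simp: lp_opt_iff)
  show ?thesis unfolding *
    by (rule face_of_Int_supporting_hyperplane_ge) (use x in \<open>auto simp: lp_opt_iff convex_lp_feasible\<close>)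
qed auto

text \<open>The optimal face is itself a polytope, and the extreme points of a face are extreme points of
  the whole feasible set; so optima are mixtures of optimal vertices.\<close>

lemma lp_opt_eq_hull:
  assumes "bounded (lp_feasible A b)"
  shows "lp_opt A b c = convex hull (lp_opt A b c \<inter> lp_vertices A b)"
proof -
  have "compact (lp_opt A b c)"
    using face_of_imp_compact[OF convex_lp_feasible compact_lp_feasible[OF assms] lp_opt_face] .
  moreover have "convex (lp_opt A b c)" using face_of_imp_convex[OF lp_opt_face] .
  ultimately have "lp_opt A b c = convex hull {x. x extreme_point_of lp_opt A b c}"
    by (rule Krein_Milman_Minkowski)
  also have "{x. x extreme_point_of lp_opt A b c} = lp_opt A b c \<inter> lp_vertices A b"
    by (auto simp: extreme_point_of_face[OF lp_opt_face] lp_vertices_def)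
  finally show ?thesis .
qed

lemma lp_opt_vertex_exists:
  assumes "lp_feasible A b \<noteq> {}" "bounded (lp_feasible A b)"
  obtains x where "x \<in> lp_opt A b c" "x \<in> lp_vertices A b"
  using lp_opt_nonempty[OF assms, of c] lp_opt_eq_hull[OF assms(2), of c]
  by (metis Int_iff convex_hull_empty ex_in_conv)

text \<open>A kernel direction supported on the positive coordinates could be followed both ways from a
  vertex, which would make the vertex a midpoint.\<close>

lemma lp_vertex_kernel_trivial:
  assumes x: "x \<in> lp_vertices A b" and v: "v \<in> supported {i. 0 < x $ i}" "A *v v = 0"
  shows "v = 0"
proof (rule ccontr)
  assume "v \<noteq> 0"
  have xf: "A *v x = b" "\<And>i. 0 \<le> x $ i"
    using lp_vertices_feasible[OF x] by (auto simp: lp_feasible_def)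
  have ev: "eventually (\<lambda>s. \<forall>i. 0 < x $ i \<longrightarrow> \<bar>s * v $ i\<bar> < x $ i) (at_right (0::real))"
  proof (rule eventually_all_finite, rule eventually_mono)
    fix i
    have "((\<lambda>s. \<bar>s * v $ i\<bar>) \<longlongrightarrow> \<bar>0 * v $ i\<bar>) (at_right (0::real))" by (intro tendsto_intros)
    then show "eventually (\<lambda>s. 0 < x $ i \<longrightarrow> \<bar>s * v $ i\<bar> < x $ i) (at_right 0)"
      by (cases "0 < x $ i") (auto dest: order_tendstoD)
  qed auto
  obtain s :: real where s: "s > 0" "\<forall>i. 0 < x $ i \<longrightarrow> \<bar>s * v $ i\<bar> < x $ i"
  proof -
    have "eventually (\<lambda>s. s > 0 \<and> (\<forall>i. 0 < x $ i \<longrightarrow> \<bar>s * v $ i\<bar> < x $ i)) (at_right (0::real))"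
      using ev eventually_at_right_less[of 0] by eventually_elim auto
    then show ?thesis using that eventually_happens'[OF trivial_limit_at_right_real] by blast
  qed
  have f: "x + r *\<^sub>R v \<in> lp_feasible A b" if "\<bar>r\<bar> = s" for r
  proof -
    have "0 \<le> x $ i + r * v $ i" for i
    proof (cases "0 < x $ i")
      case True
      then have "\<bar>r * v $ i\<bar> < x $ i" using s that by (simp add: abs_mult)
      then show ?thesis by linarith
    next
      case False
      then show ?thesis using v(1) xf(2)[of i] by (auto simp: supported_def)
    qed
    then show ?thesis using v(2) xf(1)
      by (simp add: lp_feasible_def matrix_vector_right_distrib matrix_vector_mult_scaleR)
  qed
  have "x \<in> open_segment (x + s *\<^sub>R v) (x + (- s) *\<^sub>R v)"
    unfolding in_segment
  proof (intro conjI exI[of _ "1/2"])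
    show "x = (1 - 1/2) *\<^sub>R (x + s *\<^sub>R v) + (1/2) *\<^sub>R (x + (- s) *\<^sub>R v)"
      by (simp add: vec_eq_iff field_simps)
    obtain i where "v $ i \<noteq> 0" using \<open>v \<noteq> 0\<close> by (auto simp: vec_eq_iff)
    then show "x + s *\<^sub>R v \<noteq> x + (- s) *\<^sub>R v"
      using s(1) by (auto simp: vec_eq_iff intro!: exI[of _ i])
  qed auto
  then show False using x f[of s] f[of "-s"] s(1) by (auto simp: lp_vertices_def extreme_point_of_def)
qed

lemma lp_vertexI:
  assumes x: "x \<in> lp_feasible A b" "x \<in> supported B" and inj: "inj_on (\<lambda>v. A *v v) (supported B)"
  shows "x \<in> lp_vertices A b"
  unfolding lp_vertices_def extreme_point_of_def
proof (intro CollectI conjI ballI notI)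
  fix a a' assume a: "a \<in> lp_feasible A b" "a' \<in> lp_feasible A b" "x \<in> open_segment a a'"
  then obtain u where u: "a \<noteq> a'" "0 < u" "u < 1" "x = (1-u) *\<^sub>R a + u *\<^sub>R a'"
    by (auto simp: in_segment)
  have "a $ k = 0 \<and> a' $ k = 0" if "k \<notin> B" for k
  proof -
    have "(1-u) * a $ k + u * a' $ k = 0" using u(4) x(2) that by (auto simp: supported_def)
    moreover have "(1-u) * a $ k \<ge> 0" "u * a' $ k \<ge> 0"
      using u a(1,2) by (auto simp: lp_feasible_def)
    ultimately show ?thesis using u by (auto simp: add_nonneg_eq_0_iff)
  qed
  then have "a \<in> supported B" "a' \<in> supported B" by (auto simp: supported_def)
  moreover have "A *v a = A *v a'" using a by (simp add: lp_feasible_def)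
  ultimately show False using inj u(1) by (auto dest: inj_onD)
qed (fact x)

lemma subspace_supported: "subspace (supported B)"
  by (auto simp: subspace_def supported_def)

lemma dim_supported: "dim (supported B :: (real^'d) set) = card B"
  using dim_substandard_cart[where 'a=real and 'n='d, of B] by (simp add: supported_def dim_vec_eq)

lemma is_basisI:
  fixes A :: "real^'d^'m"
  assumes "card B = CARD('m)" and "\<And>v. v \<in> supported B \<Longrightarrow> A *v v = 0 \<Longrightarrow> v = 0"
  shows "is_basis A B"
proof -
  have lin: "linear (\<lambda>v. A *v v)" by (rule matrix_vector_mul_linear)
  have inj: "inj_on (\<lambda>v. A *v v) (supported B)"
    using assms(2) linear_inj_on_iff_eq_0[OF lin subspace_supported] by blast
  have "dim ((\<lambda>v. A *v v) ` supported B) = dim (supported B :: (real^'d) set)"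
    by (intro dim_image_eq[OF lin]) (use inj in \<open>simp add: span_eq_iff[THEN iffD2, OF subspace_supported]\<close>)
  also have "\<dots> = DIM(real^'m)" using assms(1) by (simp add: dim_supported)
  finally have "span ((\<lambda>v. A *v v) ` supported B) = UNIV" by (rule dim_eq_full[THEN iffD1])
  then have "(\<lambda>v. A *v v) ` supported B = UNIV"
    using linear_subspace_image[OF lin subspace_supported, of B] by (metis span_eq_iff)
  then show ?thesis using assms(1) inj by (auto simp: is_basis_def bij_betw_def)
qed

lemma basis_solve:
  assumes "is_basis A B"
  shows "basis_solve A B y \<in> supported B" "A *v basis_solve A B y = y"
  using assms inv_into_into[of y "\<lambda>v. A *v v" "supported B"] f_inv_into_f[of y "\<lambda>v. A *v v" "supported B"]
  by (auto simp: is_basis_def bij_betw_def basis_solve_def)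

lemma basis_solve_eqI:
  assumes "is_basis A B" "v \<in> supported B" "A *v v = y"
  shows "basis_solve A B y = v"
  using assms basis_solve[OF assms(1), of y] by (auto simp: is_basis_def bij_betw_def dest: inj_onD)

text \<open>The support of an optimal vertex is a basis: nondegeneracy gives it the right size and extremality
  makes its columns independent.\<close>

lemma optimal_bases_nonempty:
  fixes A :: "real^'d^'m"
  assumes lp: "lp_setting A b"
  shows "optimal_bases A b c \<noteq> {}"
proof -
  obtain x where x: "x \<in> lp_opt A b c" "x \<in> lp_vertices A b"
    using lp lp_opt_vertex_exists[of A b c] by (auto simp: lp_setting_def)
  have B: "is_basis A {i. 0 < x $ i}"
    by (rule is_basisI) (use lp x lp_vertex_kernel_trivial[OF x(2)] in \<open>auto simp: lp_setting_def\<close>)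
  have "x \<in> supported {i. 0 < x $ i}" "A *v x = b"
    using lp_vertices_feasible[OF x(2)] by (auto simp: lp_feasible_def supported_def order.antisym not_less)
  then have "basis_solve A {i. 0 < x $ i} b = x" by (intro basis_solve_eqI[OF B])
  then have "{i. 0 < x $ i} \<in> optimal_bases A b c"
    using B x lp_vertices_feasible[OF x(2)] by (auto simp: optimal_bases_def)
  then show ?thesis by auto
qed

lemma optimal_basis_vertex:
  assumes "B \<in> optimal_bases A b c"
  shows "basis_solve A B b \<in> lp_vertices A b"
  using assms basis_solve[of A B b]
  by (intro lp_vertexI[where B=B]) (auto simp: optimal_bases_def is_basis_def bij_betw_def)

lemma edge_dir:
  assumes "is_basis A B"
  shows "A *v edge_dir A B j = 0" "k \<notin> B \<Longrightarrow> edge_dir A B j $ k = of_bool (k = j)"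
proof -
  have "A *v axis j 1 = column j A" by (simp add: matrix_vector_mul_component vec_eq_iff
        matrix_vector_mult_def column_def axis_def if_distrib[where f="\<lambda>x. _ * x"] cong: if_cong)
  then show "A *v edge_dir A B j = 0" using basis_solve[OF assms, of "column j A"]
    by (simp add: edge_dir_def matrix_vector_mult_diff_distrib)
  show "edge_dir A B j $ k = of_bool (k = j)" if "k \<notin> B"
    using basis_solve(1)[OF assms, of "column j A"] that by (auto simp: edge_dir_def supported_def axis_def)
qed

text \<open>Nondegeneracy makes every basic coordinate of a basic feasible point positive, which leaves room
  to move along each edge direction.\<close>

lemma edge_step_feasible:
  fixes A :: "real^'d^'m"
  assumes lp: "lp_setting A b" and B: "B \<in> optimal_bases A b c" and j: "j \<notin> B"
  obtains s where "s > 0" "basis_solve A B b + s *\<^sub>R edge_dir A B j \<in> lp_feasible A b"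
proof -
  let ?x = "basis_solve A B b" and ?\<delta> = "edge_dir A B j"
  have bas: "is_basis A B" using B by (simp add: optimal_bases_def)
  have x: "?x \<in> lp_feasible A b" "?x \<in> supported B" using B basis_solve[OF bas] by (auto simp: optimal_bases_def)
  have "card {i. 0 < ?x $ i} = card B"
    using lp optimal_basis_vertex[OF B] bas by (auto simp: lp_setting_def is_basis_def)
  moreover have "{i. 0 < ?x $ i} \<subseteq> B" using x(2) by (force simp: supported_def)
  ultimately have pos: "{i. 0 < ?x $ i} = B" by (intro card_subset_eq) auto
  have "eventually (\<lambda>s. \<forall>i. i \<in> B \<longrightarrow> 0 < ?x $ i + s * ?\<delta> $ i) (at_right (0::real))"
  proof (rule eventually_all_finite, cases)
    fix i assume "i \<in> B"
    then have "0 < ?x $ i + 0 * ?\<delta> $ i" using pos by auto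
    moreover have "((\<lambda>s. ?x $ i + s * ?\<delta> $ i) \<longlongrightarrow> ?x $ i + 0 * ?\<delta> $ i) (at_right (0::real))"
      by (intro tendsto_intros)
    ultimately show "eventually (\<lambda>s. i \<in> B \<longrightarrow> 0 < ?x $ i + s * ?\<delta> $ i) (at_right 0)"
      by (auto dest: order_tendstoD)
  qed auto
  then have "eventually (\<lambda>s. s > 0 \<and> (\<forall>i. i \<in> B \<longrightarrow> 0 < ?x $ i + s * ?\<delta> $ i)) (at_right (0::real))"
    using eventually_at_right_less[of 0] by eventually_elim auto
  then obtain s where s: "s > 0" "\<And>i. i \<in> B \<Longrightarrow> 0 < ?x $ i + s * ?\<delta> $ i"
    using eventually_happens'[OF trivial_limit_at_right_real] by blast
  have "0 \<le> ?x $ i + s * ?\<delta> $ i" for i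
    using s(1) s(2)[of i] edge_dir(2)[OF bas, of i j] x(2) by (cases "i \<in> B") (auto simp: supported_def)
  then have "?x + s *\<^sub>R ?\<delta> \<in> lp_feasible A b"
    using x(1) edge_dir(1)[OF bas, of j]
    by (simp add: lp_feasible_def matrix_vector_right_distrib matrix_vector_mult_scaleR)
  then show ?thesis using that s(1) by blast
qed

lemma reduced_cost_nonneg:
  assumes "lp_setting A b" "B \<in> optimal_bases A b c" "j \<notin> B"
  shows "0 \<le> c \<bullet> edge_dir A B j"
proof -
  obtain s where s: "s > 0" "basis_solve A B b + s *\<^sub>R edge_dir A B j \<in> lp_feasible A b"
    using edge_step_feasible[OF assms] .
  have "c \<bullet> basis_solve A B b \<le> c \<bullet> (basis_solve A B b + s *\<^sub>R edge_dir A B j)"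
    using assms(2) s(2) by (simp add: optimal_bases_def lp_opt_iff)
  then show ?thesis using s(1) by (simp add: inner_add_right zero_le_mult_iff)
qed

text \<open>A displacement between feasible points lies in the kernel of the constraint matrix, hence is the
  combination of edge directions given by its nonbasic coordinates.\<close>

lemma basis_optimalI:
  assumes bas: "is_basis A B" "basis_solve A B b \<in> lp_feasible A b"
    and c: "\<And>j. j \<notin> B \<Longrightarrow> 0 \<le> c \<bullet> edge_dir A B j"
  shows "basis_solve A B b \<in> lp_opt A b c"
  unfolding lp_opt_iff
proof (intro conjI ballI bas(2))
  let ?x = "basis_solve A B b"
  fix y assume y: "y \<in> lp_feasible A b"
  define v where "v = (\<Sum>j\<in>-B. y $ j *\<^sub>R edge_dir A B j)"
  have Av: "A *v v = 0"
    unfolding v_def by (simp add: linear_sum[OF matrix_vector_mul_linear] matrix_vector_mult_scaleR edge_dir(1)[OF bas(1)])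
  have vk: "v $ k = y $ k" if "k \<notin> B" for k
    using that by (simp add: v_def edge_dir(2)[OF bas(1)] if_distrib sum.delta cong: if_cong)
  have "y - v \<in> supported B" using vk by (simp add: supported_def)
  moreover have "A *v (y - v) = b" using y Av by (simp add: lp_feasible_def matrix_vector_mult_diff_distrib)
  ultimately have "?x = y - v" by (intro basis_solve_eqI[OF bas(1)])
  then have "c \<bullet> y = c \<bullet> ?x + c \<bullet> v" by (simp add: inner_diff_right)
  moreover have "c \<bullet> v \<ge> 0"
    unfolding v_def inner_sum_right using c y by (intro sum_nonneg) (auto simp: lp_feasible_def)
  ultimately show "c \<bullet> ?x \<le> c \<bullet> y" by simp
qed


section \<open>Correctness of the discovery algorithm\<close>

definition edge_dirs :: "real^'d^'m \<Rightarrow> (real^'d) set" where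
  "edge_dirs A = range (\<lambda>(B, j). edge_dir A B j)"

lemma finite_edge_dirs: "finite (edge_dirs A)"
  unfolding edge_dirs_def by simp

lemma edge_dir_in_edge_dirs: "edge_dir A B j \<in> edge_dirs A"
  unfolding edge_dirs_def by auto

definition reach_span :: "real^'d^'m \<Rightarrow> real^'m \<Rightarrow> (real^'d) set \<Rightarrow> (real^'d) set" where
  "reach_span A b C =
     span {x - x' | x x'. x \<in> reachable_vertices A b C \<and> x' \<in> reachable_vertices A b C}"

lemma dim_reach_span: "dim (reach_span A b C) = dstar A b C"
  by (simp add: reach_span_def dstar_def)

text \<open>That the data resolve a cost is expressed by a vertex rather than by a basis: the basis chosen for a
  cost may change with the data, while this condition is preserved when data are added.\<close>

definition sufficient :: "real^'d^'m \<Rightarrow> real^'m \<Rightarrow> (real^'d) set \<Rightarrow> (real^'d) set \<Rightarrow> real^'d \<Rightarrow> bool" where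
  "sufficient A b C D c \<longleftrightarrow>
     (\<exists>x\<in>lp_vertices A b. \<forall>c'\<in>consistent_costs C D (measurements c). x \<in> lp_opt A b c')"

lemma consistent_costs_iff:
  "c' \<in> consistent_costs C D (measurements c) \<longleftrightarrow> c' \<in> C \<and> (\<forall>q\<in>D. q \<bullet> c' = q \<bullet> c)"
  by (simp add: consistent_costs_def measurements_def)

lemma sufficient_mono: "sufficient A b C D c \<Longrightarrow> D \<subseteq> D' \<Longrightarrow> sufficient A b C D' c"
  unfolding sufficient_def by (fastforce simp: consistent_costs_iff)

lemma hull_diff_in_span:
  assumes "u \<in> convex hull V" "v \<in> convex hull V"
  shows "u - v \<in> span {x - x' | x x'. x \<in> V \<and> x' \<in> V}"
proof -
  let ?W = "span {x - x' | x x'. x \<in> V \<and> x' \<in> V}"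
  from assms(1) have "V \<noteq> {}" by auto
  then obtain z where z: "z \<in> V" by auto
  have "convex ((+) z ` ?W)" by (rule convex_translation[OF subspace_imp_convex[OF subspace_span]])
  moreover have "V \<subseteq> (+) z ` ?W"
  proof
    fix x assume "x \<in> V"
    then have "x - z \<in> ?W" using z by (intro span_base) auto
    then show "x \<in> (+) z ` ?W" by (intro image_eqI[of _ _ "x - z"]) auto
  qed
  ultimately have "convex hull V \<subseteq> (+) z ` ?W" by (rule hull_minimal[rotated])
  then obtain w w' where "u = z + w" "v = z + w'" "w \<in> ?W" "w' \<in> ?W" using assms by blast
  then show ?thesis using span_diff[of w _ w'] by simp
qed

locale discovery =
  fixes A :: "real^'d^'m" and b :: "real^'m" and C :: "(real^'d) set" and R :: "'d tie_rule"
  assumes lp: "lp_setting A b" and ties: "valid_tie_rule R"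
    and compact_C: "compact C" and convex_C: "convex C"
begin

lemma compact_consistent: "compact (consistent_costs C D s)"
proof -
  have "consistent_costs C D s = C \<inter> (\<Inter>q\<in>D. {c'. q \<bullet> c' = s q})"
    by (auto simp: consistent_costs_def)
  also have "compact \<dots>" by (intro compact_Int_closed compact_C closed_INT ballI closed_hyperplane)
  finally show ?thesis .
qed

lemma convex_consistent: "convex (consistent_costs C D s)"
proof -
  have "consistent_costs C D s = C \<inter> (\<Inter>q\<in>D. {c'. q \<bullet> c' = s q})"
    by (auto simp: consistent_costs_def)
  also have "convex \<dots>" by (intro convex_Int convex_C convex_INT convex_hyperplane)
  finally show ?thesis .
qed

lemma consistent_self: "c \<in> C \<Longrightarrow> c \<in> consistent_costs C D (measurements c)"
  by (simp add: consistent_costs_iff)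

lemma bdd_consistent: "bdd_below ((\<lambda>c'. c' \<bullet> v) ` consistent_costs C D s)"
  by (intro bounded_imp_bdd_below compact_imp_bounded compact_continuous_image compact_consistent
      continuous_intros)

lemma argmin_consistent_nonempty:
  assumes "c \<in> C" shows "argmin_set (\<lambda>c'. c' \<bullet> v) (consistent_costs C D (measurements c)) \<noteq> {}"
proof -
  have "continuous_on (consistent_costs C D (measurements c)) (\<lambda>x. x \<bullet> v)" by (intro continuous_intros)
  then obtain x where "x \<in> consistent_costs C D (measurements c)"
      "\<forall>y\<in>consistent_costs C D (measurements c). x \<bullet> v \<le> y \<bullet> v"
    using continuous_attains_inf[OF compact_consistent _ , of D "measurements c" "\<lambda>x. x \<bullet> v"]
      consistent_self[OF assms] by blast
  then have "x \<in> argmin_set (\<lambda>c'. c' \<bullet> v) (consistent_costs C D (measurements c))"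
    by (simp add: argmin_set_iff)
  then show ?thesis by auto
qed

lemma argmin_consistent_value:
  assumes "x \<in> argmin_set (\<lambda>c'. c' \<bullet> v) (consistent_costs C D s)"
  shows "(INF c'\<in>consistent_costs C D s. c' \<bullet> v) = x \<bullet> v"
  using assms by (intro cInf_eq_minimum) (auto simp: argmin_set_iff)

lemma pick_basis_optimal: "pick_basis R c D (optimal_bases A b c) \<in> optimal_bases A b c"
  using ties optimal_bases_nonempty[OF lp, of c] by (simp add: valid_tie_rule_def)

text \<open>On the segment from \<open>c\<close> to the violating cost, the first cost at which some reduced cost vanishes
  keeps the current basis optimal, so the whole edge is optimal for it and lies in the span of
  differences of its optimal vertices. The edge is new because the two ends of the segment agree on
  the data but not on the edge.\<close>

lemma alg1_query_Some:
  assumes c: "c \<in> C" and q: "alg1_query A b C R c D = Some q"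
  shows "q \<in> edge_dirs A" "q \<in> reach_span A b C" "q \<notin> span D"
proof -
  define B where "B = pick_basis R c D (optimal_bases A b c)"
  define Ck where "Ck = consistent_costs C D (measurements c)"
  define \<delta> where "\<delta> = edge_dir A B"
  define m where "m = (\<lambda>j. INF c'\<in>Ck. c' \<bullet> \<delta> j)"
  define j0 where "j0 = pick_min R c D (argmin_set m (- B))"
  define cout where "cout = pick_out R c D j0 (argmin_set (\<lambda>c'. c' \<bullet> \<delta> j0) Ck)"
  define J where "J = {j\<in>-B. cout \<bullet> \<delta> j < 0}"
  define \<alpha> where "\<alpha> = (\<lambda>j. (c \<bullet> \<delta> j) / (c \<bullet> \<delta> j - cout \<bullet> \<delta> j))"
  define js where "js = pick_pivot R c D (argmin_set \<alpha> J)"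
  note defs = B_def Ck_def \<delta>_def m_def j0_def cout_def J_def \<alpha>_def js_def
  have N: "- B \<noteq> {}" and m0: "m j0 < 0" and qeq: "q = \<delta> js"
    using q by (auto simp: alg1_query_def Let_def defs split: if_splits)
  have B: "B \<in> optimal_bases A b c" using pick_basis_optimal by (simp add: B_def)
  then have bas: "is_basis A B" "basis_solve A B b \<in> lp_feasible A b" by (auto simp: optimal_bases_def)
  have j0: "j0 \<in> - B"
    using ties argmin_set_nonempty[of "-B" m] N
    unfolding j0_def valid_tie_rule_def by (metis argmin_set_iff finite_code)
  have cout: "cout \<in> argmin_set (\<lambda>c'. c' \<bullet> \<delta> j0) Ck"
    using ties argmin_consistent_nonempty[OF c, of "\<delta> j0" D] by (simp add: cout_def valid_tie_rule_def Ck_def)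
  then have cCk: "cout \<in> Ck" by (simp add: argmin_set_iff)
  have "cout \<bullet> \<delta> j0 < 0" using argmin_consistent_value[of cout "\<delta> j0" D] cout m0
    by (simp add: m_def Ck_def)
  then have "J \<noteq> {}" using j0 by (auto simp: J_def)
  then have js: "js \<in> argmin_set \<alpha> J"
    using ties argmin_set_nonempty[of J \<alpha>] by (simp add: js_def valid_tie_rule_def)
  then have jsN: "js \<notin> B" and neg: "cout \<bullet> \<delta> js < 0" by (auto simp: argmin_set_iff J_def)
  have rc: "0 \<le> c \<bullet> \<delta> j" if "j \<notin> B" for j using reduced_cost_nonneg[OF lp B that] by (simp add: \<delta>_def)
  show "q \<in> edge_dirs A" by (simp add: qeq \<delta>_def edge_dir_in_edge_dirs)
  show "q \<notin> span D"
  proof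
    assume "q \<in> span D"
    moreover have "D \<subseteq> {v. (cout - c) \<bullet> v = 0}"
      using cCk by (auto simp: Ck_def consistent_costs_iff inner_diff_left inner_commute[of cout] inner_commute[of c])
    ultimately have "(cout - c) \<bullet> q = 0"
      using span_minimal[OF _ subspace_hyperplane, of D "cout - c"] by auto
    then show False using neg rc[OF jsN] by (simp add: qeq inner_diff_left)
  qed
  define a where "a = \<alpha> js"
  have a: "0 \<le> a" "a \<le> 1" using rc[OF jsN] neg by (auto simp: a_def \<alpha>_def divide_simps)
  define ca where "ca = (1 - a) *\<^sub>R c + a *\<^sub>R cout"
  have ca: "ca \<in> Ck"
    unfolding ca_def using convex_consistent consistent_self[OF c, of D] cCk a
    by (intro convexD_alt) (auto simp: Ck_def)
  have caC: "ca \<in> C" using ca by (simp add: Ck_def consistent_costs_iff)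
  have ca0: "ca \<bullet> \<delta> js = 0"
  proof -
    have "a * (c \<bullet> \<delta> js - cout \<bullet> \<delta> js) = c \<bullet> \<delta> js"
      using neg rc[OF jsN] by (simp add: a_def \<alpha>_def)
    then show ?thesis by (simp add: ca_def inner_add_left algebra_simps)
  qed
  \<comment> \<open>Minimality of the ratio at \<open>js\<close> keeps every other reduced cost nonnegative up to \<open>ca\<close>.\<close>
  have "0 \<le> ca \<bullet> \<delta> j" if j: "j \<notin> B" for j
  proof (cases "cout \<bullet> \<delta> j < 0")
    case True
    then have "a \<le> \<alpha> j" using js j by (auto simp: argmin_set_iff J_def a_def)
    then have "a * (c \<bullet> \<delta> j - cout \<bullet> \<delta> j) \<le> c \<bullet> \<delta> j"
      using True rc[OF j] by (simp add: \<alpha>_def pos_le_divide_eq)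
    then show ?thesis by (simp add: ca_def inner_add_left algebra_simps)
  next
    case False
    then show ?thesis using rc[OF j] a by (simp add: ca_def inner_add_left)
  qed
  then have xopt: "basis_solve A B b \<in> lp_opt A b ca" by (intro basis_optimalI bas) (simp add: \<delta>_def)
  obtain s where s: "s > 0" "basis_solve A B b + s *\<^sub>R \<delta> js \<in> lp_feasible A b"
    using edge_step_feasible[OF lp B jsN] by (auto simp: \<delta>_def)
  then have yopt: "basis_solve A B b + s *\<^sub>R \<delta> js \<in> lp_opt A b ca"
    using xopt ca0 by (simp add: lp_opt_iff inner_add_right)
  have "basis_solve A B b + s *\<^sub>R \<delta> js - basis_solve A B b \<in>
      span {x - x' | x x'. x \<in> lp_opt A b ca \<inter> lp_vertices A b \<and> x' \<in> lp_opt A b ca \<inter> lp_vertices A b}"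
    using xopt yopt lp_opt_eq_hull[of A b ca] lp
    by (intro hull_diff_in_span) (auto simp: lp_setting_def)
  also have "\<dots> \<subseteq> reach_span A b C"
    unfolding reach_span_def reachable_vertices_def using caC by (intro span_mono) blast
  finally have "s *\<^sub>R \<delta> js \<in> reach_span A b C" by simp
  then have "(1/s) *\<^sub>R s *\<^sub>R \<delta> js \<in> reach_span A b C" unfolding reach_span_def by (rule span_scale)
  then show "q \<in> reach_span A b C" using s(1) by (simp add: qeq)
qed

lemma alg1_query_None:
  assumes c: "c \<in> C" and q: "alg1_query A b C R c D = None"
  shows "sufficient A b C D c"
proof -
  define B where "B = pick_basis R c D (optimal_bases A b c)"
  define Ck where "Ck = consistent_costs C D (measurements c)"
  define m where "m = (\<lambda>j. INF c'\<in>Ck. c' \<bullet> edge_dir A B j)"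
  define j0 where "j0 = pick_min R c D (argmin_set m (- B))"
  have N: "- B = {} \<or> m j0 \<ge> 0"
    using q by (auto simp: alg1_query_def Let_def B_def Ck_def m_def j0_def split: if_splits)
  have B: "B \<in> optimal_bases A b c" using pick_basis_optimal by (simp add: B_def)
  have m: "0 \<le> m j" if "j \<notin> B" for j
  proof -
    have "j0 \<in> argmin_set m (- B)"
      using ties argmin_set_nonempty[of "-B" m] that
      unfolding j0_def valid_tie_rule_def by (metis ComplI empty_iff finite_code)
    then have "m j0 \<le> m j" using that by (simp add: argmin_set_iff)
    then show ?thesis using N that by auto
  qed
  have "basis_solve A B b \<in> lp_opt A b c'" if "c' \<in> Ck" for c'
  proof (rule basis_optimalI)
    fix j assume "j \<notin> B"
    from m[OF this] show "0 \<le> c' \<bullet> edge_dir A B j"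
      using cINF_lower[OF bdd_consistent that[unfolded Ck_def], of "edge_dir A B j"]
      by (simp add: m_def Ck_def)
  qed (use B in \<open>auto simp: optimal_bases_def\<close>)
  then show ?thesis using optimal_basis_vertex[OF B] by (auto simp: sufficient_def Ck_def)
qed

definition datasets :: "(real^'d) set set" where
  "datasets = {D. D \<subseteq> edge_dirs A \<and> D \<subseteq> reach_span A b C \<and> independent D}"

lemma finite_datasets: "finite datasets"
  by (rule finite_subset[of _ "Pow (edge_dirs A)"]) (auto simp: datasets_def finite_edge_dirs)

lemma empty_dataset: "{} \<in> datasets" by (simp add: datasets_def independent_empty)

lemma dataset_card: "D \<in> datasets \<Longrightarrow> finite D \<and> card D \<le> dstar A b C"
  using independent_card_le_dim[of D "reach_span A b C"] finite_subset[OF _ finite_edge_dirs]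
  by (auto simp: datasets_def dim_reach_span)

lemma dataset_step:
  assumes "c \<in> C" "D \<in> datasets" "alg1_query A b C R c D = Some q"
  shows "D \<union> {q} \<in> datasets" "q \<notin> D"
  using alg1_query_Some[OF assms(1,3)] assms(2)
  by (auto simp: datasets_def independent_insertI span_base)

lemma alg1:
  assumes c: "c \<in> C" and D: "D \<in> datasets"
  shows "alg1 A b C R c D \<in> datasets \<and> D \<subseteq> alg1 A b C R c D \<and>
    alg1_query A b C R c (alg1 A b C R c D) = None"
  unfolding alg1_def
proof (rule while_rule[where P="\<lambda>D'. D' \<in> datasets \<and> D \<subseteq> D'" and r="Wellfounded.measure (\<lambda>D. dstar A b C - card D)"])
  fix s assume s: "s \<in> datasets \<and> D \<subseteq> s" and q: "alg1_query A b C R c s \<noteq> None"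
  then obtain q where q: "alg1_query A b C R c s = Some q" by auto
  note st = dataset_step[OF c _ q]
  show "s \<union> {the (alg1_query A b C R c s)} \<in> datasets \<and> D \<subseteq> s \<union> {the (alg1_query A b C R c s)}"
    using st s q by auto
  have "card (s \<union> {q}) = Suc (card s)" using st s dataset_card[of s] by simp
  then show "(s \<union> {the (alg1_query A b C R c s)}, s) \<in> Wellfounded.measure (\<lambda>D. dstar A b C - card D)"
    using st s q dataset_card[of "s \<union> {q}"] by (auto simp: less_diff_conv)
qed (use D in auto)

lemma alg1_sufficient:
  assumes "c \<in> C" "D \<in> datasets" shows "sufficient A b C (alg1 A b C R c D) c"
  using alg1[OF assms] alg1_query_None[OF assms(1)] by blast

definition alg1_step :: "real^'d \<Rightarrow> (real^'d) set \<Rightarrow> (real^'d) set" where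
  "alg1_step c D = (case alg1_query A b C R c D of None \<Rightarrow> D | Some q \<Rightarrow> insert q D)"

text \<open>Bounding the number of iterations turns the loop into a finite composition, to which closure
  properties of measurable functions apply.\<close>

lemma alg1_eq_funpow:
  assumes c: "c \<in> C" and "D \<in> datasets" and "dstar A b C - card D \<le> k"
  shows "alg1 A b C R c D = (alg1_step c ^^ k) D"
  using assms(2,3)
proof (induction k arbitrary: D)
  case 0
  have "alg1_query A b C R c D = None"
  proof (rule ccontr)
    assume "alg1_query A b C R c D \<noteq> None"
    then obtain q where q: "alg1_query A b C R c D = Some q" by auto
    have "card (D \<union> {q}) = Suc (card D)" using dataset_step[OF c 0(1) q] dataset_card[OF 0(1)] by simp
    then show False using dataset_card[OF dataset_step(1)[OF c 0(1) q]] 0(2) by simp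
  qed
  then show ?case by (simp add: alg1_def while_unfold[of _ _ D])
next
  case (Suc k)
  show ?case
  proof (cases "alg1_query A b C R c D")
    case None
    then have "alg1_step c D = D" by (simp add: alg1_step_def)
    then have "(alg1_step c ^^ Suc k) D = D" by (induction k) (auto simp: funpow_swap1)
    then show ?thesis using None by (simp add: alg1_def while_unfold[of _ _ D])
  next
    case (Some q)
    have "card (D \<union> {q}) = Suc (card D)" using dataset_step[OF c Suc(2) Some] dataset_card[OF Suc(2)] by simp
    then have "alg1 A b C R c (D \<union> {q}) = (alg1_step c ^^ k) (D \<union> {q})"
      using Suc(3) by (intro Suc.IH dataset_step[OF c Suc(2) Some]) simp
    moreover have "alg1 A b C R c D = alg1 A b C R c (D \<union> {q})"
      using Some by (simp add: alg1_def while_unfold[of _ _ D])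
    moreover have "alg1_step c D = D \<union> {q}" using Some by (simp add: alg1_step_def)
    ultimately show ?thesis by (simp add: funpow_Suc_right del: funpow.simps)
  qed
qed

end


section \<open>Measurability of the discovery algorithm\<close>

lemma measurable_finite_set_valued:
  fixes f :: "'x \<Rightarrow> 'i::finite set"
  assumes "\<And>i. Measurable.pred M (\<lambda>x. i \<in> f x)"
  shows "f \<in> measurable M (count_space UNIV)"
  unfolding measurable_count_space_eq2_countable
proof (intro conjI ballI)
  fix S :: "'i set"
  have *: "(\<lambda>x. f x = S) = (\<lambda>x. \<forall>i. (i \<in> f x) = (i \<in> S))" by (auto simp: fun_eq_iff)
  have "Measurable.pred M (\<lambda>x. f x = S)" unfolding * using assms by measurable
  then show "f -` {S} \<inter> space M \<in> sets M"
    by (simp add: pred_def vimage_def Int_def conj_commute)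
qed auto

lemma measurable_argmin_set:
  fixes f :: "'x \<Rightarrow> 'i::finite \<Rightarrow> real"
  assumes [measurable]: "\<And>i. (\<lambda>x. f x i) \<in> borel_measurable M" "\<And>i. Measurable.pred M (\<lambda>x. i \<in> S x)"
  shows "(\<lambda>x. argmin_set (f x) (S x)) \<in> measurable M (count_space UNIV)"
proof (rule measurable_finite_set_valued)
  fix i
  have *: "(\<lambda>x. i \<in> argmin_set (f x) (S x)) = (\<lambda>x. i \<in> S x \<and> (\<forall>y. y \<in> S x \<longrightarrow> f x i \<le> f x y))"
    by (auto simp: fun_eq_iff argmin_set_iff)
  show "Measurable.pred M (\<lambda>x. i \<in> argmin_set (f x) (S x))" unfolding * by measurable
qed

text \<open>Existence of a consistent cost with a closed property is a closed condition on the observed cost,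
  because projections of compact sets are compact.\<close>

lemma compact_project:
  fixes C F :: "(real^'d) set"
  assumes "compact C" "closed F"
  shows "compact {c\<in>C. \<exists>c'\<in>C \<inter> F. \<forall>q\<in>D. q \<bullet> c' = q \<bullet> c}"
proof -
  let ?A = "{p :: (real^'d) \<times> (real^'d). \<forall>q\<in>D. q \<bullet> snd p = q \<bullet> fst p}"
  have "closed {p :: (real^'d) \<times> (real^'d). q \<bullet> snd p = q \<bullet> fst p}" for q
    by (intro closed_Collect_eq continuous_intros)
  then have "closed (\<Inter>q\<in>D. {p :: (real^'d) \<times> (real^'d). q \<bullet> snd p = q \<bullet> fst p})" by blast
  also have "(\<Inter>q\<in>D. {p :: (real^'d) \<times> (real^'d). q \<bullet> snd p = q \<bullet> fst p}) = ?A" by auto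
  finally have "compact ((C \<times> (C \<inter> F)) \<inter> ?A)"
    using assms by (intro compact_Int_closed compact_Times) auto
  then have "compact (fst ` ((C \<times> (C \<inter> F)) \<inter> ?A))" by (intro compact_continuous_image continuous_intros)
  also have "fst ` ((C \<times> (C \<inter> F)) \<inter> ?A) = {c\<in>C. \<exists>c'\<in>C \<inter> F. \<forall>q\<in>D. q \<bullet> c' = q \<bullet> c}"
    unfolding image_def Bex_def split_paired_Ex by (intro Collect_cong) auto
  finally show ?thesis .
qed

locale strict_discovery = discovery A b C R
  for A :: "real^'d^'m" and b :: "real^'m" and C :: "(real^'d) set" and R :: "'d tie_rule" +
  assumes strict_C: "\<And>x y. x \<in> C \<Longrightarrow> y \<in> C \<Longrightarrow> x \<noteq> y \<Longrightarrow> midpoint x y \<in> interior C"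
begin

abbreviation costM :: "(real^'d) measure" where "costM \<equiv> restrict_space borel C"

lemma space_costM: "space costM = C" by (simp add: space_restrict_space)

lemma sets_costM: "X \<in> sets borel \<Longrightarrow> X \<subseteq> C \<Longrightarrow> X \<in> sets costM"
  using compact_C by (simp add: sets_restrict_space_iff compact_imp_closed)

lemma pred_costM: "{c\<in>C. Q c} \<in> sets borel \<Longrightarrow> Measurable.pred costM Q"
  by (simp add: pred_def space_costM sets_costM)

definition reaches :: "(real^'d) set \<Rightarrow> (real^'d) set \<Rightarrow> real^'d \<Rightarrow> bool" where
  "reaches D F c \<longleftrightarrow> (\<exists>c'\<in>consistent_costs C D (measurements c). c' \<in> F)"

lemma reaches_measurable:
  assumes "closed F" shows "Measurable.pred costM (reaches D F)"
proof (rule pred_costM)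
  have "{c\<in>C. reaches D F c} = {c\<in>C. \<exists>c'\<in>C \<inter> F. \<forall>q\<in>D. q \<bullet> c' = q \<bullet> c}"
    unfolding reaches_def Bex_def Int_iff consistent_costs_iff by (simp only: conj_ac)
  then show "{c\<in>C. reaches D F c} \<in> sets borel"
    using compact_project[OF compact_C assms, of D] by (simp add: borel_compact)
qed

definition low :: "(real^'d) set \<Rightarrow> real^'d \<Rightarrow> real^'d \<Rightarrow> real" where
  "low D v c = (INF c'\<in>consistent_costs C D (measurements c). c' \<bullet> v)"

lemma low_le_iff:
  assumes "c \<in> C" shows "low D v c \<le> a \<longleftrightarrow> reaches D {c'. c' \<bullet> v \<le> a} c"
proof -
  obtain x where x: "x \<in> argmin_set (\<lambda>c'. c' \<bullet> v) (consistent_costs C D (measurements c))"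
    using argmin_consistent_nonempty[OF assms] by blast
  have lx: "low D v c = x \<bullet> v" using argmin_consistent_value[OF x] by (simp add: low_def)
  show ?thesis
  proof
    assume "low D v c \<le> a"
    then show "reaches D {c'. c' \<bullet> v \<le> a} c"
      using x lx unfolding reaches_def by (intro bexI[of _ x]) (auto simp: argmin_set_iff)
  next
    assume "reaches D {c'. c' \<bullet> v \<le> a} c"
    then obtain c' where c': "c' \<in> consistent_costs C D (measurements c)" "c' \<bullet> v \<le> a"
      by (auto simp: reaches_def)
    have "x \<bullet> v \<le> c' \<bullet> v" using x c'(1) unfolding argmin_set_iff by blast
    then show "low D v c \<le> a" using lx c'(2) by linarith
  qed
qed

lemma closed_low_halfspace: "closed {c' :: real^'d. c' \<bullet> v \<le> a}"
  by (intro closed_Collect_le continuous_intros)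

lemma low_measurable [measurable]: "low D v \<in> borel_measurable costM"
proof (rule borel_measurableI_le)
  fix a
  have "Measurable.pred costM (reaches D {c'. c' \<bullet> v \<le> a})" by (rule reaches_measurable[OF closed_low_halfspace])
  then have "{c\<in>space costM. reaches D {c'. c' \<bullet> v \<le> a} c} \<in> sets costM" by (simp add: pred_def)
  also have "{c\<in>space costM. reaches D {c'. c' \<bullet> v \<le> a} c} = {c\<in>space costM. low D v c \<le> a}"
    by (simp add: space_costM low_le_iff cong: conj_cong)
  finally show "{c\<in>space costM. low D v c \<le> a} \<in> sets costM" .
qed

lemma optimal_bases_measurable: "optimal_bases A b \<in> measurable costM (count_space UNIV)"
proof (rule measurable_finite_set_valued, rule pred_costM)
  fix B
  let ?x = "basis_solve A B b"
  have "closed (\<Inter>y\<in>lp_feasible A b. {c. c \<bullet> ?x \<le> c \<bullet> y})"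
    by (intro closed_INT ballI closed_Collect_le continuous_intros)
  then have "closed (C \<inter> (\<Inter>y\<in>lp_feasible A b. {c. c \<bullet> ?x \<le> c \<bullet> y}))"
    by (rule closed_Int[OF compact_imp_closed[OF compact_C]])
  moreover have "{c \<in> C. B \<in> optimal_bases A b c} =
     (if is_basis A B \<and> ?x \<in> lp_feasible A b then C \<inter> (\<Inter>y\<in>lp_feasible A b. {c. c \<bullet> ?x \<le> c \<bullet> y}) else {})"
    by (auto simp: optimal_bases_def lp_opt_iff)
  ultimately show "{c \<in> C. B \<in> optimal_bases A b c} \<in> sets borel" by auto
qed

text \<open>Two different minimizers would have a midpoint interior to \<open>C\<close>; pushing it away from \<open>c\<close>, where
  the functional is larger, would decrease the minimum. So the minimizing cost is determined by \<open>c\<close>,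
  which is the source of its measurability.\<close>

lemma argmin_unique:
  assumes c: "c \<in> C" and m: "low D v c < c \<bullet> v"
    and x: "x \<in> argmin_set (\<lambda>c'. c' \<bullet> v) (consistent_costs C D (measurements c))"
    and y: "y \<in> argmin_set (\<lambda>c'. c' \<bullet> v) (consistent_costs C D (measurements c))"
  shows "x = y"
proof (rule ccontr)
  assume "x \<noteq> y"
  have xC: "x \<in> C" "y \<in> C" and agree: "\<And>q. q \<in> D \<Longrightarrow> q \<bullet> x = q \<bullet> c" "\<And>q. q \<in> D \<Longrightarrow> q \<bullet> y = q \<bullet> c"
    using x y by (auto simp: argmin_set_iff consistent_costs_iff)
  define z where "z = midpoint x y"
  have "z \<in> interior C" using strict_C xC \<open>x \<noteq> y\<close> by (simp add: z_def)
  then obtain e where e: "e > 0" "ball z e \<subseteq> C" by (auto simp: mem_interior)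
  define s where "s = e / (2 * (norm (z - c) + 1))"
  have s: "s > 0" using e(1) by (auto simp: s_def intro!: divide_pos_pos add_nonneg_pos mult_pos_pos)
  have "s * norm (z - c) < e"
  proof -
    have "s * norm (z - c) \<le> s * (norm (z - c) + 1)" using s by simp
    also have "\<dots> = e / 2" by (simp add: s_def field_simps add_nonneg_eq_0_iff)
    finally show ?thesis using e(1) by simp
  qed
  then have "z + s *\<^sub>R (z - c) \<in> C" using e s by (intro subsetD[OF e(2)]) (simp add: dist_norm)
  moreover have "q \<bullet> (z + s *\<^sub>R (z - c)) = q \<bullet> c" if "q \<in> D" for q
    using agree[OF that] by (simp add: z_def midpoint_def inner_add_right inner_diff_right)
  ultimately have "z + s *\<^sub>R (z - c) \<in> consistent_costs C D (measurements c)"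
    by (simp add: consistent_costs_iff)
  then have "x \<bullet> v \<le> (z + s *\<^sub>R (z - c)) \<bullet> v" using x by (simp add: argmin_set_iff)
  moreover have "x \<bullet> v = low D v c" "y \<bullet> v = low D v c"
    using argmin_consistent_value[OF x] argmin_consistent_value[OF y] by (auto simp: low_def)
  then have "z \<bullet> v = low D v c" by (simp add: z_def midpoint_def inner_add_left)
  ultimately have "0 \<le> s * (low D v c - c \<bullet> v)"
    using \<open>x \<bullet> v = _\<close> by (simp add: inner_add_left inner_diff_left)
  then show False using s m by (simp add: zero_le_mult_iff)
qed

definition out_cost :: "(real^'d) set \<Rightarrow> 'd set \<Rightarrow> 'd \<Rightarrow> real^'d \<Rightarrow> real^'d" where
  "out_cost D B j0 c =
     pick_out R c D j0 (argmin_set (\<lambda>c'. c' \<bullet> edge_dir A B j0) (consistent_costs C D (measurements c)))"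

definition violated :: "(real^'d) set \<Rightarrow> 'd set \<Rightarrow> 'd \<Rightarrow> real^'d \<Rightarrow> bool" where
  "violated D B j0 c \<longleftrightarrow> B \<in> optimal_bases A b c \<and> j0 \<notin> B \<and> low D (edge_dir A B j0) c < 0"

lemma violated_measurable [measurable]: "Measurable.pred costM (violated D B j0)"
proof -
  have "Measurable.pred costM (\<lambda>c. B \<in> optimal_bases A b c)"
    by (rule measurable_compose[OF optimal_bases_measurable, of "\<lambda>S. B \<in> S"]) simp
  moreover have "Measurable.pred costM (\<lambda>c. low D (edge_dir A B j0) c < 0)" by measurable
  moreover have "Measurable.pred costM (\<lambda>c. j0 \<notin> B)" by simp
  ultimately show ?thesis unfolding violated_def 
    by (intro pred_intros_logic(3))
qed

text \<open>By compactness the unique minimizer lies in a closed half-space as soon as the half-space contains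
  near-minimizers at every rational level above the minimum: countably many closed conditions.\<close>

lemma out_cost_le_iff:
  assumes c: "c \<in> C" and viol: "violated D B j0 c"
  shows "out_cost D B j0 c \<bullet> w \<le> a \<longleftrightarrow>
    (\<forall>r::rat. low D (edge_dir A B j0) c < of_rat r \<longrightarrow>
        reaches D ({c'. c' \<bullet> w \<le> a} \<inter> {c'. c' \<bullet> edge_dir A B j0 \<le> of_rat r}) c)"
proof -
  let ?v = "edge_dir A B j0" and ?Ck = "consistent_costs C D (measurements c)"
  have am: "out_cost D B j0 c \<in> argmin_set (\<lambda>c'. c' \<bullet> ?v) ?Ck"
    using ties argmin_consistent_nonempty[OF c, of ?v D] by (simp add: out_cost_def valid_tie_rule_def)
  have val: "out_cost D B j0 c \<bullet> ?v = low D ?v c"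
    using argmin_consistent_value[OF am] by (simp add: low_def)
  have lt: "low D ?v c < c \<bullet> ?v"
    using reduced_cost_nonneg[OF lp, of B c j0] viol by (auto simp: violated_def)
  show ?thesis
  proof
    assume "out_cost D B j0 c \<bullet> w \<le> a"
    then show "\<forall>r::rat. low D ?v c < of_rat r \<longrightarrow>
        reaches D ({c'. c' \<bullet> w \<le> a} \<inter> {c'. c' \<bullet> ?v \<le> of_rat r}) c"
      using am val unfolding reaches_def
      by (intro allI impI bexI[of _ "out_cost D B j0 c"]) (auto simp: argmin_set_iff)
  next
    assume *: "\<forall>r::rat. low D ?v c < of_rat r \<longrightarrow>
        reaches D ({c'. c' \<bullet> w \<le> a} \<inter> {c'. c' \<bullet> ?v \<le> of_rat r}) c"
    let ?K = "?Ck \<inter> {c'. c' \<bullet> w \<le> a}"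
    have K: "compact ?K" using compact_consistent closed_low_halfspace by (rule compact_Int_closed)
    obtain r0 where "low D ?v c < of_rat r0" using of_rat_dense[of "low D ?v c" "low D ?v c + 1"] by auto
    then have "?K \<noteq> {}" using * unfolding reaches_def by blast
    then have "\<exists>x\<in>?K. \<forall>y\<in>?K. x \<bullet> ?v \<le> y \<bullet> ?v"
      by (rule continuous_attains_inf[OF K]) (intro continuous_intros)
    then show "out_cost D B j0 c \<bullet> w \<le> a"
    proof (rule bexE)
      fix x assume x: "x \<in> ?K" "\<forall>y\<in>?K. x \<bullet> ?v \<le> y \<bullet> ?v"
      have le: "x \<bullet> ?v \<le> low D ?v c"
      proof (rule ccontr)
        assume "\<not> x \<bullet> ?v \<le> low D ?v c"
        then have "low D ?v c < x \<bullet> ?v" by linarith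
        from of_rat_dense[OF this] obtain r where r: "low D ?v c < of_rat r" "of_rat r < x \<bullet> ?v" by blast
        then have "reaches D ({c'. c' \<bullet> w \<le> a} \<inter> {c'. c' \<bullet> ?v \<le> of_rat r}) c" using * by simp
        then obtain c' where c': "c' \<in> ?Ck" "c' \<in> {c'. c' \<bullet> w \<le> a} \<inter> {c'. c' \<bullet> ?v \<le> of_rat r}"
          unfolding reaches_def by (rule bexE)
        then have "c' \<in> ?K" "c' \<bullet> ?v \<le> of_rat r" by auto
        then show False using bspec[OF x(2), of c'] r(2) by linarith
      qed
      have "x \<bullet> ?v \<le> y \<bullet> ?v" if "y \<in> ?Ck" for y
      proof -
        have "out_cost D B j0 c \<bullet> ?v \<le> y \<bullet> ?v" using am that by (simp add: argmin_set_iff)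
        then show ?thesis using le val by linarith
      qed
      then have "x \<in> argmin_set (\<lambda>c'. c' \<bullet> ?v) ?Ck"
        using x(1) by (simp add: argmin_set_iff)
      then have "x = out_cost D B j0 c" by (rule argmin_unique[OF c lt _ am])
      then show "out_cost D B j0 c \<bullet> w \<le> a" using x(1) by auto
    qed
  qed
qed

lemma out_cost_measurable [measurable]:
  "(\<lambda>c. if violated D B j0 c then out_cost D B j0 c \<bullet> w else 0) \<in> borel_measurable costM"
proof (rule borel_measurableI_le)
  fix a :: real
  let ?Q = "\<lambda>c. \<forall>r::rat. low D (edge_dir A B j0) c < of_rat r \<longrightarrow>
        reaches D ({c'. c' \<bullet> w \<le> a} \<inter> {c'. c' \<bullet> edge_dir A B j0 \<le> of_rat r}) c"
  have "Measurable.pred costM (reaches D ({c'. c' \<bullet> w \<le> a} \<inter> {c'. c' \<bullet> edge_dir A B j0 \<le> of_rat r}))" for r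
    by (intro reaches_measurable closed_Int closed_low_halfspace)
  moreover have "Measurable.pred costM (\<lambda>c. low D (edge_dir A B j0) c < of_rat r)" for r by measurable
  ultimately have q: "Measurable.pred costM ?Q"
    by (intro pred_intros_countable(1) pred_intros_logic(4))
  have 1: "Measurable.pred costM (\<lambda>c. violated D B j0 c \<and> ?Q c)"
    using violated_measurable q by (rule pred_intros_logic(3))
  have "Measurable.pred costM (\<lambda>c. \<not> violated D B j0 c)"
    using violated_measurable by (rule pred_intros_logic(2))
  moreover have "Measurable.pred costM (\<lambda>c. 0 \<le> a)" by simp
  ultimately have 2: "Measurable.pred costM (\<lambda>c. \<not> violated D B j0 c \<and> 0 \<le> a)" by (rule pred_intros_logic(3))
  have "Measurable.pred costM (\<lambda>c. (violated D B j0 c \<and> ?Q c) \<or> (\<not> violated D B j0 c \<and> 0 \<le> a))"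
    using 1 2 by (rule pred_intros_logic(5))
  then have 3: "{c \<in> space costM. (violated D B j0 c \<and> ?Q c) \<or> (\<not> violated D B j0 c \<and> 0 \<le> a)} \<in> sets costM"
    unfolding pred_def .
  have 4: "{c \<in> space costM. (if violated D B j0 c then out_cost D B j0 c \<bullet> w else 0) \<le> a} =
     {c \<in> space costM. (violated D B j0 c \<and> ?Q c) \<or> (\<not> violated D B j0 c \<and> 0 \<le> a)}"
  proof (rule Collect_cong, rule conj_cong[OF refl])
    fix c assume "c \<in> space costM"
    then have "c \<in> C" by (simp only: space_costM)
    note * = out_cost_le_iff[OF this, of D B j0 w a]
    show "((if violated D B j0 c then out_cost D B j0 c \<bullet> w else 0) \<le> a) =
      ((violated D B j0 c \<and> ?Q c) \<or> (\<not> violated D B j0 c \<and> 0 \<le> a))"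
    proof (cases "violated D B j0 c")
      case True
      then show ?thesis using *[OF True] by (simp only: if_True simp_thms)
    qed (simp only: if_False simp_thms)
  qed
  show "{c \<in> space costM. (if violated D B j0 c then out_cost D B j0 c \<bullet> w else 0) \<le> a} \<in> sets costM"
    using 3 by (rule ssubst[OF 4])
qed

text \<open>The query for a fixed basis and a fixed violating index, so that the measurable choice of these two
  can be composed afterwards. The value 0 is a dummy for costs at which no violation occurs.\<close>

definition query_at :: "(real^'d) set \<Rightarrow> 'd set \<Rightarrow> 'd \<Rightarrow> real^'d \<Rightarrow> (real^'d) option" where
  "query_at D B j0 c =
    (if - B = {} \<or> 0 \<le> low D (edge_dir A B j0) c then None
     else (let oc = (\<lambda>j. if violated D B j0 c then out_cost D B j0 c \<bullet> edge_dir A B j else 0)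
       in Some (edge_dir A B (pick_pivot R c D (argmin_set
            (\<lambda>j. (c \<bullet> edge_dir A B j) / (c \<bullet> edge_dir A B j - oc j)) {j\<in>-B. oc j < 0})))))"

lemma tie_measurable:
  "(\<lambda>c. pick_basis R c D S) \<in> measurable costM (count_space UNIV)"
  "(\<lambda>c. pick_min R c D T) \<in> measurable costM (count_space UNIV)"
  "(\<lambda>c. pick_pivot R c D T) \<in> measurable costM (count_space UNIV)"
  using ties by (auto simp: valid_tie_rule_def intro!: measurable_restrict_space1)

lemma id_costM [measurable]: "(\<lambda>c. c) \<in> borel_measurable costM"
  by (intro measurable_restrict_space1) simp

lemma query_at_measurable: "query_at D B j0 \<in> measurable costM (count_space UNIV)"
proof -
  define oc where "oc = (\<lambda>c j. if violated D B j0 c then out_cost D B j0 c \<bullet> edge_dir A B j else 0)"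
  have ocm [measurable]: "(\<lambda>c. oc c j) \<in> borel_measurable costM" for j by (simp add: oc_def)
  have "(\<lambda>c. argmin_set (\<lambda>j. (c \<bullet> edge_dir A B j) / (c \<bullet> edge_dir A B j - oc c j)) {j\<in>-B. oc c j < 0})
     \<in> measurable costM (count_space UNIV)"
  proof (rule measurable_argmin_set)
    show "(\<lambda>c. (c \<bullet> edge_dir A B j) / (c \<bullet> edge_dir A B j - oc c j)) \<in> borel_measurable costM" for j
      by (intro borel_measurable_divide borel_measurable_diff borel_measurable_inner id_costM borel_measurable_const ocm)
    fix i
    have "Measurable.pred costM (\<lambda>c. i \<in> - B)" by simp
    moreover have "Measurable.pred costM (\<lambda>c. oc c i < 0)" by measurable
    ultimately have "Measurable.pred costM (\<lambda>c. i \<in> - B \<and> oc c i < 0)" by (rule pred_intros_logic(3))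
    then show "Measurable.pred costM (\<lambda>c. i \<in> {j\<in>-B. oc c j < 0})" unfolding mem_Collect_eq .
  qed
  then have "(\<lambda>c. pick_pivot R c D (argmin_set (\<lambda>j. (c \<bullet> edge_dir A B j) / (c \<bullet> edge_dir A B j - oc c j)) {j\<in>-B. oc c j < 0}))
     \<in> measurable costM (count_space UNIV)"
    by (rule measurable_compose_countable[OF tie_measurable(3)])
  then have 1: "(\<lambda>c. Some (edge_dir A B (pick_pivot R c D (argmin_set (\<lambda>j. (c \<bullet> edge_dir A B j) / (c \<bullet> edge_dir A B j - oc c j)) {j\<in>-B. oc c j < 0}))))
     \<in> measurable costM (count_space UNIV)"
    by (rule measurable_compose) simp
  have "Measurable.pred costM (\<lambda>c. - B = {})" by simp
  moreover have "Measurable.pred costM (\<lambda>c. 0 \<le> low D (edge_dir A B j0) c)" by measurable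
  ultimately have "Measurable.pred costM (\<lambda>c. - B = {} \<or> 0 \<le> low D (edge_dir A B j0) c)"
    by (rule pred_intros_logic(5))
  then have 2: "{c \<in> space costM. - B = {} \<or> 0 \<le> low D (edge_dir A B j0) c} \<in> sets costM"
    unfolding pred_def .
  have 3: "query_at D B j0 = (\<lambda>c. if - B = {} \<or> 0 \<le> low D (edge_dir A B j0) c then None
     else Some (edge_dir A B (pick_pivot R c D (argmin_set
       (\<lambda>j. (c \<bullet> edge_dir A B j) / (c \<bullet> edge_dir A B j - oc c j)) {j\<in>-B. oc c j < 0}))))"
    unfolding query_at_def oc_def Let_def ..
  have "(\<lambda>c. None :: (real^'d) option) \<in> measurable costM (count_space UNIV)" by (rule measurable_const) simp
  then show ?thesis unfolding 3 using 1 2 by (rule measurable_If)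
qed

lemma alg1_query_eq_query_at:
  fixes D
  assumes "c \<in> C"
  defines "B \<equiv> pick_basis R c D (optimal_bases A b c)"
  shows "alg1_query A b C R c D =
     query_at D B (pick_min R c D (argmin_set (\<lambda>j. low D (edge_dir A B j) c) (- B))) c"
proof -
  have B: "B \<in> optimal_bases A b c" using pick_basis_optimal by (simp add: B_def)
  define j0 where "j0 = pick_min R c D (argmin_set (\<lambda>j. low D (edge_dir A B j) c) (- B))"
  have "j0 \<in> - B" if "- B \<noteq> {}"
    using ties argmin_set_nonempty[of "-B" "\<lambda>j. low D (edge_dir A B j) c"] that
    unfolding j0_def valid_tie_rule_def by (metis argmin_set_iff finite_code)
  then have *: "violated D B j0 c" if "\<not> (- B = {} \<or> 0 \<le> low D (edge_dir A B j0) c)"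
    using that B by (auto simp: violated_def)
  show ?thesis
    unfolding alg1_query_def Let_def B_def[symmetric] low_def[symmetric] j0_def[symmetric] query_at_def
      out_cost_def[symmetric]
    using * by auto
qed

lemma alg1_query_measurable [measurable]: "(\<lambda>c. alg1_query A b C R c D) \<in> measurable costM (count_space UNIV)"
proof -
  have 1: "(\<lambda>c. pick_basis R c D (optimal_bases A b c)) \<in> measurable costM (count_space UNIV)"
    by (rule measurable_compose_countable[OF tie_measurable(1) optimal_bases_measurable])
  have "(\<lambda>c. argmin_set (\<lambda>j. low D (edge_dir A B j) c) (- B)) \<in> measurable costM (count_space UNIV)" for B
    by (rule measurable_argmin_set) auto
  then have 2: "(\<lambda>c. pick_min R c D (argmin_set (\<lambda>j. low D (edge_dir A B j) c) (- B))) \<in> measurable costM (count_space UNIV)" for B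
    by (rule measurable_compose_countable[OF tie_measurable(2)])
  have 3: "(\<lambda>c. query_at D B (pick_min R c D (argmin_set (\<lambda>j. low D (edge_dir A B j) c) (- B))) c)
      \<in> measurable costM (count_space UNIV)" for B
    by (rule measurable_compose_countable[OF query_at_measurable 2])
  have 4: "(\<lambda>c. query_at D (pick_basis R c D (optimal_bases A b c))
      (pick_min R c D (argmin_set (\<lambda>j. low D (edge_dir A (pick_basis R c D (optimal_bases A b c)) j) c)
         (- pick_basis R c D (optimal_bases A b c)))) c) \<in> measurable costM (count_space UNIV)"
    by (rule measurable_compose_countable[OF 3 1])
  show ?thesis
  proof (rule measurable_cong[THEN iffD2, OF _ 4])
    fix c assume "c \<in> space costM"
    then have "c \<in> C" by (simp only: space_costM)
    then show "alg1_query A b C R c D = query_at D (pick_basis R c D (optimal_bases A b c))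
      (pick_min R c D (argmin_set (\<lambda>j. low D (edge_dir A (pick_basis R c D (optimal_bases A b c)) j) c)
         (- pick_basis R c D (optimal_bases A b c)))) c"
      by (rule alg1_query_eq_query_at)
  qed
qed

lemma alg1_step_measurable: "(\<lambda>c. alg1_step c D) \<in> measurable costM (count_space UNIV)"
  unfolding alg1_step_def
  by (rule measurable_compose[OF alg1_query_measurable, of "\<lambda>q. case q of None \<Rightarrow> D | Some q \<Rightarrow> insert q D"]) simp

lemma alg1_step_edge_dirs: "D \<subseteq> edge_dirs A \<Longrightarrow> alg1_step c D \<subseteq> edge_dirs A"
  unfolding alg1_step_def alg1_query_def Let_def by (auto simp: edge_dir_in_edge_dirs)

lemma alg1_funpow_measurable:
  assumes "D \<subseteq> edge_dirs A"
  shows "(\<lambda>c. (alg1_step c ^^ k) D) \<in> measurable costM (count_space (Pow (edge_dirs A)))"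
proof (induction k)
  case (Suc k)
  have "(\<lambda>c. alg1_step c D') \<in> measurable costM (count_space (Pow (edge_dirs A)))" if "D' \<in> Pow (edge_dirs A)" for D'
    using measurable_sets[OF alg1_step_measurable[of D']] alg1_step_edge_dirs that
    by (auto simp: measurable_def space_costM)
  from measurable_compose_countable'[of _ "\<lambda>D c. alg1_step c D", OF this Suc] show ?case
    using finite_edge_dirs[of A] by (simp add: countable_finite)
qed (use assms in simp)

lemma alg1_measurable:
  assumes "D \<in> datasets"
  shows "(\<lambda>c. alg1 A b C R c D) \<in> measurable costM (count_space datasets)"
proof -
  have D: "D \<subseteq> edge_dirs A" using assms by (simp add: datasets_def)
  have eq: "alg1 A b C R c D = (alg1_step c ^^ dstar A b C) D" if "c \<in> C" for c
    by (rule alg1_eq_funpow[OF that assms]) simp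
  have "(\<lambda>c. alg1 A b C R c D) \<in> measurable costM (count_space (Pow (edge_dirs A)))"
    by (rule measurable_cong[THEN iffD2, OF _ alg1_funpow_measurable[OF D]]) (simp only: space_costM eq)
  note m = this
  show ?thesis
  proof (rule measurableI)
    fix X assume "X \<in> sets (count_space datasets)"
    then have "X \<in> sets (count_space (Pow (edge_dirs A)))" by (auto simp: datasets_def)
    then show "(\<lambda>c. alg1 A b C R c D) -` X \<inter> space costM \<in> sets costM" by (rule measurable_sets[OF m])
  qed (use alg1[OF _ assms] in \<open>simp add: space_costM\<close>)
qed

text \<open>A vertex fails to be optimal at a consistent cost if some other vertex is better by at least
  \<open>1 / (n + 1)\<close>; so failure is a countable union of compact projections.\<close>

lemma sufficient_measurable: "Measurable.pred costM (sufficient A b C D)"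
proof -
  have vopt: "x \<in> lp_opt A b c' \<longleftrightarrow> (\<forall>y\<in>lp_vertices A b. c' \<bullet> x \<le> c' \<bullet> y)" if "x \<in> lp_vertices A b" for x c'
  proof -
    obtain z where z: "z \<in> lp_opt A b c'" "z \<in> lp_vertices A b"
      using lp lp_opt_vertex_exists[of A b c'] by (auto simp: lp_setting_def)
    then show ?thesis using that lp_vertices_feasible[of _ A b] by (force simp: lp_opt_iff)
  qed
  have "sufficient A b C D c \<longleftrightarrow> (\<exists>x\<in>lp_vertices A b. \<forall>y\<in>lp_vertices A b. \<forall>n::nat.
      \<not> reaches D {c'. c' \<bullet> (y - x) \<le> - 1 / real (Suc n)} c)" for c
  proof -
    have "(\<exists>n::nat. c' \<bullet> (y - x) \<le> - 1 / real (Suc n)) \<longleftrightarrow> \<not> c' \<bullet> x \<le> c' \<bullet> y" for c' x y :: "real^'d"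
    proof
      assume "\<exists>n::nat. c' \<bullet> (y - x) \<le> - 1 / real (Suc n)"
      then obtain n :: nat where "c' \<bullet> (y - x) \<le> - 1 / real (Suc n)" by blast
      moreover have "- 1 / real (Suc n) < 0" by simp
      ultimately have "c' \<bullet> (y - x) < 0" by linarith
      then show "\<not> c' \<bullet> x \<le> c' \<bullet> y" by (simp add: inner_diff_right)
    next
      assume "\<not> c' \<bullet> x \<le> c' \<bullet> y"
      then have "0 < - (c' \<bullet> (y - x))" by (simp add: inner_diff_right)
      from reals_Archimedean[OF this] obtain n where "inverse (real (Suc n)) < - (c' \<bullet> (y - x))" by blast
      then show "\<exists>n::nat. c' \<bullet> (y - x) \<le> - 1 / real (Suc n)" by (intro exI[of _ n]) (simp add: inverse_eq_divide)
    qed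
    then have le: "c' \<bullet> x \<le> c' \<bullet> y \<longleftrightarrow> (\<forall>n::nat. \<not> c' \<bullet> (y - x) \<le> - 1 / real (Suc n))" for c' x y :: "real^'d"
      by meson
    show ?thesis
      unfolding sufficient_def reaches_def mem_Collect_eq
    proof (rule bex_cong[OF refl])
      fix x assume "x \<in> lp_vertices A b"
      from vopt[OF this] le
      show "(\<forall>c'\<in>consistent_costs C D (measurements c). x \<in> lp_opt A b c') =
        (\<forall>y\<in>lp_vertices A b. \<forall>n. \<not> (\<exists>c'\<in>consistent_costs C D (measurements c).
           c' \<bullet> (y - x) \<le> - 1 / real (Suc n)))"
        by (simp only:) meson
    qed
  qed
  note eq = this
  have r: "Measurable.pred costM (reaches D {c'. c' \<bullet> v \<le> a})" for v a
    by (rule reaches_measurable[OF closed_low_halfspace])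
  have "Measurable.pred costM (\<lambda>c. \<exists>x\<in>lp_vertices A b. \<forall>y\<in>lp_vertices A b. \<forall>n::nat.
      \<not> reaches D {c'. c' \<bullet> (y - x) \<le> - 1 / real (Suc n)} c)"
    by (intro pred_intros_finite(3,4) finite_lp_vertices pred_intros_countable(1) pred_intros_logic(2) r)
  then show ?thesis by (simp only: eq[abs_def])
qed

end


section \<open>The lifted predictor\<close>

lemma matrix_vector_mult_linear_comb:
  fixes M :: "real^'d^'d"
  shows "M *v (\<Sum>i<t. c i *\<^sub>R U i) = (\<Sum>i<(t::nat). c i *\<^sub>R (M *v U i))"
  by (simp add: linear_sum[OF matrix_vector_mul_linear] matrix_vector_mult_scaleR)

lemma pos_def_mat_symmetric_form:
  fixes M :: "real^'d^'d" assumes "pos_def_mat M" shows "x \<bullet> (M *v y) = (M *v x) \<bullet> y"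
  using assms by (metis dot_lmul_matrix pos_def_mat_def vector_transpose_matrix)

lemma pos_def_mat_inv:
  fixes M :: "real^'d^'d" assumes M: "pos_def_mat M"
  shows "M *v (matrix_inv M *v x) = x" "matrix_inv M *v (M *v x) = x"
proof -
  have "x = 0" if "M *v x = 0" for x
    using that M by (auto simp: pos_def_mat_def)
  then have "inj (\<lambda>x. M *v x)" using linear_injective_0[OF matrix_vector_mul_linear[of M]] by auto
  then have "invertible M" using invertible_left_inverse matrix_left_invertible_injective by blast
  then have "M ** matrix_inv M = mat 1 \<and> matrix_inv M ** M = mat 1"
    unfolding invertible_def matrix_inv_def by (rule someI_ex)
  then show "M *v (matrix_inv M *v x) = x" "matrix_inv M *v (M *v x) = x"
    by (simp_all add: matrix_vector_mul_assoc)
qed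

lemma pos_def_inv_form_pos:
  fixes M :: "real^'d^'d" assumes M: "pos_def_mat M" shows "x \<noteq> 0 \<Longrightarrow> 0 < x \<bullet> (matrix_inv M *v x)"
proof -
  assume "x \<noteq> 0"
  then have n: "matrix_inv M *v x \<noteq> 0" using pos_def_mat_inv(1)[OF M, of x] by auto
  have "x \<bullet> (matrix_inv M *v x) = (matrix_inv M *v x) \<bullet> (M *v (matrix_inv M *v x))"
    by (simp add: pos_def_mat_inv(1)[OF M] inner_commute)
  then show ?thesis using M n by (simp add: pos_def_mat_def)
qed

lemma pos_def_inv_form_nonneg:
  fixes M :: "real^'d^'d" assumes M: "pos_def_mat M" shows "0 \<le> x \<bullet> (matrix_inv M *v x)"
  using pos_def_inv_form_pos[OF M, of x] by (cases "x = 0") auto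

lemma pos_def_inv_form_symmetric:
  fixes M :: "real^'d^'d" assumes M: "pos_def_mat M"
  shows "x \<bullet> (matrix_inv M *v y) = y \<bullet> (matrix_inv M *v x)"
proof -
  have "x \<bullet> (matrix_inv M *v y) = (M *v (matrix_inv M *v x)) \<bullet> (matrix_inv M *v y)"
    by (simp add: pos_def_mat_inv(1)[OF M])
  also have "\<dots> = (matrix_inv M *v x) \<bullet> (M *v (matrix_inv M *v y))"
    by (simp only: pos_def_mat_symmetric_form[OF M])
  also have "\<dots> = y \<bullet> (matrix_inv M *v x)" by (simp add: pos_def_mat_inv(1)[OF M] inner_commute)
  finally show ?thesis .
qed

lemma orthonormal_basis_expand:
  assumes U: "orthonormal_basis_of U W" and u: "u \<in> W"
  shows "u = (\<Sum>i<dim W. (U i \<bullet> u) *\<^sub>R U i)"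
proof -
  let ?t = "dim W"
  have o: "U i \<bullet> U j = of_bool (i = j)" if "i < ?t" "j < ?t" for i j using U that by (simp add: orthonormal_basis_of_def)
  let ?L = "\<lambda>u. (\<Sum>i<?t. (U i \<bullet> u) *\<^sub>R U i)"
  have "u \<in> span (U ` {..<?t})" using U u by (simp add: orthonormal_basis_of_def)
  then show ?thesis
  proof (induction rule: span_induct_alt)
    case (step c x y)
    then obtain j where j: "j < ?t" "x = U j" by auto
    have "?L x = (\<Sum>i<?t. if i = j then U j else 0)"
      unfolding j(2) by (intro sum.cong refl) (use j(1) in \<open>auto simp: o\<close>)
    also have "\<dots> = x" using j by simp
    finally have "?L x = x" .
    moreover have "?L (c *\<^sub>R x + y) = c *\<^sub>R ?L x + ?L y"
      by (simp add: inner_add_right scaleR_add_left sum.distrib scaleR_sum_right)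
    ultimately show ?case using step by simp
  qed simp
qed

text \<open>The compression of a positive definite form to a subspace is invertible; the columns of the
  inverse are the coordinates of the dual basis.\<close>

lemma compressed_form_inverse:
  fixes Sig :: "real^'d^'d"
  assumes S: "pos_def_mat Sig" and U: "orthonormal_basis_of U W" and W: "subspace W"
  defines "t \<equiv> dim W" and "G \<equiv> \<lambda>i j. U i \<bullet> (Sig *v U j)"
  shows "\<exists>H. \<forall>i<t. \<forall>j<t. (\<Sum>k<t. G i k * H k j) = of_bool (i = j) \<and> (\<Sum>k<t. H i k * G k j) = of_bool (i = j)"
proof -
  have o: "U i \<bullet> U j = of_bool (i = j)" if "i < t" "j < t" for i j
    using U that by (simp add: orthonormal_basis_of_def t_def)
  have UW: "U i \<in> W" if "i < t" for i
    using U that span_base[of "U i" "U ` {..<dim W}"] by (auto simp: orthonormal_basis_of_def t_def)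
  define f where "f = (\<lambda>u. \<Sum>i<t. (U i \<bullet> (Sig *v u)) *\<^sub>R U i)"
  have lin: "linear f"
    unfolding f_def by (rule linearI)
      (simp_all add: matrix_vector_right_distrib matrix_vector_mult_scaleR inner_add_right scaleR_add_left sum.distrib scaleR_sum_right)
  have fW: "f u \<in> W" for u unfolding f_def using W UW by (intro subspace_sum subspace_scale) auto
  have fi: "U i \<bullet> f u = U i \<bullet> (Sig *v u)" if "i < t" for i u
  proof -
    have "U i \<bullet> f u = (\<Sum>j<t. if j = i then U i \<bullet> (Sig *v u) else 0)"
      unfolding f_def inner_sum_right by (intro sum.cong refl) (use that in \<open>auto simp: o\<close>)
    then show ?thesis using that by simp
  qed
  have inj: "inj_on f W"
  proof (subst linear_inj_on_iff_eq_0[OF lin W], intro ballI impI)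
    fix u assume u: "u \<in> W" "f u = 0"
    have "U i \<bullet> (Sig *v u) = 0" if "i < t" for i using fi[OF that, of u] u by simp
    then have "u \<bullet> (Sig *v u) = 0"
      by (subst (1) orthonormal_basis_expand[OF U u(1)]) (simp add: inner_sum_left t_def)
    then show "u = 0" using S by (auto simp: pos_def_mat_def)
  qed
  have "dim (f ` W) = dim W"
    by (intro dim_image_eq[OF lin]) (simp add: inj span_eq_iff[THEN iffD2, OF W])
  then have img: "f ` W = W"
    using fW linear_subspace_image[OF lin W] W by (intro subspace_dim_equal) auto
  define g where "g = (\<lambda>j. SOME u. u \<in> W \<and> f u = U j)"
  have g: "g j \<in> W \<and> f (g j) = U j" if "j < t" for j
  proof -
    have "\<exists>u. u \<in> W \<and> f u = U j" using img UW[OF that] by (metis imageE)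
    then show ?thesis unfolding g_def by (rule someI_ex)
  qed
  have dual: "U i \<bullet> (Sig *v g j) = of_bool (i = j)" if "i < t" "j < t" for i j
    using fi[OF that(1), of "g j"] g[OF that(2)] o that by simp
  define H where "H = (\<lambda>k j. U k \<bullet> g j)"
  have gexp: "g j = (\<Sum>k<t. H k j *\<^sub>R U k)" if "j < t" for j
    using orthonormal_basis_expand[OF U, of "g j"] g[OF that] by (simp add: H_def t_def)
  have GH: "(\<Sum>k<t. G i k * H k j) = of_bool (i = j)" if "i < t" "j < t" for i j
  proof -
    have "U i \<bullet> (Sig *v g j) = (\<Sum>k<t. G i k * H k j)"
      by (subst gexp[OF that(2)]) (simp add: matrix_vector_mult_linear_comb inner_sum_right G_def mult.commute)
    then show ?thesis using dual[OF that] by simp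
  qed
  have Hsym: "H i j = H j i" if "i < t" "j < t" for i j
  proof -
    have *: "g i \<bullet> (Sig *v g j) = H j i" if "i < t" "j < t" for i j
    proof -
      have "g i \<bullet> (Sig *v g j) = (\<Sum>k<t. if k = j then H j i else 0)"
        by (subst gexp[OF that(1)]) (auto simp: inner_sum_left dual that intro!: sum.cong)
      then show ?thesis using that by simp
    qed
    have "H j i = g i \<bullet> (Sig *v g j)" by (rule *[OF that, symmetric])
    also have "\<dots> = g j \<bullet> (Sig *v g i)" by (subst pos_def_mat_symmetric_form[OF S]) (rule inner_commute)
    also have "\<dots> = H i j" by (rule *[OF that(2,1)])
    finally show ?thesis by simp
  qed
  have Gsym: "G i j = G j i" for i j
    unfolding G_def by (subst pos_def_mat_symmetric_form[OF S]) (rule inner_commute)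
  have "(\<Sum>k<t. H i k * G k j) = of_bool (i = j)" if "i < t" "j < t" for i j
  proof -
    have "(\<Sum>k<t. H i k * G k j) = (\<Sum>k<t. G j k * H k i)"
      using that by (intro sum.cong refl) (simp add: Hsym[of i] Gsym[of j] mult.commute)
    then show ?thesis using GH[OF that(2,1)] by (simp add: eq_commute)
  qed
  then show ?thesis using GH by blast
qed

lemma lift_interpolates:
  fixes Sig :: "real^'d^'d"
  assumes S: "pos_def_mat Sig" and U: "orthonormal_basis_of U W" and W: "subspace W"
  obtains u where "u \<in> W" "lift Sig U (dim W) s = Sig *v u" "\<And>i. i < dim W \<Longrightarrow> U i \<bullet> lift Sig U (dim W) s = s i"
proof -
  define t where "t = dim W"
  define G where "G = (\<lambda>i j. U i \<bullet> (Sig *v U j))"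
  define H where "H = mat_inv_upto t G"
  have H: "\<forall>i<t. \<forall>j<t. (\<Sum>k<t. G i k * H k j) = of_bool (i = j) \<and> (\<Sum>k<t. H i k * G k j) = of_bool (i = j)"
    unfolding H_def mat_inv_upto_def using compressed_form_inverse[OF S U W] unfolding t_def G_def by (rule someI_ex)
  define u where "u = (\<Sum>i<t. (\<Sum>j<t. H i j * s j) *\<^sub>R U i)"
  have lift: "lift Sig U t s = Sig *v u" by (simp add: lift_def Let_def u_def H_def G_def)
  have "U i \<in> W" if "i < t" for i 
    using U that span_base[of "U i" "U ` {..<dim W}"] by (auto simp: orthonormal_basis_of_def t_def)
  then have "u \<in> W" unfolding u_def using W by (intro subspace_sum subspace_scale) auto
  moreover have "U i \<bullet> lift Sig U t s = s i" if i: "i < t" for i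
  proof -
    have "U i \<bullet> lift Sig U t s = (\<Sum>k<t. (\<Sum>j<t. H k j * s j) * G i k)"
      unfolding lift unfolding u_def matrix_vector_mult_linear_comb inner_sum_right by (simp add: G_def)
    also have "\<dots> = (\<Sum>j<t. (\<Sum>k<t. G i k * H k j) * s j)"
      unfolding sum_distrib_right by (subst sum.swap) (simp add: mult_ac)
    also have "\<dots> = (\<Sum>j<t. if j = i then s i else 0)" using H i by (intro sum.cong refl) auto
    finally show ?thesis using i by simp
  qed
  ultimately show ?thesis using that lift by (simp add: t_def)
qed

text \<open>The lifted vector is the Mahalanobis-orthogonal projection, so it stays in the ellipsoid while
  keeping the measurements in the span of the data.\<close>

lemma lifted_cost:
  fixes Sig :: "real^'d^'d" and c c0 :: "real^'d"
  assumes S: "pos_def_mat Sig" and U: "orthonormal_basis_of U W" and W: "subspace W"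
  defines "c' \<equiv> c0 + lift Sig U (dim W) (\<lambda>i. U i \<bullet> (c - c0))"
  shows "q \<in> W \<Longrightarrow> q \<bullet> c' = q \<bullet> c" and "c \<in> ellipsoid c0 Sig \<Longrightarrow> c' \<in> ellipsoid c0 Sig"
proof -
  define L where "L = lift Sig U (dim W) (\<lambda>i. U i \<bullet> (c - c0))"
  obtain u where u: "u \<in> W" "L = Sig *v u" "\<And>i. i < dim W \<Longrightarrow> U i \<bullet> L = U i \<bullet> (c - c0)"
    unfolding L_def by (rule lift_interpolates[OF S U W, of "\<lambda>i. U i \<bullet> (c - c0)"]) auto
  have agree: "q \<bullet> L = q \<bullet> (c - c0)" if "q \<in> W" for q
    by (subst (1 2) orthonormal_basis_expand[OF U that]) (simp add: inner_sum_left u(3))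
  show "q \<bullet> c' = q \<bullet> c" if "q \<in> W"
    unfolding c'_def L_def[symmetric] inner_add_right agree[OF that] by (simp add: inner_diff_right)
  let ?I = "\<lambda>x y. x \<bullet> (matrix_inv Sig *v y)"
  have "?I (c - c0 - L) L = (c - c0 - L) \<bullet> u" by (simp add: u(2) pos_def_mat_inv[OF S])
  also have "\<dots> = u \<bullet> (c - c0) - u \<bullet> L" by (simp add: inner_diff_right inner_commute[of _ u])
  also have "\<dots> = 0" using agree[OF u(1)] by simp
  finally have orth: "?I (c - c0 - L) L = 0" .
  have "c - c0 = (c - c0 - L) + L" by simp
  then have "?I (c - c0) (c - c0) = ?I ((c - c0 - L) + L) ((c - c0 - L) + L)" by simp
  also have "\<dots> = ?I (c - c0 - L) (c - c0 - L) + ?I L L + 2 * ?I (c - c0 - L) L"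
    unfolding matrix_vector_right_distrib inner_add_left inner_add_right
    using pos_def_inv_form_symmetric[OF S, of L "c - c0 - L"] by simp
  finally have "?I L L \<le> ?I (c - c0) (c - c0)"
    using orth pos_def_inv_form_nonneg[OF S, of "c - c0 - L"] by simp
  then show "c' \<in> ellipsoid c0 Sig" if "c \<in> ellipsoid c0 Sig"
    using that by (simp add: ellipsoid_def c'_def L_def[symmetric])
qed

section \<open>The ellipsoid\<close>

lemma ellipsoid_form_continuous:
  fixes Sig :: "real^'d^'d" and c0 :: "real^'d"
  shows "continuous_on S (\<lambda>c. (c - c0) \<bullet> (matrix_inv Sig *v (c - c0)))"
proof -
  have "continuous_on S (\<lambda>c. matrix_inv Sig *v (c - c0))"
    by (rule bounded_linear.continuous_on[OF matrix_vector_mul_bounded_linear]) (intro continuous_intros)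
  then show ?thesis by (intro continuous_intros)
qed

lemma center_in_ellipsoid: "c0 \<in> ellipsoid c0 Sig" by (simp add: ellipsoid_def)

lemma convex_midpoint_form:
  fixes Sig :: "real^'d^'d" assumes S: "pos_def_mat Sig"
  shows "(u *\<^sub>R x + v *\<^sub>R y) \<bullet> (matrix_inv Sig *v (u *\<^sub>R x + v *\<^sub>R y)) =
    u\<^sup>2 * (x \<bullet> (matrix_inv Sig *v x)) + v\<^sup>2 * (y \<bullet> (matrix_inv Sig *v y)) + 2 * u * v * (x \<bullet> (matrix_inv Sig *v y))"
  using pos_def_inv_form_symmetric[OF S, of y x]
  by (simp add: matrix_vector_right_distrib matrix_vector_mult_scaleR inner_add_left inner_add_right power2_eq_square algebra_simps)

lemma ellipsoid_convex_gap:
  fixes Sig :: "real^'d^'d" assumes S: "pos_def_mat Sig" and u: "0 \<le> u" "0 \<le> v" "u + v = 1"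
  shows "(u *\<^sub>R x + v *\<^sub>R y) \<bullet> (matrix_inv Sig *v (u *\<^sub>R x + v *\<^sub>R y)) =
    u * (x \<bullet> (matrix_inv Sig *v x)) + v * (y \<bullet> (matrix_inv Sig *v y)) - u * v * ((x - y) \<bullet> (matrix_inv Sig *v (x - y)))"
proof -
  have v: "v = 1 - u" using u by simp
  show ?thesis
    unfolding convex_midpoint_form[OF S] using convex_midpoint_form[OF S, of 1 x "-1" y]
    by (simp add: v power2_eq_square algebra_simps)
qed

lemma convex_ellipsoid:
  fixes Sig :: "real^'d^'d" assumes S: "pos_def_mat Sig" shows "convex (ellipsoid c0 Sig)"
  unfolding convex_def
proof (intro ballI allI impI)
  fix x y u v assume xy: "x \<in> ellipsoid c0 Sig" "y \<in> ellipsoid c0 Sig" and u: "0 \<le> (u::real)" "0 \<le> v" "u + v = 1"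
  have e: "u *\<^sub>R x + v *\<^sub>R y - c0 = u *\<^sub>R (x - c0) + v *\<^sub>R (y - c0)"
    using u(3) by (simp add: algebra_simps flip: scaleR_add_left)
  have "u * ((x - c0) \<bullet> (matrix_inv Sig *v (x - c0))) + v * ((y - c0) \<bullet> (matrix_inv Sig *v (y - c0))) \<le> u * 1 + v * 1"
    using xy u by (intro add_mono mult_left_mono) (auto simp: ellipsoid_def)
  moreover have "0 \<le> u * v * ((x - y) \<bullet> (matrix_inv Sig *v (x - y)))"
    using u pos_def_inv_form_nonneg[OF S] by (intro mult_nonneg_nonneg) auto
  ultimately show "u *\<^sub>R x + v *\<^sub>R y \<in> ellipsoid c0 Sig"
    unfolding ellipsoid_def mem_Collect_eq e using ellipsoid_convex_gap[OF S u, of "x - c0" "y - c0"] u by simp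
qed

lemma ellipsoid_strict:
  fixes Sig :: "real^'d^'d" assumes S: "pos_def_mat Sig"
    and xy: "x \<in> ellipsoid c0 Sig" "y \<in> ellipsoid c0 Sig" "x \<noteq> y"
  shows "midpoint x y \<in> interior (ellipsoid c0 Sig)"
proof -
  let ?q = "\<lambda>c. (c - c0) \<bullet> (matrix_inv Sig *v (c - c0))"
  have m: "midpoint x y - c0 = (1/2) *\<^sub>R (x - c0) + (1/2) *\<^sub>R (y - c0)"
    by (simp add: midpoint_def vec_eq_iff field_simps)
  have "0 < (x - y) \<bullet> (matrix_inv Sig *v (x - y))" using pos_def_inv_form_pos[OF S] xy(3) by simp
  then have "?q (midpoint x y) < 1"
    unfolding m using ellipsoid_convex_gap[OF S, of "1/2" "1/2" "x - c0" "y - c0"] xy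
    by (simp add: ellipsoid_def)
  moreover have "open {c. ?q c < 1}"
    by (intro open_Collect_less ellipsoid_form_continuous continuous_on_const)
  moreover have "{c. ?q c < 1} \<subseteq> ellipsoid c0 Sig" by (auto simp: ellipsoid_def)
  ultimately show ?thesis by (auto intro: interiorI)
qed

lemma compact_ellipsoid:
  fixes Sig :: "real^'d^'d" assumes S: "pos_def_mat Sig" shows "compact (ellipsoid c0 Sig)"
proof -
  let ?f = "\<lambda>v :: real^'d. v \<bullet> (matrix_inv Sig *v v)"
  obtain v0 where v0: "v0 \<in> sphere (0 :: real^'d) 1" "\<And>v. v \<in> sphere 0 1 \<Longrightarrow> ?f v0 \<le> ?f v"
  proof -
    have "sphere (0 :: real^'d) 1 \<noteq> {}" by simp
    moreover have "continuous_on (sphere 0 1) ?f" using ellipsoid_form_continuous[of _ 0 Sig] by simp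
    ultimately show ?thesis using continuous_attains_inf[OF compact_sphere, of 0 1 ?f] that by blast
  qed
  have "v0 \<noteq> 0" using v0(1) by auto
  then have a: "0 < ?f v0" by (rule pos_def_inv_form_pos[OF S])
  have low: "?f v0 * (norm v)\<^sup>2 \<le> ?f v" for v
  proof (cases "v = 0")
    case False
    have "?f v0 \<le> ?f (v /\<^sub>R norm v)" using False by (intro v0) simp
    also have "\<dots> = ?f v / (norm v)\<^sup>2"
      by (simp add: matrix_vector_mult_scaleR power2_eq_square divide_inverse)
    finally show ?thesis using False by (simp add: field_simps)
  qed simp
  have "ellipsoid c0 Sig \<subseteq> cball c0 (sqrt (1 / ?f v0))"
  proof
    fix c assume "c \<in> ellipsoid c0 Sig"
    then have "?f v0 * (norm (c - c0))\<^sup>2 \<le> 1" using low[of "c - c0"] by (simp add: ellipsoid_def)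
    then have "(norm (c - c0))\<^sup>2 \<le> 1 / ?f v0" using a by (simp add: field_simps)
    then have "norm (c - c0) \<le> sqrt (1 / ?f v0)" by (rule real_le_rsqrt)
    then show "c \<in> cball c0 (sqrt (1 / ?f v0))" by (simp add: dist_norm norm_minus_commute)
  qed
  then have "bounded (ellipsoid c0 Sig)" using bounded_cball bounded_subset by blast
  moreover have "closed (ellipsoid c0 Sig)"
    unfolding ellipsoid_def by (intro closed_Collect_le ellipsoid_form_continuous continuous_on_const)
  ultimately show ?thesis by (simp add: compact_eq_bounded_closed)
qed


section \<open>Generalization of a stable online scheme\<close>

text \<open>An online learner with finitely many states. \<open>Good s\<close> collects points from which the state \<open>s\<close> has
  nothing left to learn; it contains all points that leave \<open>s\<close> unchanged and grows along updates.\<close>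

locale online_scheme = Q: prob_space Q for Q :: "'x measure" +
  fixes F :: "'s set" and s0 :: 's and step :: "'x \<Rightarrow> 's \<Rightarrow> 's" and Good :: "'s \<Rightarrow> 'x set"
  assumes F: "finite F" "s0 \<in> F" "\<And>x s. x \<in> space Q \<Longrightarrow> s \<in> F \<Longrightarrow> step x s \<in> F"
    and step_measurable: "\<And>s. s \<in> F \<Longrightarrow> (\<lambda>x. step x s) \<in> measurable Q (count_space F)"
    and Good_sets: "\<And>s. s \<in> F \<Longrightarrow> Good s \<in> sets Q"
    and Good_mono: "\<And>x s. x \<in> space Q \<Longrightarrow> s \<in> F \<Longrightarrow> Good s \<subseteq> Good (step x s)"
    and Good_fixed: "\<And>x s. x \<in> space Q \<Longrightarrow> s \<in> F \<Longrightarrow> step x s = s \<Longrightarrow> x \<in> Good s"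
begin

text \<open>A learner that sees only the points with index in \<open>I\<close>; the full run is the case \<open>UNIV\<close>.\<close>

primrec run :: "nat set \<Rightarrow> (nat \<Rightarrow> 'x) \<Rightarrow> nat \<Rightarrow> 's" where
  "run I y 0 = s0"
| "run I y (Suc i) = (if Suc i \<in> I then step (y (Suc i)) (run I y i) else run I y i)"

definition updates :: "nat \<Rightarrow> (nat \<Rightarrow> 'x) \<Rightarrow> nat set" where
  "updates n y = {i\<in>{1..n}. run UNIV y i \<noteq> run UNIV y (i - 1)}"

lemma run_in_F: "(\<And>i. i \<in> {1..n} \<Longrightarrow> y i \<in> space Q) \<Longrightarrow> i \<le> n \<Longrightarrow> run I y i \<in> F"
  by (induction i) (auto simp: F)

lemma run_cong: "(\<And>i. i \<in> I \<Longrightarrow> i \<in> {1..n} \<Longrightarrow> y i = y' i) \<Longrightarrow> i \<le> n \<Longrightarrow> run I y i = run I y' i"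
  by (induction i) auto

text \<open>Stability: points that did not change the state may be dropped.\<close>

lemma run_stable:
  assumes "updates n y \<subseteq> I" "i \<le> n" shows "run I y i = run UNIV y i"
  using assms(2)
proof (induction i)
  case (Suc i)
  then have "Suc i \<notin> I \<Longrightarrow> Suc i \<notin> updates n y" using assms(1) by auto
  then show ?case using Suc by (auto simp: updates_def)
qed simp

lemma run_Good_mono:
  assumes "\<And>i. i \<in> {1..n} \<Longrightarrow> y i \<in> space Q" "i \<le> j" "j \<le> n"
  shows "Good (run UNIV y i) \<subseteq> Good (run UNIV y j)"
  using assms(2,3)
proof (induction j)
  case (Suc j)
  show ?case
  proof (cases "i = Suc j")
    case False
    then have "Good (run UNIV y i) \<subseteq> Good (run UNIV y j)" using Suc by auto
    also have "\<dots> \<subseteq> Good (run UNIV y (Suc j))"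
      using Good_mono[of "y (Suc j)" "run UNIV y j"] run_in_F[of n y j] assms(1) Suc by auto
    finally show ?thesis .
  qed auto
qed auto

lemma unused_point_Good:
  assumes y: "\<And>i. i \<in> {1..n} \<Longrightarrow> y i \<in> space Q" and i: "i \<in> {1..n}" "i \<notin> updates n y"
  shows "y i \<in> Good (run UNIV y n)"
proof -
  obtain k where k: "i = Suc k" using i by (cases i) auto
  then have "step (y i) (run UNIV y k) = run UNIV y k" using i by (auto simp: updates_def)
  then have "y i \<in> Good (run UNIV y k)"
    using i k y run_in_F[of n y k] by (intro Good_fixed) auto
  then show ?thesis using run_Good_mono[of n y k n] y i k by auto
qed

lemma run_measurable:
  assumes "I \<subseteq> {1..n}" "i \<le> n"
  shows "(\<lambda>y. run I y i) \<in> measurable (PiM I (\<lambda>_. Q)) (count_space F)"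
  using assms(2)
proof (induction i)
  case (Suc i)
  then have IH: "(\<lambda>y. run I y i) \<in> measurable (PiM I (\<lambda>_. Q)) (count_space F)" by simp
  have "(\<lambda>y. step (y (Suc i)) (run I y i)) \<in> measurable (PiM I (\<lambda>_. Q)) (count_space F)" if "Suc i \<in> I"
  proof (rule measurable_compose_countable'[OF _ IH])
    fix s assume "s \<in> F"
    then show "(\<lambda>y. step (y (Suc i)) s) \<in> measurable (PiM I (\<lambda>_. Q)) (count_space F)"
      by (intro measurable_compose[OF _ step_measurable] measurable_component_singleton that)
  qed (use F countable_finite in auto)
  then show ?case using IH by (cases "Suc i \<in> I") auto
qed (use F in auto)

definition miss :: "'s \<Rightarrow> real" where "miss s = measure Q (space Q - Good s)"

text \<open>The points outside \<open>I\<close> are an independent test sample for the state computed from \<open>I\<close>.\<close>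

lemma holdout_bound:
  assumes I: "I \<subseteq> {1..n}" and e: "0 \<le> e" "e \<le> 1"
  defines "Z \<equiv> {y \<in> space (PiM {1..n} (\<lambda>_. Q)). e < miss (run I y n) \<and> (\<forall>i\<in>{1..n}-I. y i \<in> Good (run I y n))}"
  shows "Z \<in> sets (PiM {1..n} (\<lambda>_. Q))"
    and "measure (PiM {1..n} (\<lambda>_. Q)) Z \<le> (1 - e) ^ card ({1..n} - I)"
proof -
  interpret P: product_sigma_finite "\<lambda>_. Q" by standard
  interpret PP: prob_space "PiM {1..n} (\<lambda>_. Q)" by (intro prob_space_PiM Q.prob_space_axioms)
  interpret PI: prob_space "PiM I (\<lambda>_. Q)" by (intro prob_space_PiM Q.prob_space_axioms)
  let ?J = "{1..n} - I" and ?M = "\<lambda>I. PiM I (\<lambda>_::nat. Q)"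
  have fin: "finite I" "finite ?J" using I finite_subset by auto
  have runr: "run I (restrict y I) n = run I y n" for y
    by (rule run_cong[of I n]) auto
  let ?G = "\<lambda>s. {y \<in> space (?M {1..n}). run I (restrict y I) n = s} \<inter> (\<Inter>i\<in>?J. {y \<in> space (?M {1..n}). y i \<in> Good s})"
  have run_pred: "{y \<in> space (?M {1..n}). run I (restrict y I) n = s} \<in> sets (?M {1..n})" if "s \<in> F" for s
  proof -
    have "(\<lambda>y. run I (restrict y I) n) \<in> measurable (?M {1..n}) (count_space F)"
      by (rule measurable_compose[OF measurable_restrict_subset[OF I] run_measurable[OF I order.refl]])
    from measurable_sets[OF this, of "{s}"] that show ?thesis
      by (simp add: vimage_def Int_def conj_commute)
  qed
  have good_pred: "{y \<in> space (?M {1..n}). y i \<in> Good s} \<in> sets (?M {1..n})" if "s \<in> F" "i \<in> ?J" for s i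
  proof -
    have "(\<lambda>y. y i) \<in> measurable (?M {1..n}) Q" using that by (intro measurable_component_singleton) auto
    from measurable_sets[OF this Good_sets[OF that(1)]] show ?thesis
      by (simp add: vimage_def Int_def conj_commute)
  qed
  have Zeq: "Z = (\<Union>s\<in>{s\<in>F. e < miss s}. {y \<in> space (?M {1..n}). run I (restrict y I) n = s \<and> (\<forall>i\<in>?J. y i \<in> Good s)})"
    (is "_ = (\<Union>s\<in>?S. ?Y s)")
    using run_in_F[of n _ n I] by (auto simp: Z_def runr space_PiM PiE_iff)
  have Y: "?Y s \<in> sets (?M {1..n})" if "s \<in> F" for s
  proof -
    have "?Y s = {y \<in> space (?M {1..n}). run I (restrict y I) n = s} \<inter> {y \<in> space (?M {1..n}). \<forall>i\<in>?J. y i \<in> Good s}"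
      by auto
    also have "\<dots> \<in> sets (?M {1..n})"
      by (intro sets.Int run_pred that sets.sets_Collect_finite_All good_pred fin) auto
    finally show ?thesis .
  qed
  show Z: "Z \<in> sets (?M {1..n})"
    unfolding Zeq using F(1) Y by (intro sets.finite_UN) auto
  let ?A = "\<lambda>s. {y \<in> space (?M I). run I y n = s}"
  have A: "?A s \<in> sets (?M I)" if "s \<in> F" for s
    using measurable_sets[OF run_measurable[OF I order.refl], of "{s}"] that
    by (simp add: vimage_def Int_def conj_commute)
  have un: "I \<union> ?J = {1..n}" using I by auto
  have em: "emeasure (?M {1..n}) (?Y s) = emeasure (?M I) (?A s) * emeasure Q (Good s) ^ card ?J" if s: "s \<in> F" for s
  proof -
    have "emeasure (?M {1..n}) (?Y s) = (\<integral>\<^sup>+ y. indicator (?Y s) y \<partial>?M (I \<union> ?J))"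
      unfolding un using Y[OF s] by (rule nn_integral_indicator[symmetric])
    also have "\<dots> = (\<integral>\<^sup>+ x. (\<integral>\<^sup>+ z. indicator (?Y s) (merge I ?J (x, z)) \<partial>?M ?J) \<partial>?M I)"
    proof (rule P.product_nn_integral_fold)
      show "indicator (?Y s) \<in> borel_measurable (?M (I \<union> ?J))"
        unfolding un using Y[OF s] by (rule borel_measurable_indicator)
    qed (use fin in auto)
    also have "\<dots> = (\<integral>\<^sup>+ x. (\<integral>\<^sup>+ z. indicator (?A s) x * indicator (Pi\<^sub>E ?J (\<lambda>_. Good s)) z \<partial>?M ?J) \<partial>?M I)"
    proof (intro nn_integral_cong)
      fix x z assume x: "x \<in> space (?M I)" and z: "z \<in> space (?M ?J)"
      have m: "merge I ?J (x, z) \<in> space (?M {1..n})" using x z un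
        by (auto simp: space_PiM PiE_iff extensional_def merge_def)
      have "run I (restrict (merge I ?J (x, z)) I) n = run I x n"
        by (rule run_cong[of I n]) (auto simp: merge_def)
      moreover have "(\<forall>i\<in>?J. merge I ?J (x, z) i \<in> Good s) \<longleftrightarrow> z \<in> Pi\<^sub>E ?J (\<lambda>_. Good s)"
        using z by (auto simp: merge_def space_PiM PiE_iff)
      ultimately show "indicator (?Y s) (merge I ?J (x, z)) = (indicator (?A s) x * indicator (Pi\<^sub>E ?J (\<lambda>_. Good s)) z :: ennreal)"
        using m x by (auto simp: indicator_def)
    qed
    also have "\<dots> = emeasure (?M I) (?A s) * emeasure (?M ?J) (Pi\<^sub>E ?J (\<lambda>_. Good s))"
      using A[OF s] Good_sets[OF s] fin
      by (simp add: nn_integral_cmult nn_integral_multc sets_PiM_I_finite)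
    also have "emeasure (?M ?J) (Pi\<^sub>E ?J (\<lambda>_. Good s)) = emeasure Q (Good s) ^ card ?J"
      using Good_sets[OF s] fin by (subst P.emeasure_PiM) auto
    finally show ?thesis .
  qed
  have prob: "measure (?M {1..n}) (?Y s) = measure (?M I) (?A s) * measure Q (Good s) ^ card ?J" if "s \<in> F" for s
  proof -
    have "ennreal (measure (?M {1..n}) (?Y s)) = ennreal (measure (?M I) (?A s) * measure Q (Good s) ^ card ?J)"
      using em[OF that] by (simp only: Q.emeasure_eq_measure PI.emeasure_eq_measure PP.emeasure_eq_measure
          ennreal_mult ennreal_power measure_nonneg zero_le_power)
    then show ?thesis by (simp add: ennreal_inj)
  qed
  have "measure (?M {1..n}) Z \<le> (\<Sum>s\<in>?S. measure (?M {1..n}) (?Y s))"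
    unfolding Zeq using F(1) Y by (intro PP.finite_measure_subadditive_finite) auto
  also have "\<dots> \<le> (\<Sum>s\<in>?S. measure (?M I) (?A s) * (1 - e) ^ card ?J)"
  proof (intro sum_mono)
    fix s assume s: "s \<in> ?S"
    have "measure Q (Good s) \<le> 1 - e"
      using s Q.prob_compl[OF Good_sets] by (auto simp: miss_def)
    then show "measure (?M {1..n}) (?Y s) \<le> measure (?M I) (?A s) * (1 - e) ^ card ?J"
      using s prob by (auto intro!: mult_left_mono power_mono)
  qed
  also have "\<dots> = measure (?M I) (\<Union>s\<in>?S. ?A s) * (1 - e) ^ card ?J"
    unfolding sum_distrib_right[symmetric]
    using F(1) A by (subst PI.finite_measure_finite_Union) (auto simp: disjoint_family_on_def)
  also have "\<dots> \<le> 1 * (1 - e) ^ card ?J"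
    using e by (intro mult_right_mono PI.prob_le_1) auto
  finally show "measure (?M {1..n}) Z \<le> (1 - e) ^ card ?J" by simp
qed


definition block :: "nat \<Rightarrow> nat \<Rightarrow> nat set \<Rightarrow> nat set" where
  "block n k J = {i\<in>{1..n}. (i - 1) mod (2 * k) \<in> J}"

text \<open>At least \<open>k\<close> residue classes modulo \<open>2 k\<close> lie outside \<open>J\<close>, each with \<open>n div (2 k)\<close> members. For
  \<open>k = 0\<close> the block is empty.\<close>

lemma card_outside_block:
  assumes J: "J \<subseteq> {..<2 * k}" "card J \<le> k" and n: "24 * k < n"
  shows "real n / 4 \<le> real (card ({1..n} - block n k J))"
proof (cases "k = 0")
  case True
  then have "{1..n} - block n k J = {1..n}" using J by (auto simp: block_def)
  then show ?thesis by simp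
next
  case False
  let ?K = "2 * k"
  let ?f = "\<lambda>(r, l). ?K * l + r + 1"
  let ?S = "({..<?K} - J) \<times> {..<n div ?K}"
  have inj: "inj_on ?f ?S"
  proof (rule inj_onI)
    fix p p' assume p: "p \<in> ?S" "p' \<in> ?S" "?f p = ?f p'"
    obtain r l r' l' where pp: "p = (r, l)" "p' = (r', l')" by (cases p, cases p')
    with p have *: "r < ?K" "r' < ?K" "?K * l + r + 1 = ?K * l' + r' + 1" by auto
    then have "(?K * l + r) mod ?K = (?K * l' + r') mod ?K" "(?K * l + r) div ?K = (?K * l' + r') div ?K" by auto
    then show "p = p'" using * pp by simp
  qed
  have sub: "?f ` ?S \<subseteq> {1..n} - block n k J"
  proof
    fix i assume "i \<in> ?f ` ?S"
    then obtain r l where i: "i = ?K * l + r + 1" and *: "r < ?K" "r \<notin> J" "l < n div ?K" by auto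
    have "?K * l + r + 1 \<le> ?K * (l + 1)" using * by simp
    also have "\<dots> \<le> ?K * (n div ?K)" using * by (intro mult_le_mono2) simp
    also have "\<dots> \<le> n" by simp
    finally show "i \<in> {1..n} - block n k J" using * i by (simp add: block_def)
  qed
  have "k \<le> card ({..<?K} - J)" using J finite_subset[OF J(1)] by (simp add: card_Diff_subset)
  then have "k * (n div ?K) \<le> card ?S" by simp
  also have "card ?S = card (?f ` ?S)" using card_image[OF inj] by simp
  also have "\<dots> \<le> card ({1..n} - block n k J)" using sub by (intro card_mono) auto
  finally have *: "real (k * (n div ?K)) \<le> real (card ({1..n} - block n k J))" by (simp only: of_nat_le_iff)
  have "n < ?K * (n div ?K) + ?K" using False mod_less_divisor[of ?K n] mult_div_mod_eq[of ?K n] by linarith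
  then have "n < 2 * (k * (n div ?K)) + 2 * k" by (simp add: mult.assoc)
  then have "real n < real (2 * (k * (n div ?K)) + 2 * k)" by (simp only: of_nat_less_iff)
  then have "real n < 2 * real (k * (n div ?K)) + 2 * real k" by simp
  moreover have "24 * real k < real n" using n by linarith
  ultimately show ?thesis using * by linarith
qed

definition threshold :: "nat \<Rightarrow> real \<Rightarrow> nat \<Rightarrow> real" where
  "threshold n \<delta> k = 4 / real n * (6 * real k + ln (exp 1 / \<delta>))"

text \<open>If the scheme made \<open>k\<close> updates, some block built from at most \<open>k\<close> residue classes contains them
  all, and the points outside form a test sample without mistakes. For a fixed block this has
  probability at most \<open>(1 - \<epsilon>)\<^bsup>n/4\<^esup>\<close>, and the weight \<open>6 k\<close> in the threshold pays for the \<open>4\<^sup>k\<close> blocks and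
  for the sum over \<open>k\<close>.\<close>

theorem compression_bound:
  assumes n: "1 \<le> n" and \<delta>: "0 < \<delta>" "\<delta> < 1"
  obtains Z where "Z \<in> sets (PiM {1..n} (\<lambda>_. Q))" "measure (PiM {1..n} (\<lambda>_. Q)) Z \<le> \<delta>"
    "\<And>y. y \<in> space (PiM {1..n} (\<lambda>_. Q)) \<Longrightarrow> threshold n \<delta> (card (updates n y)) < miss (run UNIV y n) \<Longrightarrow> y \<in> Z"
proof -
  interpret PP: prob_space "PiM {1..n} (\<lambda>_. Q)" by (intro prob_space_PiM Q.prob_space_axioms)
  let ?M = "PiM {1..n} (\<lambda>_. Q)" and ?e = "threshold n \<delta>"
  have ln: "ln (exp 1 / \<delta>) = 1 + ln (1 / \<delta>)" "0 \<le> ln (1 / \<delta>)" using \<delta> by (auto simp: ln_div)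
  have e0: "0 \<le> ?e k" for k using ln n by (simp add: threshold_def)
  have small: "24 * k < n" if "?e k \<le> 1" for k
  proof -
    have "4 * (6 * real k + ln (exp 1 / \<delta>)) \<le> real n" using that n by (simp add: threshold_def field_simps)
    then have "24 * real k + 4 * ln (exp 1 / \<delta>) \<le> real n" by (simp add: algebra_simps)
    moreover have "0 < ln (exp 1 / \<delta>)" using ln by simp
    ultimately have "24 * real k < real n" by simp
    then show ?thesis by linarith
  qed
  \<comment> \<open>A threshold above 1 is never exceeded, and one below 1 forces \<open>24 k < n\<close>.\<close>
  define ks where "ks = {k\<in>{..n}. ?e k \<le> 1}"
  define Js where "Js = (\<lambda>k. {J. J \<subseteq> {..<2 * k} \<and> card J \<le> k})"
  define W where "W = (\<lambda>k J. {y \<in> space ?M. ?e k < miss (run (block n k J) y n) \<and>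
     (\<forall>i\<in>{1..n} - block n k J. y i \<in> Good (run (block n k J) y n))})"
  have finJ: "finite (Js k)" for k by (rule finite_subset[of _ "Pow {..<2 * k}"]) (auto simp: Js_def)
  have cardJ: "real (card (Js k)) \<le> 4 ^ k" for k
  proof -
    have "card (Js k) \<le> card (Pow {..<2 * k})" by (intro card_mono) (auto simp: Js_def)
    also have "\<dots> = 4 ^ k" by (simp add: card_Pow power_mult)
    finally have "real (card (Js k)) \<le> real (4 ^ k)" by (simp only: of_nat_le_iff)
    then show ?thesis by simp
  qed
  have W: "W k J \<in> sets ?M" "measure ?M (W k J) \<le> \<delta> * exp (- (6 * real k) - 1)" if k: "k \<in> ks" and J: "J \<in> Js k" for k J
  proof -
    have e1: "?e k \<le> 1" using k by (simp add: ks_def)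
    have sub: "block n k J \<subseteq> {1..n}" by (auto simp: block_def)
    show "W k J \<in> sets ?M" unfolding W_def by (rule holdout_bound(1)[OF sub e0 e1])
    let ?m = "card ({1..n} - block n k J)"
    have "measure ?M (W k J) \<le> (1 - ?e k) ^ ?m" unfolding W_def by (rule holdout_bound(2)[OF sub e0 e1])
    also have "\<dots> \<le> exp (- ?e k) ^ ?m" using e1 exp_ge_add_one_self[of "- ?e k"] by (intro power_mono) auto
    also have "\<dots> = exp (- (?e k * ?m))" by (simp add: exp_of_nat_mult[symmetric] mult.commute)
    also have "\<dots> \<le> exp (- (?e k * (real n / 4)))"
    proof -
      have "real n / 4 \<le> real ?m" using card_outside_block[OF _ _ small[OF e1], of J] J by (simp add: Js_def)
      from mult_left_mono[OF this e0[of k]] show ?thesis by simp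
    qed
    also have "?e k * (real n / 4) = 6 * real k + 1 + ln (1 / \<delta>)"
      using n ln by (simp add: threshold_def)
    also have "exp (- (6 * real k + 1 + ln (1 / \<delta>))) = \<delta> * exp (- (6 * real k) - 1)"
      using \<delta> by (simp add: exp_diff exp_add exp_minus ln_div field_simps)
    finally show "measure ?M (W k J) \<le> \<delta> * exp (- (6 * real k) - 1)" .
  qed
  define Z where "Z = (\<Union>k\<in>ks. \<Union>J\<in>Js k. W k J)"
  have fink: "finite ks" by (simp add: ks_def)
  have Zs: "Z \<in> sets ?M" unfolding Z_def using fink finJ W(1) by (intro sets.finite_UN) auto
  have "measure ?M Z \<le> (\<Sum>k\<in>ks. measure ?M (\<Union>J\<in>Js k. W k J))"
    unfolding Z_def using fink finJ W(1) by (intro PP.finite_measure_subadditive_finite) auto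
  also have "\<dots> \<le> (\<Sum>k\<in>ks. \<Sum>J\<in>Js k. measure ?M (W k J))"
    using finJ W(1) by (intro sum_mono PP.finite_measure_subadditive_finite) auto
  also have "\<dots> \<le> (\<Sum>k\<in>ks. \<Sum>J\<in>Js k. \<delta> * exp (- (6 * real k) - 1))"
    using W(2) by (intro sum_mono) auto
  also have "\<dots> = (\<Sum>k\<in>ks. real (card (Js k)) * (\<delta> * exp (- (6 * real k) - 1)))" by simp
  also have "\<dots> \<le> (\<Sum>k\<in>ks. \<delta> * (1/2) ^ Suc k)"
  proof (intro sum_mono)
    fix k
    have e2: "2 \<le> exp (1::real)" using exp_ge_add_one_self[of 1] by simp
    have "(2::real) ^ (6 * k + 1) \<le> exp 1 ^ (6 * k + 1)" using e2 by (intro power_mono) auto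
    also have "\<dots> = exp (6 * real k + 1)" by (simp add: exp_of_nat_mult[symmetric] exp_add)
    finally have "exp (- (6 * real k) - 1) \<le> inverse (2 ^ (6 * k + 1))"
    proof -
      assume "(2::real) ^ (6 * k + 1) \<le> exp (6 * real k + 1)"
      then have "inverse (exp (6 * real k + 1)) \<le> inverse (2 ^ (6 * k + 1))" by (intro le_imp_inverse_le) auto
      moreover have "exp (- (6 * real k) - 1) = inverse (exp (6 * real k + 1))"
        by (simp add: exp_minus[symmetric])
      ultimately show ?thesis by simp
    qed
    then have "4 ^ k * exp (- (6 * real k) - 1) \<le> 4 ^ k * inverse (2 ^ (6 * k + 1))" by (intro mult_left_mono) auto
    also have "\<dots> = (1/2) * (4 ^ k * inverse 64 ^ k)"
      by (simp add: power_add power_mult power_inverse power_one_over inverse_eq_divide)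
    also have "\<dots> = (1/2) * (4 * inverse 64) ^ k" by (simp only: power_mult_distrib)
    also have "\<dots> \<le> (1/2) * (1/2) ^ k" by (intro mult_left_mono power_mono) auto
    finally have *: "4 ^ k * exp (- (6 * real k) - 1) \<le> (1/2::real) ^ Suc k" by simp
    have "real (card (Js k)) * (\<delta> * exp (- (6 * real k) - 1)) \<le> 4 ^ k * (\<delta> * exp (- (6 * real k) - 1))"
      using cardJ \<delta> by (intro mult_right_mono) auto
    also have "\<dots> = \<delta> * (4 ^ k * exp (- (6 * real k) - 1))" by simp
    also have "\<dots> \<le> \<delta> * (1/2) ^ Suc k" using * \<delta> by (intro mult_left_mono) auto
    finally show "real (card (Js k)) * (\<delta> * exp (- (6 * real k) - 1)) \<le> \<delta> * (1/2) ^ Suc k" .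
  qed
  also have "\<dots> = \<delta> * (\<Sum>k\<in>ks. (1/2) ^ Suc k)" by (simp add: sum_distrib_left)
  also have "\<dots> \<le> \<delta> * 1"
  proof (intro mult_left_mono)
    have "(\<Sum>k\<in>ks. (1/2::real) ^ Suc k) \<le> (\<Sum>k. (1/2) ^ Suc k)"
      using fink power_half_series by (intro sum_le_suminf) (auto simp: sums_iff)
    then show "(\<Sum>k\<in>ks. (1/2::real) ^ Suc k) \<le> 1" using power_half_series by (simp add: sums_iff)
  qed (use \<delta> in auto)
  finally have prob: "measure ?M Z \<le> \<delta>" by simp
  have "y \<in> Z" if y: "y \<in> space ?M" and bad: "?e (card (updates n y)) < miss (run UNIV y n)" for y
  proof -
    define k where "k = card (updates n y)"
    define J where "J = (\<lambda>i. (i - 1) mod (2 * k)) ` updates n y"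
    have yQ: "y i \<in> space Q" if "i \<in> {1..n}" for i using y that by (auto simp: space_PiM)
    have fin: "finite (updates n y)" and U: "updates n y \<subseteq> {1..n}" by (auto simp: updates_def)
    have kn: "k \<le> n" using card_mono[OF _ U] by (simp add: k_def)
    have "miss (run UNIV y n) \<le> 1" by (simp add: miss_def)
    then have k: "k \<in> ks" using bad kn by (simp add: ks_def k_def)
    have J: "J \<in> Js k"
    proof (cases "k = 0")
      case True
      then show ?thesis using fin by (simp add: Js_def J_def k_def)
    next
      case False
      then show ?thesis using card_image_le[OF fin] by (auto simp: Js_def J_def k_def)
    qed
    have sub: "updates n y \<subseteq> block n k J" using U by (auto simp: block_def J_def)
    have "run (block n k J) y n = run UNIV y n" by (rule run_stable[OF sub]) simp
    moreover have "y i \<in> Good (run UNIV y n)" if "i \<in> {1..n} - block n k J" for i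
      using that sub by (intro unused_point_Good yQ) auto
    ultimately have "y \<in> W k J" using y bad by (simp add: W_def k_def)
    then show ?thesis using k J by (auto simp: Z_def)
  qed
  then show ?thesis using that Zs prob by blast
qed

end


section \<open>Powers of a positive contraction\<close>

text \<open>A symmetric operator between 0 and the identity. The numbers \<open>mom v k\<close> are the moments of its
  spectral measure at \<open>v\<close>; their properties follow from the Cauchy--Schwarz inequality for the two
  forms \<open>u \<bullet> v\<close> and \<open>u \<bullet> Q v\<close>, according to the parity of the exponent.\<close>

locale contraction =
  fixes Q :: "'a::euclidean_space \<Rightarrow> 'a"
  assumes lin: "linear Q" and sym: "\<And>u v. u \<bullet> Q v = Q u \<bullet> v"
    and pos: "\<And>v. 0 \<le> v \<bullet> Q v" and le_id: "\<And>v. v \<bullet> Q v \<le> v \<bullet> v"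
begin

definition mom :: "'a \<Rightarrow> nat \<Rightarrow> real" where "mom v k = v \<bullet> (Q ^^ k) v"

lemma lin_pow: "linear (Q ^^ k)"
proof (induction k)
  case (Suc k)
  then show ?case using linear_compose[OF Suc lin] by (simp add: o_def)
qed (simp add: linear_iff)

lemma sym_pow: "u \<bullet> (Q ^^ k) v = (Q ^^ k) u \<bullet> v"
proof (induction k arbitrary: u)
  case (Suc k)
  have "u \<bullet> (Q ^^ Suc k) v = Q u \<bullet> (Q ^^ k) v" by (simp add: sym)
  also have "\<dots> = (Q ^^ k) (Q u) \<bullet> v" by (rule Suc)
  also have "(Q ^^ k) (Q u) = (Q ^^ Suc k) u" by (simp add: funpow_swap1)
  finally show ?case .
qed simp

lemma pow_add: "(Q ^^ (j + k)) v = (Q ^^ j) ((Q ^^ k) v)"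
  by (simp add: funpow_add)

lemma mom_split: "mom v (j + k) = (Q ^^ j) v \<bullet> (Q ^^ k) v"
  unfolding mom_def pow_add by (rule sym_pow)

lemma even_or_odd: obtains h where "k = h + h" | h where "k = h + Suc h"
proof (cases "even k")
  case True
  then obtain h where "k = 2 * h" by (elim evenE)
  then show ?thesis using that(1)[of h] by simp
next
  case False
  then obtain h where "k = 2 * h + 1" by (elim oddE)
  then show ?thesis using that(2)[of h] by simp
qed

lemma mom_pos: "0 \<le> mom v k"
proof (cases k rule: even_or_odd)
  case (1 h)
  then show ?thesis by (simp add: mom_split)
next
  case (2 h)
  then show ?thesis using pos[of "(Q ^^ h) v"] mom_split[of v h "Suc h"] by simp
qed

lemma form_Cauchy_Schwarz: "(u \<bullet> Q v)\<^sup>2 \<le> (u \<bullet> Q u) * (v \<bullet> Q v)"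
proof -
  have *: "0 \<le> u \<bullet> Q u + 2 * s * (u \<bullet> Q v) + s\<^sup>2 * (v \<bullet> Q v)" for s
    using pos[of "u + s *\<^sub>R v"] sym[of v u]
    by (simp add: linear_add[OF lin] linear_cmul[OF lin] inner_add inner_commute algebra_simps power2_eq_square)
  show ?thesis
  proof (cases "v \<bullet> Q v = 0")
    case True
    have "u \<bullet> Q v = 0"
    proof (rule ccontr)
      assume "u \<bullet> Q v \<noteq> 0"
      then show False using *[of "- (u \<bullet> Q u + 1) / (2 * (u \<bullet> Q v))"] True by (simp add: field_simps)
    qed
    then show ?thesis using True by simp
  next
    case False
    then have p: "0 < v \<bullet> Q v" using pos[of v] by linarith
    have "0 \<le> (v \<bullet> Q v) * (u \<bullet> Q u + 2 * (- (u \<bullet> Q v) / (v \<bullet> Q v)) * (u \<bullet> Q v) + (- (u \<bullet> Q v) / (v \<bullet> Q v))\<^sup>2 * (v \<bullet> Q v))"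
      using p by (intro mult_nonneg_nonneg *) auto
    also have "\<dots> = (u \<bullet> Q u) * (v \<bullet> Q v) - (u \<bullet> Q v)\<^sup>2"
      using p by (simp add: field_simps power2_eq_square)
    finally show ?thesis by simp
  qed
qed

lemma mom_log_convex: "(mom v (Suc k))\<^sup>2 \<le> mom v k * mom v (Suc (Suc k))"
proof (cases k rule: even_or_odd)
  case (1 h)
  let ?a = "(Q ^^ h) v" and ?b = "(Q ^^ Suc h) v"
  have "(?a \<bullet> ?b)\<^sup>2 \<le> (?a \<bullet> ?a) * (?b \<bullet> ?b)" by (rule Cauchy_Schwarz_ineq)
  moreover have "mom v (Suc k) = ?a \<bullet> ?b" "mom v k = ?a \<bullet> ?a" "mom v (Suc (Suc k)) = ?b \<bullet> ?b"
    using 1 mom_split[of v h "Suc h"] mom_split[of v h h] mom_split[of v "Suc h" "Suc h"] by auto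
  ultimately show ?thesis by simp
next
  case (2 h)
  let ?a = "(Q ^^ h) v" and ?b = "(Q ^^ Suc h) v"
  have "(?a \<bullet> Q ?b)\<^sup>2 \<le> (?a \<bullet> Q ?a) * (?b \<bullet> Q ?b)" by (rule form_Cauchy_Schwarz)
  moreover have "mom v (Suc k) = ?a \<bullet> Q ?b" "mom v k = ?a \<bullet> Q ?a" "mom v (Suc (Suc k)) = ?b \<bullet> Q ?b"
    using 2 mom_split[of v h "Suc (Suc h)"] mom_split[of v h "Suc h"] mom_split[of v "Suc h" "Suc (Suc h)"] by auto
  ultimately show ?thesis by simp
qed

lemma mom_zero: "mom v 0 = v \<bullet> v" by (simp add: mom_def)

lemma mom_shift: "a \<le> b \<Longrightarrow> mom v (Suc a) * mom v b \<le> mom v a * mom v (Suc b)"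
proof (induction b)
  case (Suc b)
  show ?case
  proof (cases "a = Suc b")
    case False
    then have IH: "mom v (Suc a) * mom v b \<le> mom v a * mom v (Suc b)" using Suc by simp
    have lc: "(mom v (Suc b))\<^sup>2 \<le> mom v b * mom v (Suc (Suc b))" by (rule mom_log_convex)
    show ?thesis
    proof (cases "mom v b = 0")
      case True
      then have "mom v (Suc b) = 0" using lc by simp
      then show ?thesis using mom_pos[of v a] mom_pos[of v "Suc (Suc b)"] by simp
    next
      case False
      then have pb: "0 < mom v b" using mom_pos[of v b] by linarith
      have "mom v b * (mom v (Suc a) * mom v (Suc b)) = (mom v (Suc a) * mom v b) * mom v (Suc b)" by simp
      also have "\<dots> \<le> (mom v a * mom v (Suc b)) * mom v (Suc b)" using IH mom_pos by (rule mult_right_mono)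
      also have "\<dots> = mom v a * (mom v (Suc b))\<^sup>2" by (simp add: power2_eq_square)
      also have "\<dots> \<le> mom v a * (mom v b * mom v (Suc (Suc b)))" using lc mom_pos by (rule mult_left_mono)
      also have "\<dots> = mom v b * (mom v a * mom v (Suc (Suc b)))" by simp
      finally show ?thesis using pb by simp
    qed
  qed simp
qed (simp add: mult.commute)

text \<open>Log-convexity makes the moments positively associated.\<close>

lemma mom_association_le: "a \<le> b \<Longrightarrow> mom v a * mom v b \<le> mom v 0 * mom v (a + b)"
proof (induction a arbitrary: b)
  case (Suc a)
  have "mom v (Suc a) * mom v b \<le> mom v a * mom v (Suc b)" using Suc by (intro mom_shift) simp
  also have "\<dots> \<le> mom v 0 * mom v (a + Suc b)" using Suc by (intro Suc.IH) simp
  finally show ?case by simp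
qed simp

lemma mom_association: "mom v a * mom v b \<le> mom v 0 * mom v (a + b)"
  using mom_association_le[of a b v] mom_association_le[of b a v] by (cases "a \<le> b") (auto simp: add.commute mult.commute)

lemma mom_Jensen: "v \<bullet> v = 1 \<Longrightarrow> (v \<bullet> Q v) ^ k \<le> mom v k"
proof (induction k)
  case (Suc k)
  have "(v \<bullet> Q v) ^ Suc k \<le> (v \<bullet> Q v) * mom v k" using Suc pos by (simp add: mult_left_mono)
  also have "\<dots> = mom v 1 * mom v k" by (simp add: mom_def)
  also have "\<dots> \<le> mom v (Suc k)" using mom_association[of v 1 k] Suc by (simp add: mom_zero)
  finally show ?case .
qed (simp add: mom_def)

lemma mom_decreasing: "mom v (Suc k) \<le> mom v k"
proof (cases k rule: even_or_odd)
  case (1 h)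
  have "mom v (Suc k) = (Q ^^ h) v \<bullet> Q ((Q ^^ h) v)" using 1 mom_split[of v h "Suc h"] by simp
  then show ?thesis using 1 le_id[of "(Q ^^ h) v"] mom_split[of v h h] by simp
next
  case (2 h)
  let ?b = "(Q ^^ Suc h) v"
  have m1: "mom v (Suc k) = ?b \<bullet> ?b" using 2 mom_split[of v "Suc h" "Suc h"] by simp
  have "mom v (Suc (Suc k)) = ?b \<bullet> Q ?b" using 2 mom_split[of v "Suc h" "Suc (Suc h)"] by simp
  then have "mom v (Suc (Suc k)) \<le> mom v (Suc k)" using m1 le_id by simp
  then have "mom v k * mom v (Suc (Suc k)) \<le> mom v k * mom v (Suc k)" using mom_pos by (intro mult_left_mono)
  then have "mom v (Suc k) * mom v (Suc k) \<le> mom v k * mom v (Suc k)"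
    using mom_log_convex[of v k] by (simp add: power2_eq_square)
  then show ?thesis using mom_pos[of v k] mom_pos[of v "Suc k"] by (auto simp: mult_le_cancel_right)
qed

lemma mom_le_zero: "mom v k \<le> v \<bullet> v"
  by (induction k) (use mom_decreasing mom_zero in \<open>auto intro: order_trans\<close>)

definition tr :: "nat \<Rightarrow> real" where "tr k = (\<Sum>b\<in>Basis. mom b k)"

lemma tr_pos: "0 \<le> tr k" unfolding tr_def by (intro sum_nonneg mom_pos)

lemma tr_le: "tr k \<le> DIM('a)"
proof -
  have "tr k \<le> (\<Sum>b::'a\<in>Basis. 1)"
    unfolding tr_def using mom_le_zero by (intro sum_mono) (metis inner_same_Basis)
  then show ?thesis by simp
qed

text \<open>The trace of a positive operator dominates its quadratic form on the unit sphere.\<close>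

lemma mom_le_tr:
  assumes "v \<bullet> v = 1" shows "mom v (2 * h) \<le> tr (2 * h)"
proof -
  have e: "mom u (2 * h) = (norm ((Q ^^ h) u))\<^sup>2" for u
    using mom_split[of u h h] by (simp add: mult_2 power2_norm_eq_inner)
  have "(Q ^^ h) v = (\<Sum>b\<in>Basis. (v \<bullet> b) *\<^sub>R (Q ^^ h) b)"
  proof -
    have "(Q ^^ h) v = (Q ^^ h) (\<Sum>b\<in>Basis. (v \<bullet> b) *\<^sub>R b)" by (simp only: euclidean_representation)
    then show ?thesis by (simp only: linear_sum[OF lin_pow] linear_cmul[OF lin_pow])
  qed
  then have "norm ((Q ^^ h) v) \<le> (\<Sum>b\<in>Basis. \<bar>v \<bullet> b\<bar> * norm ((Q ^^ h) b))"
    using norm_sum[of "\<lambda>b. (v \<bullet> b) *\<^sub>R (Q ^^ h) b" Basis] by simp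
  also have "\<dots> \<le> L2_set (\<lambda>b. v \<bullet> b) Basis * L2_set (\<lambda>b. norm ((Q ^^ h) b)) Basis"
    using L2_set_mult_ineq[of "\<lambda>b. v \<bullet> b" "\<lambda>b. norm ((Q ^^ h) b)" Basis] by simp
  also have "L2_set (\<lambda>b. v \<bullet> b) Basis = 1"
    using assms euclidean_inner[of v v] by (simp add: L2_set_def power2_eq_square)
  finally have "norm ((Q ^^ h) v) \<le> sqrt (tr (2 * h))" by (simp add: L2_set_def tr_def e)
  then have "(norm ((Q ^^ h) v))\<^sup>2 \<le> (sqrt (tr (2 * h)))\<^sup>2" by (intro power_mono) auto
  then show ?thesis using tr_pos by (simp add: e)
qed

lemma mom_lower_even:
  assumes "\<And>v. c * (v \<bullet> v) \<le> v \<bullet> Q v" shows "c * mom v (2 * h) \<le> mom v (Suc (2 * h))"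
  using assms[of "(Q ^^ h) v"] mom_split[of v h h] mom_split[of v h "Suc h"] by (simp add: mult_2)

end

text \<open>Subtracting a rank-one term: both operators appear in the telescoped difference of powers, and
  positive association of the moments controls the second-order term.\<close>

locale rank_one_step = contraction Q + Q': contraction Q'
  for Q Q' :: "'a::euclidean_space \<Rightarrow> 'a" and x :: 'a and t :: real +
  assumes t: "0 \<le> t" and x: "x \<bullet> x \<le> 1" and step: "\<And>v. Q' v = Q v - (t * (x \<bullet> v)) *\<^sub>R x"
begin

lemma pow_diff: "(Q ^^ m) v - (Q' ^^ m) v = (\<Sum>a<m. (t * (x \<bullet> (Q' ^^ (m - 1 - a)) v)) *\<^sub>R (Q ^^ a) x)"
proof (induction m)
  case (Suc m)
  have "(Q ^^ Suc m) v - (Q' ^^ Suc m) v = Q ((Q ^^ m) v - (Q' ^^ m) v) + (Q ((Q' ^^ m) v) - Q' ((Q' ^^ m) v))"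
    by (simp add: linear_diff[OF lin])
  also have "Q ((Q' ^^ m) v) - Q' ((Q' ^^ m) v) = (t * (x \<bullet> (Q' ^^ m) v)) *\<^sub>R x" by (simp add: step)
  also have "Q ((Q ^^ m) v - (Q' ^^ m) v) = (\<Sum>a<m. (t * (x \<bullet> (Q' ^^ (m - 1 - a)) v)) *\<^sub>R (Q ^^ Suc a) x)"
    unfolding Suc by (simp add: linear_sum[OF lin] linear_cmul[OF lin])
  finally show ?case by (simp add: sum.lessThan_Suc_shift del: sum.lessThan_Suc)
qed simp

lemma pow_diff': "(Q ^^ m) v - (Q' ^^ m) v = (\<Sum>a<m. (t * (x \<bullet> (Q ^^ (m - 1 - a)) v)) *\<^sub>R (Q' ^^ a) x)"
proof (induction m)
  case (Suc m)
  have "(Q ^^ Suc m) v - (Q' ^^ Suc m) v = Q' ((Q ^^ m) v - (Q' ^^ m) v) + (Q ((Q ^^ m) v) - Q' ((Q ^^ m) v))"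
    by (simp add: linear_diff[OF Q'.lin])
  also have "Q ((Q ^^ m) v) - Q' ((Q ^^ m) v) = (t * (x \<bullet> (Q ^^ m) v)) *\<^sub>R x" by (simp add: step)
  also have "Q' ((Q ^^ m) v - (Q' ^^ m) v) = (\<Sum>a<m. (t * (x \<bullet> (Q ^^ (m - 1 - a)) v)) *\<^sub>R (Q' ^^ Suc a) x)"
    unfolding Suc by (simp add: linear_sum[OF Q'.lin] linear_cmul[OF Q'.lin])
  finally show ?case by (simp add: sum.lessThan_Suc_shift del: sum.lessThan_Suc)
qed simp

lemma mom_diff: "mom x k - Q'.mom x k = (\<Sum>a<k. t * (Q'.mom x (k - 1 - a) * mom x a))"
  using arg_cong[OF pow_diff[of k x], of "\<lambda>w. x \<bullet> w"]
  by (simp add: mom_def Q'.mom_def inner_diff_right inner_sum_right mult.assoc)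

lemma mom_mono: "Q'.mom x k \<le> mom x k"
  using mom_diff[of k] t mom_pos Q'.mom_pos by (smt (verit) mult_nonneg_nonneg sum_nonneg)

lemma mom_diff_le: "mom x (Suc k) - Q'.mom x (Suc k) \<le> t * (Suc k * mom x k)"
proof -
  have "mom x (Suc k) - Q'.mom x (Suc k) \<le> (\<Sum>a<Suc k. t * mom x k)"
    unfolding mom_diff
  proof (intro sum_mono mult_left_mono t)
    fix a assume a: "a \<in> {..<Suc k}"
    have "Q'.mom x (Suc k - 1 - a) * mom x a \<le> mom x (k - a) * mom x a"
      using mom_mono mom_pos by (simp add: mult_right_mono)
    also have "\<dots> \<le> mom x 0 * mom x k" using mom_association[of x "k - a" a] a by simp
    also have "\<dots> \<le> 1 * mom x k" using x mom_pos by (intro mult_right_mono) (auto simp: mom_zero)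
    finally show "Q'.mom x (Suc k - 1 - a) * mom x a \<le> mom x k" by simp
  qed
  then show ?thesis by (simp add: algebra_simps)
qed

lemma mixed_mom: "Q'.mom x (j + a) \<le> (Q' ^^ j) x \<bullet> (Q ^^ a) x"
proof -
  have "(Q' ^^ j) x \<bullet> (Q ^^ a) x - Q'.mom x (j + a) = (Q' ^^ j) x \<bullet> ((Q ^^ a) x - (Q' ^^ a) x)"
    by (simp add: Q'.mom_split inner_diff_right)
  also have "\<dots> = (\<Sum>c<a. t * (mom x (a - 1 - c) * Q'.mom x (j + c)))"
    unfolding pow_diff' by (simp add: inner_sum_right mom_def Q'.mom_split mult.assoc)
  also have "\<dots> \<ge> 0" using t mom_pos Q'.mom_pos by (intro sum_nonneg mult_nonneg_nonneg)
  finally show ?thesis by simp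
qed

lemma tr_drop: "t * (real (Suc q) * Q'.mom x q) \<le> tr (Suc q) - Q'.tr (Suc q)"
proof -
  have "tr (Suc q) - Q'.tr (Suc q) = (\<Sum>b\<in>Basis. b \<bullet> ((Q ^^ Suc q) b - (Q' ^^ Suc q) b))"
    by (simp add: tr_def Q'.tr_def mom_def Q'.mom_def inner_diff_right sum_subtractf)
  also have "\<dots> = (\<Sum>a<Suc q. t * (\<Sum>b\<in>Basis. (b \<bullet> (Q ^^ a) x) * (x \<bullet> (Q' ^^ (q - a)) b)))"
    unfolding pow_diff inner_sum_right by (subst sum.swap) (simp add: sum_distrib_left mult_ac)
  also have "\<dots> = (\<Sum>a<Suc q. t * ((Q' ^^ (q - a)) x \<bullet> (Q ^^ a) x))"
  proof (intro sum.cong refl arg_cong[where f="\<lambda>s. t * s"])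
    fix a
    show "(\<Sum>b\<in>Basis. (b \<bullet> (Q ^^ a) x) * (x \<bullet> (Q' ^^ (q - a)) b)) = (Q' ^^ (q - a)) x \<bullet> (Q ^^ a) x"
      unfolding Q'.sym_pow by (subst euclidean_inner) (simp add: mult.commute inner_commute)
  qed
  also have "\<dots> \<ge> (\<Sum>a<Suc q. t * Q'.mom x q)"
  proof (intro sum_mono mult_left_mono t)
    fix a assume "a \<in> {..<Suc q}"
    then show "Q'.mom x q \<le> (Q' ^^ (q - a)) x \<bullet> (Q ^^ a) x" using mixed_mom[of "q - a" a] by simp
  qed
  finally show ?thesis by (simp add: algebra_simps)
qed

text \<open>With exponent \<open>q = 2 h + 2\<close> and \<open>t q = 1/2\<close>, the first-order drop \<open>t q m\<^bsub>q-1\<^esub>\<close> loses at most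
  \<open>t q \<cdot> t (q - 1) m\<^bsub>q-2\<^esub>\<close> at second order, and \<open>m\<^bsub>q-2\<^esub> \<le> (40/39) m\<^bsub>q-1\<^esub>\<close>; this leaves the factor
  \<open>(1/2) (1 - 20/39) = 19/78\<close>.\<close>

lemma tr_drop_quantitative:
  assumes t_def: "t = 1 / (2 * real (2 * h + 2))"
    and low: "\<And>v. 39/40 * (v \<bullet> v) \<le> v \<bullet> Q v"
  shows "19/78 * mom x (2 * h + 2) \<le> tr (2 * h + 2) - Q'.tr (2 * h + 2)"
proof -
  let ?q = "2 * h + 1"
  have tq: "t * real (Suc ?q) = 1/2" by (simp add: t_def)
  have "t * real (Suc (2 * h)) \<le> 1/2" using tq t by (simp add: algebra_simps)
  then have "t * real (Suc (2 * h)) * mom x (2 * h) \<le> 1/2 * mom x (2 * h)"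
    using mom_pos by (rule mult_right_mono)
  then have "mom x ?q - Q'.mom x ?q \<le> 1/2 * mom x (2 * h)"
    using mom_diff_le[of "2 * h"] by (simp add: mult.assoc)
  moreover have "39/40 * mom x (2 * h) \<le> mom x ?q" using mom_lower_even[OF low, of x h] by simp
  ultimately have "19/39 * mom x ?q \<le> Q'.mom x ?q" by linarith
  moreover have "mom x (Suc ?q) \<le> mom x ?q" by (rule mom_decreasing)
  moreover have "1/2 * Q'.mom x ?q \<le> tr (Suc ?q) - Q'.tr (Suc ?q)" 
  proof -
    have "t * (real (Suc ?q) * Q'.mom x ?q) = 1/2 * Q'.mom x ?q" by (simp only: mult.assoc[symmetric] tq)
    then show ?thesis using tr_drop[of ?q] by linarith
  qed
  ultimately show ?thesis by simp
qed

end

section \<open>Concentration of the design matrix\<close>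

locale random_design = prob_space P for P :: "'z measure" +
  fixes X :: "'z \<Rightarrow> 'a::euclidean_space" and \<kappa> :: real and n :: nat
  assumes X_meas [measurable]: "X \<in> borel_measurable P" and X_norm: "\<And>z. norm (X z) \<le> 1"
    and \<kappa>: "0 < \<kappa>" and second_moment: "\<And>v. \<kappa> * (v \<bullet> v) \<le> (\<integral>z. (X z \<bullet> v)\<^sup>2 \<partial>P)"
    and n: "1 \<le> n"
begin

text \<open>The rate is half the inverse of the exponent \<open>20 n\<close> of the potential, so that all \<open>n\<close> rank-one terms
  together move the identity by at most \<open>1/40\<close>.\<close>

definition rate :: real where "rate = 1 / (40 * real n)"

definition deflate :: "nat set \<Rightarrow> (nat \<Rightarrow> 'z) \<Rightarrow> 'a \<Rightarrow> 'a" where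
  "deflate I z v = v - rate *\<^sub>R (\<Sum>i\<in>I. (X (z i) \<bullet> v) *\<^sub>R X (z i))"

lemma X_inner_le: "(X z \<bullet> v)\<^sup>2 \<le> v \<bullet> v"
proof -
  have "(X z \<bullet> v)\<^sup>2 \<le> (X z \<bullet> X z) * (v \<bullet> v)" by (rule Cauchy_Schwarz_ineq)
  also have "X z \<bullet> X z \<le> 1" using X_norm[of z] by (simp add: norm_eq_sqrt_inner)
  then have "(X z \<bullet> X z) * (v \<bullet> v) \<le> 1 * (v \<bullet> v)" by (intro mult_right_mono) auto
  finally show ?thesis by simp
qed

lemma deflate_form: "v \<bullet> deflate I z v = v \<bullet> v - rate * (\<Sum>i\<in>I. (X (z i) \<bullet> v)\<^sup>2)"
  by (simp add: deflate_def inner_diff_right inner_sum_right power2_eq_square inner_commute)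

lemma deflate_form_lower: "I \<subseteq> {1..n} \<Longrightarrow> 39/40 * (v \<bullet> v) \<le> v \<bullet> deflate I z v"
proof -
  assume I: "I \<subseteq> {1..n}"
  have "(\<Sum>i\<in>I. (X (z i) \<bullet> v)\<^sup>2) \<le> (\<Sum>i\<in>I. v \<bullet> v)" by (intro sum_mono X_inner_le)
  also have "\<dots> = real (card I) * (v \<bullet> v)" by simp
  also have "\<dots> \<le> real n * (v \<bullet> v)" using card_mono[OF _ I] by (intro mult_right_mono) auto
  finally have "rate * (\<Sum>i\<in>I. (X (z i) \<bullet> v)\<^sup>2) \<le> rate * (real n * (v \<bullet> v))"
    by (intro mult_left_mono) (auto simp: rate_def)
  also have "\<dots> = 1/40 * (v \<bullet> v)" using n by (simp add: rate_def)
  finally show ?thesis by (simp add: deflate_form)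
qed

lemma contraction_deflate: "I \<subseteq> {1..n} \<Longrightarrow> contraction (deflate I z)"
proof
  assume I: "I \<subseteq> {1..n}"
  show "deflate I z (u + v) = deflate I z u + deflate I z v" for u v
    by (simp add: deflate_def inner_add_right scaleR_add_left sum.distrib scaleR_add_right)
  show "deflate I z (r *\<^sub>R v) = r *\<^sub>R deflate I z v" for r v
    by (simp add: deflate_def scaleR_diff_right scaleR_sum_right mult_ac)
  show "u \<bullet> deflate I z v = deflate I z u \<bullet> v" for u v
    by (simp add: deflate_def inner_diff_right inner_diff_left inner_sum_right inner_sum_left mult.commute inner_commute)
  have "0 \<le> 39/40 * (v \<bullet> v)" for v :: 'a by simp
  then show "0 \<le> v \<bullet> deflate I z v" for v using deflate_form_lower[OF I, of v z] by (rule order_trans)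
  show "v \<bullet> deflate I z v \<le> v \<bullet> v" for v
    by (simp add: deflate_form rate_def sum_nonneg)
qed

lemma deflate_cong: "(\<And>i. i \<in> I \<Longrightarrow> z i = z' i) \<Longrightarrow> deflate I z = deflate I z'"
  unfolding deflate_def fun_eq_iff by (simp cong: sum.cong)

lemma deflate_insert: "finite I \<Longrightarrow> i \<notin> I \<Longrightarrow> deflate (insert i I) z v = deflate I z v - (rate * (X (z i) \<bullet> v)) *\<^sub>R X (z i)"
  by (simp add: deflate_def algebra_simps)

lemma deflate_pow_measurable: "(\<lambda>z. (deflate I z ^^ k) v) \<in> borel_measurable (PiM I (\<lambda>_. P))"
proof (induction k)
  case (Suc k)
  then show ?case unfolding funpow.simps o_def deflate_def by measurable
qed simp

definition potential :: "nat set \<Rightarrow> (nat \<Rightarrow> 'z) \<Rightarrow> real" where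
  "potential I z = (\<Sum>b\<in>Basis. b \<bullet> (deflate I z ^^ (20 * n)) b)"

lemma potential_eq_tr: "I \<subseteq> {1..n} \<Longrightarrow> potential I z = contraction.tr (deflate I z) (20 * n)"
  by (simp add: potential_def contraction.tr_def contraction.mom_def contraction_deflate)

lemma potential_measurable: "potential I \<in> borel_measurable (PiM I (\<lambda>_. P))"
  unfolding potential_def[abs_def]
  by (intro borel_measurable_sum borel_measurable_inner deflate_pow_measurable) auto

lemma potential_bounds: "I \<subseteq> {1..n} \<Longrightarrow> 0 \<le> potential I z \<and> potential I z \<le> DIM('a)"
  using contraction.tr_pos[OF contraction_deflate] contraction.tr_le[OF contraction_deflate] by (simp add: potential_eq_tr)

lemma X_inner_integrable: "integrable P (\<lambda>z. (X z \<bullet> v)\<^sup>2)"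
  using X_inner_le by (intro integrable_const_bound[where B="v \<bullet> v"]) auto

text \<open>One more observation shrinks the expected potential geometrically.\<close>

lemma potential_step:
  assumes I: "insert i I \<subseteq> {1..n}" "i \<notin> I"
  shows "(\<integral>y. potential (insert i I) (z(i := y)) \<partial>P) \<le> (1 - 19/78 * \<kappa>) * potential I z"
proof -
  let ?Q = "deflate I z"
  have I': "I \<subseteq> {1..n}" "finite I" using I finite_subset by auto
  interpret Q: contraction ?Q by (rule contraction_deflate[OF I'(1)])
  define h where "h = 10 * n - 1"
  have h: "2 * h + 2 = 20 * n" using n by (simp add: h_def)
  have drop: "potential (insert i I) (z(i := y)) \<le> potential I z - 19/78 * Q.mom (X y) (20 * n)" for y
  proof -
    have deflate_eq: "deflate I (z(i := y)) = ?Q" using I(2) by (intro deflate_cong) auto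
    interpret Q': contraction "deflate (insert i I) (z(i := y))" by (rule contraction_deflate[OF I(1)])
    interpret rank_one_step ?Q "deflate (insert i I) (z(i := y))" "X y" rate
    proof
      show "0 \<le> rate" by (simp add: rate_def)
      show "X y \<bullet> X y \<le> 1" using X_norm[of y] by (simp add: norm_eq_sqrt_inner)
      show "deflate (insert i I) (z(i := y)) v = deflate I z v - (rate * (X y \<bullet> v)) *\<^sub>R X y" for v
        using deflate_insert[OF I'(2) I(2), of "z(i := y)" v] deflate_eq by simp
    qed
    have "rate = 1 / (2 * real (2 * h + 2))" unfolding h by (simp add: rate_def)
    from tr_drop_quantitative[OF this deflate_form_lower[OF I'(1)], unfolded h]
    show ?thesis unfolding potential_eq_tr[OF I(1)] potential_eq_tr[OF I'(1)] by linarith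
  qed
  have mom_eq: "Q.mom (X y) (20 * n) = (\<Sum>b\<in>Basis. (X y \<bullet> (?Q ^^ (10 * n)) b)\<^sup>2)" for y
  proof -
    have "20 * n = 10 * n + 10 * n" by simp
    then have "Q.mom (X y) (20 * n) = (?Q ^^ (10 * n)) (X y) \<bullet> (?Q ^^ (10 * n)) (X y)"
      by (simp only: Q.mom_split)
    also have "\<dots> = (\<Sum>b\<in>Basis. ((?Q ^^ (10 * n)) (X y) \<bullet> b)\<^sup>2)"
      by (subst euclidean_inner) (simp add: power2_eq_square)
    finally show ?thesis by (simp add: Q.sym_pow)
  qed
  have int_mom: "integrable P (\<lambda>y. Q.mom (X y) (20 * n))"
    unfolding mom_eq by (intro Bochner_Integration.integrable_sum X_inner_integrable)
  have "\<kappa> * potential I z \<le> (\<Sum>b\<in>Basis. (\<integral>y. (X y \<bullet> (?Q ^^ (10 * n)) b)\<^sup>2 \<partial>P))"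
  proof -
    have "\<kappa> * potential I z = (\<Sum>b\<in>Basis. \<kappa> * ((?Q ^^ (10 * n)) b \<bullet> (?Q ^^ (10 * n)) b))"
      unfolding potential_def sum_distrib_left
    proof (intro sum.cong refl arg_cong[where f="\<lambda>s. \<kappa> * s"])
      fix b
      have "20 * n = 10 * n + 10 * n" by simp
      then show "b \<bullet> (?Q ^^ (20 * n)) b = (?Q ^^ (10 * n)) b \<bullet> (?Q ^^ (10 * n)) b"
        by (simp only: Q.mom_split[unfolded Q.mom_def])
    qed
    also have "\<dots> \<le> (\<Sum>b\<in>Basis. (\<integral>y. (X y \<bullet> (?Q ^^ (10 * n)) b)\<^sup>2 \<partial>P))"
      by (intro sum_mono second_moment)
    finally show ?thesis .
  qed
  also have "\<dots> = (\<integral>y. Q.mom (X y) (20 * n) \<partial>P)"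
    unfolding mom_eq by (intro Bochner_Integration.integral_sum[symmetric] X_inner_integrable)
  finally have low: "\<kappa> * potential I z \<le> (\<integral>y. Q.mom (X y) (20 * n) \<partial>P)" .
  have "(\<integral>y. potential (insert i I) (z(i := y)) \<partial>P) \<le> (\<integral>y. potential I z - 19/78 * Q.mom (X y) (20 * n) \<partial>P)"
  proof (cases "integrable P (\<lambda>y. potential (insert i I) (z(i := y)))")
    case True
    moreover have "integrable P (\<lambda>y. potential I z - 19/78 * Q.mom (X y) (20 * n))"
      by (intro Bochner_Integration.integrable_diff integrable_mult_right int_mom) simp
    ultimately show ?thesis by (rule integral_mono) (rule drop)
  next
    case False
    have "0 \<le> potential I z - 19/78 * Q.mom (X y) (20 * n)" for y
      using drop[of y] potential_bounds[OF I(1), of "z(i := y)"] by linarith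
    then show ?thesis using False by (simp add: not_integrable_integral_eq)
  qed
  also have "\<dots> = potential I z - 19/78 * (\<integral>y. Q.mom (X y) (20 * n) \<partial>P)"
    using int_mom by (simp add: prob_space)
  also have "\<dots> \<le> potential I z - 19/78 * (\<kappa> * potential I z)" using low by simp
  finally show ?thesis by (simp add: algebra_simps)
qed

lemma \<kappa>_le: "\<kappa> \<le> 1"
proof -
  obtain b :: 'a where b: "b \<in> Basis" using nonempty_Basis by blast
  have "\<kappa> \<le> (\<integral>z. (X z \<bullet> b)\<^sup>2 \<partial>P)" using second_moment[of b] b by simp
  also have "\<dots> \<le> (\<integral>z. 1 \<partial>P)" using X_inner_le[of _ b] b by (intro integral_mono X_inner_integrable) auto
  finally show ?thesis by (simp add: prob_space)
qed

lemma potential_expectation: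
  assumes "I \<subseteq> {1..n}"
  shows "(\<integral>z. potential I z \<partial>PiM I (\<lambda>_. P)) \<le> DIM('a) * (1 - 19/78 * \<kappa>) ^ card I"
proof -
  have "finite I" using assms finite_subset by auto
  then show ?thesis using assms
  proof (induction I)
    case empty
    have "potential {} z \<le> DIM('a)" for z using potential_bounds[of "{}" z] by simp
    then show ?case by (simp add: PiM_empty lebesgue_integral_count_space_finite)
  next
    case (insert i I)
    interpret S: product_sigma_finite "\<lambda>_. P" by standard
    have int: "integrable (PiM J (\<lambda>_. P)) (potential J)" if "J \<subseteq> {1..n}" for J
    proof -
      interpret J: prob_space "PiM J (\<lambda>_. P)" by (intro prob_space_PiM prob_space_axioms)
      show ?thesis using potential_bounds[OF that] potential_measurable
        by (intro J.integrable_const_bound[where B="DIM('a)"]) auto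
    qed
    have I: "I \<subseteq> {1..n}" using insert by auto
    have p: "0 \<le> 1 - 19/78 * \<kappa>" using \<kappa>_le by simp
    have "(\<integral>z. potential (insert i I) z \<partial>PiM (insert i I) (\<lambda>_. P)) =
        (\<integral>z. (\<integral>y. potential (insert i I) (z(i := y)) \<partial>P) \<partial>PiM I (\<lambda>_. P))"
      by (rule S.product_integral_insert[OF insert.hyps int[OF insert.prems]])
    also have "\<dots> \<le> (\<integral>z. (1 - 19/78 * \<kappa>) * potential I z \<partial>PiM I (\<lambda>_. P))"
    proof (rule integral_mono_AE')
      show "integrable (PiM I (\<lambda>_. P)) (\<lambda>z. (1 - 19/78 * \<kappa>) * potential I z)"
        using int[OF I] by simp
      show "AE z in PiM I (\<lambda>_. P). (\<integral>y. potential (insert i I) (z(i := y)) \<partial>P) \<le> (1 - 19/78 * \<kappa>) * potential I z"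
        using potential_step[OF insert.prems insert.hyps(2)] by simp
      show "AE z in PiM I (\<lambda>_. P). 0 \<le> (1 - 19/78 * \<kappa>) * potential I z"
        using potential_bounds[OF I] p by (intro AE_I2 mult_nonneg_nonneg) auto
    qed
    also have "\<dots> = (1 - 19/78 * \<kappa>) * (\<integral>z. potential I z \<partial>PiM I (\<lambda>_. P))" by simp
    also have "\<dots> \<le> (1 - 19/78 * \<kappa>) * (DIM('a) * (1 - 19/78 * \<kappa>) ^ card I)"
      using insert.IH[OF I] p by (intro mult_left_mono)
    finally show ?case using insert.hyps by (simp add: mult_ac)
  qed
qed

text \<open>The threshold is the value that the potential cannot fall below when some eigenvalue of the design
  matrix is smaller than \<open>\<kappa> n / 8\<close>.\<close>

definition good_design :: "(nat \<Rightarrow> 'z) set" where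
  "good_design = {z \<in> space (PiM {1..n} (\<lambda>_. P)). potential {1..n} z < (1 - \<kappa> / 320) ^ (20 * n)}"

lemma good_design_sets: "good_design \<in> sets (PiM {1..n} (\<lambda>_. P))"
  unfolding good_design_def using potential_measurable by measurable

text \<open>A unit vector with a small quadratic form keeps \<open>u \<bullet> Q u\<close> near 1, and by Jensen its high moment, hence
  the potential, stays large.\<close>

lemma good_design_lower:
  assumes "z \<in> good_design"
  shows "\<kappa> * real n / 8 * (v \<bullet> v) \<le> (\<Sum>i=1..n. (X (z i) \<bullet> v)\<^sup>2)"
proof (rule ccontr)
  assume neg: "\<not> ?thesis"
  then have v: "v \<noteq> 0" by auto
  interpret Q: contraction "deflate {1..n} z" by (rule contraction_deflate) simp
  define u where "u = v /\<^sub>R norm v"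
  have u: "u \<bullet> u = 1" using v by (simp add: u_def power2_norm_eq_inner[symmetric] power2_eq_square)
  have "(\<Sum>i=1..n. (X (z i) \<bullet> u)\<^sup>2) = (\<Sum>i=1..n. (X (z i) \<bullet> v)\<^sup>2) / (v \<bullet> v)"
    by (simp add: u_def power_divide sum_divide_distrib power2_norm_eq_inner divide_inverse power_mult_distrib power_inverse mult.commute sum_distrib_left)
  also have "\<dots> < \<kappa> * real n / 8"
    using neg v by (simp add: pos_divide_less_eq)
  finally have "rate * (\<Sum>i=1..n. (X (z i) \<bullet> u)\<^sup>2) \<le> rate * (\<kappa> * real n / 8)"
    by (intro mult_left_mono) (auto simp: rate_def)
  also have "\<dots> = \<kappa> / 320" using n by (simp add: rate_def)
  finally have "1 - \<kappa> / 320 \<le> u \<bullet> deflate {1..n} z u" by (simp add: deflate_form u)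
  then have "(1 - \<kappa> / 320) ^ (20 * n) \<le> (u \<bullet> deflate {1..n} z u) ^ (20 * n)"
    using \<kappa>_le by (intro power_mono) auto
  also have "\<dots> \<le> Q.mom u (20 * n)" by (rule Q.mom_Jensen[OF u])
  also have "\<dots> \<le> Q.tr (20 * n)" using Q.mom_le_tr[OF u, of "10 * n"] by simp
  finally show False using assms by (simp add: good_design_def potential_eq_tr)
qed

lemma exp_le_one_minus:
  fixes y :: real assumes "0 \<le> y" "y < 1" shows "exp (- (y / (1 - y))) \<le> 1 - y"
proof -
  have "inverse (1 - y) = 1 + y / (1 - y)" using assms by (simp add: field_simps)
  also have "\<dots> \<le> exp (y / (1 - y))" by (rule exp_ge_add_one_self)
  finally have "inverse (exp (y / (1 - y))) \<le> inverse (inverse (1 - y))"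
    using assms by (intro le_imp_inverse_le) auto
  then show ?thesis by (simp add: exp_minus)
qed

text \<open>Markov's inequality for the potential. The expectation decays with exponent \<open>19/78\<close>, the threshold with
  \<open>20/319\<close>, and \<open>19/78 - 20/319 > 1/8\<close>.\<close>

lemma good_design_prob:
  "1 - DIM('a) * exp (- \<kappa> * real n / 8) \<le> measure (PiM {1..n} (\<lambda>_. P)) good_design"
proof -
  interpret J: prob_space "PiM {1..n} (\<lambda>_. P)" by (intro prob_space_PiM prob_space_axioms)
  let ?c = "(1 - \<kappa> / 320) ^ (20 * n)" and ?M = "PiM {1..n} (\<lambda>_::nat. P)"
  have c: "exp (- (20 * real n * \<kappa> / 319)) \<le> ?c"
  proof -
    let ?y = "\<kappa> / 320"
    have y: "0 \<le> ?y" "?y \<le> 1/320" using \<kappa> \<kappa>_le by auto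
    then have e: "exp (- (?y / (1 - ?y))) \<le> 1 - ?y" by (intro exp_le_one_minus) auto
    have le: "?y / (1 - ?y) \<le> \<kappa> / 319"
    proof -
      have "?y / (1 - ?y) \<le> ?y / (319/320)" using y by (intro divide_left_mono) auto
      then show ?thesis by simp
    qed
    from le have "exp (- (\<kappa> / 319)) \<le> exp (- (?y / (1 - ?y)))" by (simp only: exp_le_cancel_iff neg_le_iff_le)
    also note e
    finally have "exp (- (\<kappa> / 319)) \<le> 1 - ?y" .
    then have "exp (- (\<kappa> / 319)) ^ (20 * n) \<le> ?c" by (intro power_mono) auto
    then show ?thesis by (simp add: exp_of_nat_mult[symmetric] mult_ac)
  qed
  have int: "integrable ?M (potential {1..n})"
    using potential_bounds[OF order.refl] potential_measurable
    by (intro J.integrable_const_bound[where B="DIM('a)"]) auto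
  have bad: "space ?M - good_design = {z \<in> space ?M. ?c \<le> potential {1..n} z}"
    by (auto simp: good_design_def)
  have c0: "0 < ?c" using \<kappa>_le by simp
  have meas: "{z \<in> space ?M. ?c \<le> potential {1..n} z} \<in> sets ?M" using potential_measurable by measurable
  have "?c * measure ?M {z \<in> space ?M. ?c \<le> potential {1..n} z} =
      (\<integral>z. ?c * indicator {z \<in> space ?M. ?c \<le> potential {1..n} z} z \<partial>?M)"
    using meas by simp
  also have "\<dots> \<le> (\<integral>z. potential {1..n} z \<partial>?M)"
    using potential_bounds[OF order.refl]
    by (intro integral_mono_AE'[OF int] AE_I2) (auto simp: indicator_def)
  also have "\<dots> \<le> DIM('a) * (1 - 19/78 * \<kappa>) ^ n" using potential_expectation[OF order.refl] by simp
  also have "\<dots> \<le> DIM('a) * exp (- (19/78 * \<kappa>)) ^ n"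
    using exp_ge_add_one_self[of "- (19/78 * \<kappa>)"] \<kappa>_le by (intro mult_left_mono power_mono) auto
  also have "\<dots> = DIM('a) * exp (- (19/78 * \<kappa> * real n))" by (simp add: exp_of_nat_mult[symmetric] mult_ac)
  also have "\<dots> \<le> DIM('a) * (exp (- \<kappa> * real n / 8) * exp (- (20 * real n * \<kappa> / 319)))"
  proof -
    have "- (19/78 * \<kappa> * real n) \<le> - \<kappa> * real n / 8 + - (20 * real n * \<kappa> / 319)"
      using mult_nonneg_nonneg[of \<kappa> "real n"] \<kappa> by simp
    then show ?thesis by (simp add: exp_add[symmetric])
  qed
  also have "\<dots> \<le> DIM('a) * (exp (- \<kappa> * real n / 8) * ?c)" using c by (intro mult_left_mono) auto
  finally have "?c * measure ?M {z \<in> space ?M. ?c \<le> potential {1..n} z} \<le> ?c * (DIM('a) * exp (- \<kappa> * real n / 8))"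
    by (simp add: mult_ac)
  then have "measure ?M (space ?M - good_design) \<le> DIM('a) * exp (- \<kappa> * real n / 8)"
    using c0 unfolding bad by (simp only: mult_le_cancel_left_pos)
  then show ?thesis using J.prob_compl[OF good_design_sets] by simp
qed

end


section \<open>Self-normalized sub-Gaussian noise\<close>

lemma nn_integral_gaussian_finite:
  fixes a :: real assumes a: "0 < a"
  shows "(\<integral>\<^sup>+ (w :: 'a::euclidean_space). ennreal (exp (- (a * (w \<bullet> w)))) \<partial>lborel) < \<infinity>"
proof -
  define s where "s = 1 / sqrt (2 * a)"
  have s: "0 < s" "1 / (2 * s\<^sup>2) = a" using a by (auto simp: s_def power_divide)
  have "exp (- (a * x\<^sup>2)) = sqrt (2 * pi * s\<^sup>2) * normal_density 0 s x" for x :: real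
    using s by (simp add: normal_density_def field_simps)
  then have "(\<integral>\<^sup>+ x. ennreal (exp (- (a * x\<^sup>2))) \<partial>lborel) =
      (\<integral>\<^sup>+ x. ennreal (sqrt (2 * pi * s\<^sup>2)) * ennreal (normal_density 0 s x) \<partial>lborel)"
    by (simp add: ennreal_mult)
  also have "\<dots> = ennreal (sqrt (2 * pi * s\<^sup>2)) * (\<integral>\<^sup>+ x. ennreal (normal_density 0 s x) \<partial>lborel)"
    by (rule nn_integral_cmult) simp
  also have "(\<integral>\<^sup>+ x. ennreal (normal_density 0 s x) \<partial>lborel) = 1"
    using prob_space.emeasure_space_1[OF prob_space_normal_density[OF s(1), of 0]]
    by (simp add: emeasure_density)
  finally have one: "(\<integral>\<^sup>+ x. ennreal (exp (- (a * x\<^sup>2))) \<partial>lborel) < \<infinity>" by simp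
  have "ennreal (exp (- (a * (w \<bullet> w)))) = (\<Prod>b\<in>Basis. ennreal (exp (- (a * (w \<bullet> b)\<^sup>2))))" for w :: 'a
  proof -
    have "- (a * (w \<bullet> w)) = (\<Sum>b\<in>Basis. - (a * (w \<bullet> b)\<^sup>2))"
      by (subst euclidean_inner) (simp add: sum_distrib_left sum_negf power2_eq_square)
    then show ?thesis by (simp add: exp_sum prod_ennreal)
  qed
  then have "(\<integral>\<^sup>+ (w :: 'a). ennreal (exp (- (a * (w \<bullet> w)))) \<partial>lborel) =
      (\<Prod>b\<in>(Basis :: 'a set). (\<integral>\<^sup>+ x. ennreal (exp (- (a * x\<^sup>2))) \<partial>lborel))"
    by (simp add: nn_integral_lborel_prod[where f="\<lambda>_ x. ennreal (exp (- (a * x\<^sup>2)))"])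
  also have "\<dots> < \<infinity>" using one by (simp add: power_less_top_ennreal)
  finally show ?thesis .
qed

lemma nn_integral_lborel_shift:
  fixes f :: "'a::euclidean_space \<Rightarrow> ennreal" assumes [measurable]: "f \<in> borel_measurable borel"
  shows "(\<integral>\<^sup>+ w. f (c + w) \<partial>lborel) = (\<integral>\<^sup>+ w. f w \<partial>lborel)"
proof -
  have "(\<integral>\<^sup>+ w. f w \<partial>distr lborel borel ((+) c)) = (\<integral>\<^sup>+ w. f (c + w) \<partial>lborel)"
    by (rule nn_integral_distr) measurable
  then show ?thesis by (simp add: lborel_distr_plus)
qed

lemma nn_integral_lborel_scale:
  fixes f :: "'a::euclidean_space \<Rightarrow> ennreal" and c :: real
  assumes [measurable]: "f \<in> borel_measurable borel" and c: "0 < c"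
  shows "(\<integral>\<^sup>+ w. f w \<partial>lborel) = ennreal (c ^ DIM('a)) * (\<integral>\<^sup>+ w. f (c *\<^sub>R w) \<partial>lborel)"
proof -
  have "(\<integral>\<^sup>+ w. f w \<partial>lborel) = (\<integral>\<^sup>+ w. f w \<partial>density (distr lborel borel (\<lambda>x. 0 + c *\<^sub>R x)) (\<lambda>_. \<bar>c\<bar> ^ DIM('a)))"
    using lborel_affine[of c "0 :: 'a"] c by simp
  also have "\<dots> = (\<integral>\<^sup>+ w. ennreal (c ^ DIM('a)) * f w \<partial>distr lborel borel (\<lambda>x. 0 + c *\<^sub>R x))"
    using c by (subst nn_integral_density) auto
  also have "\<dots> = (\<integral>\<^sup>+ w. ennreal (c ^ DIM('a)) * f (c *\<^sub>R w) \<partial>lborel)"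
    by (subst nn_integral_distr) auto
  finally show ?thesis by (simp add: nn_integral_cmult)
qed

locale subgaussian_noise = prob_space P for P :: "'z measure" +
  fixes X :: "'z \<Rightarrow> 'a::euclidean_space" and e :: "'z \<Rightarrow> real" and \<sigma> :: real
  assumes X_meas [measurable]: "X \<in> borel_measurable P" and e_meas [measurable]: "e \<in> borel_measurable P"
    and sub: "\<And>l B. B \<in> sets borel \<Longrightarrow>
      (\<integral>\<^sup>+ z. indicator B (X z) * ennreal (exp (l * e z)) \<partial>P)
        \<le> ennreal (exp (l\<^sup>2 * \<sigma>\<^sup>2 / 2)) * (\<integral>\<^sup>+ z. indicator B (X z) \<partial>P)"
begin

text \<open>From events to nonnegative functions of the design, by comparing two image measures.\<close>

lemma sub_function:
  assumes [measurable]: "f \<in> borel_measurable borel"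
  shows "(\<integral>\<^sup>+ z. f (X z) * ennreal (exp (l * e z - l\<^sup>2 * \<sigma>\<^sup>2 / 2)) \<partial>P) \<le> (\<integral>\<^sup>+ z. f (X z) \<partial>P)"
proof -
  let ?K = "ennreal (exp (l\<^sup>2 * \<sigma>\<^sup>2 / 2))"
  let ?M = "distr (density P (\<lambda>z. ennreal (exp (l * e z)))) borel X"
  let ?N = "scale_measure ?K (distr P borel X)"
  have "?M \<le> ?N"
  proof (subst le_measure)
    show "\<forall>B\<in>sets ?M. emeasure ?M B \<le> emeasure ?N B"
    proof
      fix B assume "B \<in> sets ?M"
      then have [measurable]: "B \<in> sets borel" by simp
      have *: "emeasure M (X -` B \<inter> space M) = (\<integral>\<^sup>+ z. indicator B (X z) \<partial>M)" if "X \<in> measurable M borel" for M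
      proof -
        have "(\<integral>\<^sup>+ z. indicator B (X z) \<partial>M) = (\<integral>\<^sup>+ z. indicator (X -` B \<inter> space M) z \<partial>M)"
          by (intro nn_integral_cong) (simp add: indicator_def)
        also have "\<dots> = emeasure M (X -` B \<inter> space M)"
          using measurable_sets[OF that] by (intro nn_integral_indicator) simp
        finally show ?thesis by simp
      qed
      have "emeasure ?M B = (\<integral>\<^sup>+ z. indicator B (X z) * ennreal (exp (l * e z)) \<partial>P)"
      proof -
        have "emeasure ?M B = emeasure (density P (\<lambda>z. ennreal (exp (l * e z)))) (X -` B \<inter> space (density P (\<lambda>z. ennreal (exp (l * e z)))))"
          by (rule emeasure_distr) auto
        also have "\<dots> = (\<integral>\<^sup>+ z. indicator B (X z) \<partial>density P (\<lambda>z. ennreal (exp (l * e z))))" by (rule *) simp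
        also have "\<dots> = (\<integral>\<^sup>+ z. indicator B (X z) * ennreal (exp (l * e z)) \<partial>P)"
          by (subst nn_integral_density) (auto simp: mult.commute)
        finally show ?thesis .
      qed
      also have "\<dots> \<le> ?K * (\<integral>\<^sup>+ z. indicator B (X z) \<partial>P)" by (rule sub) simp
      also have "\<dots> = emeasure ?N B" by (simp add: emeasure_distr *)
      finally show "emeasure ?M B \<le> emeasure ?N B" .
    qed
  qed simp
  then have "(\<integral>\<^sup>+ x. f x \<partial>?M) \<le> (\<integral>\<^sup>+ x. f x \<partial>?N)" by (intro nn_integral_mono_measure) auto
  then have *: "(\<integral>\<^sup>+ z. f (X z) * ennreal (exp (l * e z)) \<partial>P) \<le> ?K * (\<integral>\<^sup>+ z. f (X z) \<partial>P)"
    by (simp add: nn_integral_distr nn_integral_density nn_integral_scale_measure mult.commute)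
  let ?L = "ennreal (exp (- (l\<^sup>2 * \<sigma>\<^sup>2 / 2)))"
  have "(\<integral>\<^sup>+ z. f (X z) * ennreal (exp (l * e z - l\<^sup>2 * \<sigma>\<^sup>2 / 2)) \<partial>P) =
      (\<integral>\<^sup>+ z. ?L * (f (X z) * ennreal (exp (l * e z))) \<partial>P)"
    by (intro nn_integral_cong) (simp add: diff_conv_add_uminus exp_add ennreal_mult mult_ac del: add_uminus_conv_diff)
  also have "\<dots> = ?L * (\<integral>\<^sup>+ z. f (X z) * ennreal (exp (l * e z)) \<partial>P)"
    by (rule nn_integral_cmult) measurable
  also have "\<dots> \<le> ?L * (?K * (\<integral>\<^sup>+ z. f (X z) \<partial>P))" by (intro mult_left_mono *) auto
  also have "\<dots> = (?L * ?K) * (\<integral>\<^sup>+ z. f (X z) \<partial>P)" by (simp add: mult.assoc)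
  also have "?L * ?K = 1" by (simp add: ennreal_mult[symmetric] exp_add[symmetric])
  finally show ?thesis by simp
qed

lemma sub_countable:
  assumes [measurable]: "f \<in> borel_measurable borel" "j \<in> measurable borel (count_space (UNIV :: nat set))"
  shows "(\<integral>\<^sup>+ z. f (X z) * ennreal (exp (u (j (X z)) * e z - (u (j (X z)))\<^sup>2 * \<sigma>\<^sup>2 / 2)) \<partial>P) \<le> (\<integral>\<^sup>+ z. f (X z) \<partial>P)"
proof -
  let ?A = "\<lambda>k. {x. j x = k}"
  have A [measurable]: "?A k \<in> sets borel" for k by measurable
  have dis: "disjoint_family ?A" by (auto simp: disjoint_family_on_def)
  have split: "g (j x) = (\<Sum>k. g k * indicator (?A k) x)" for g :: "nat \<Rightarrow> ennreal" and x
    by (rule suminf_cmult_indicator[OF dis, symmetric]) simp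
  have "(\<integral>\<^sup>+ z. f (X z) * ennreal (exp (u (j (X z)) * e z - (u (j (X z)))\<^sup>2 * \<sigma>\<^sup>2 / 2)) \<partial>P) =
     (\<integral>\<^sup>+ z. (\<Sum>k. (f (X z) * indicator (?A k) (X z)) * ennreal (exp (u k * e z - (u k)\<^sup>2 * \<sigma>\<^sup>2 / 2))) \<partial>P)"
    by (intro nn_integral_cong, subst split[of "\<lambda>k. f _ * ennreal (exp (u k * e _ - (u k)\<^sup>2 * \<sigma>\<^sup>2 / 2))"])
       (simp add: mult_ac)
  also have "\<dots> = (\<Sum>k. \<integral>\<^sup>+ z. (f (X z) * indicator (?A k) (X z)) * ennreal (exp (u k * e z - (u k)\<^sup>2 * \<sigma>\<^sup>2 / 2)) \<partial>P)"
    by (rule nn_integral_suminf) measurable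
  also have "\<dots> \<le> (\<Sum>k. \<integral>\<^sup>+ z. f (X z) * indicator (?A k) (X z) \<partial>P)"
    by (intro suminf_le sub_function[of "\<lambda>x. f x * indicator (?A _) x"]) auto
  also have "\<dots> = (\<integral>\<^sup>+ z. (\<Sum>k. f (X z) * indicator (?A k) (X z)) \<partial>P)"
    by (rule nn_integral_suminf[symmetric]) measurable
  also have "\<dots> = (\<integral>\<^sup>+ z. f (X z) \<partial>P)"
    by (intro nn_integral_cong) (rule split[of "\<lambda>_. f _", symmetric])
  finally show ?thesis .
qed

text \<open>A multiplier that depends on the design is a limit of countably valued ones.\<close>

lemma sub_predictable:
  assumes [measurable]: "f \<in> borel_measurable borel" "l \<in> borel_measurable borel" and f: "\<And>x. 0 \<le> f x"
  shows "(\<integral>\<^sup>+ z. ennreal (f (X z) * exp (l (X z) * e z - (l (X z))\<^sup>2 * \<sigma>\<^sup>2 / 2)) \<partial>P) \<le> (\<integral>\<^sup>+ z. ennreal (f (X z)) \<partial>P)"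
proof -
  define lm where "lm = (\<lambda>m x. real_of_int \<lfloor>real (Suc m) * l x\<rfloor> / real (Suc m))"
  have lim: "(\<lambda>m. lm m x) \<longlonglongrightarrow> l x" for x
  proof (rule tendsto_sandwich[where f="\<lambda>m. l x - 1 / real (Suc m)" and h="\<lambda>_. l x"])
    have "l x - 1 / real (Suc m) \<le> lm m x \<and> lm m x \<le> l x" for m
    proof -
      have "real (Suc m) * l x - 1 \<le> real_of_int \<lfloor>real (Suc m) * l x\<rfloor>" "real_of_int \<lfloor>real (Suc m) * l x\<rfloor> \<le> real (Suc m) * l x"
        by linarith+
      then have "(real (Suc m) * l x - 1) / real (Suc m) \<le> lm m x" "lm m x \<le> (real (Suc m) * l x) / real (Suc m)"
        unfolding lm_def by (intro divide_right_mono; simp)+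
      then show ?thesis by (simp add: diff_divide_distrib)
    qed
    then show "\<forall>\<^sub>F m in sequentially. l x - 1 / real (Suc m) \<le> lm m x" "\<forall>\<^sub>F m in sequentially. lm m x \<le> l x" by auto
    have "(\<lambda>m. l x - 1 / real (Suc m)) \<longlonglongrightarrow> l x - 0" by (intro tendsto_diff tendsto_const LIMSEQ_Suc[OF lim_1_over_n])
    then show "(\<lambda>m. l x - 1 / real (Suc m)) \<longlonglongrightarrow> l x" by simp
  qed simp
  let ?g = "\<lambda>m z. ennreal (f (X z) * exp (lm m (X z) * e z - (lm m (X z))\<^sup>2 * \<sigma>\<^sup>2 / 2))"
  have [measurable]: "lm m \<in> borel_measurable borel" for m unfolding lm_def by measurable
  have le: "(\<integral>\<^sup>+ z. ?g m z \<partial>P) \<le> (\<integral>\<^sup>+ z. ennreal (f (X z)) \<partial>P)" for m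
  proof -
    let ?j = "\<lambda>x. to_nat \<lfloor>real (Suc m) * l x\<rfloor>"
    let ?u = "\<lambda>k. real_of_int (from_nat k) / real (Suc m)"
    have [measurable]: "?j \<in> measurable borel (count_space UNIV)" by measurable
    have "?u (?j x) = lm m x" for x by (simp add: lm_def)
    then show ?thesis
      using sub_countable[of "\<lambda>x. ennreal (f x)" ?j ?u] f by (simp add: ennreal_mult del: of_nat_Suc)
  qed
  have "(\<integral>\<^sup>+ z. ennreal (f (X z) * exp (l (X z) * e z - (l (X z))\<^sup>2 * \<sigma>\<^sup>2 / 2)) \<partial>P) = (\<integral>\<^sup>+ z. liminf (\<lambda>m. ?g m z) \<partial>P)"
  proof (intro nn_integral_cong lim_imp_Liminf[symmetric])
    fix z
    show "(\<lambda>m. ?g m z) \<longlonglongrightarrow> ennreal (f (X z) * exp (l (X z) * e z - (l (X z))\<^sup>2 * \<sigma>\<^sup>2 / 2))"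
      by (intro tendsto_ennrealI tendsto_intros lim) auto
  qed simp
  also have "\<dots> \<le> liminf (\<lambda>m. \<integral>\<^sup>+ z. ?g m z \<partial>P)" by (intro nn_integral_liminf) measurable
  also have "\<dots> \<le> liminf (\<lambda>m. \<integral>\<^sup>+ z. ennreal (f (X z)) \<partial>P)" using le by (intro Liminf_mono) auto
  also have "\<dots> = (\<integral>\<^sup>+ z. ennreal (f (X z)) \<partial>P)" by (simp add: Liminf_const)
  finally show ?thesis .
qed

definition design :: "nat set \<Rightarrow> (nat \<Rightarrow> 'z) \<Rightarrow> (nat \<Rightarrow> 'a)" where
  "design I z = (\<lambda>i\<in>I. X (z i))"

lemma design_measurable [measurable]: "design I \<in> measurable (PiM I (\<lambda>_. P)) (PiM I (\<lambda>_. borel))"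
  unfolding design_def by measurable

definition tilt :: "'a \<Rightarrow> 'z \<Rightarrow> real" where
  "tilt w z = exp ((X z \<bullet> w) * e z - (X z \<bullet> w)\<^sup>2 * \<sigma>\<^sup>2 / 2)"

lemma tilt_measurable [measurable]: "tilt w \<in> borel_measurable P"
  unfolding tilt_def by measurable

text \<open>Integrating out one observation at a time: with the others fixed, the remaining factor is a function
  of the covariate alone, to which the conditional bound applies.\<close>

lemma tilt_product_le:
  assumes J: "J \<subseteq> I" and I: "finite I" and [measurable]: "G \<in> borel_measurable (PiM I (\<lambda>_. borel))" and G: "\<And>x. 0 \<le> G x"
  shows "(\<integral>\<^sup>+ z. ennreal (G (design I z) * (\<Prod>i\<in>J. tilt w (z i))) \<partial>PiM I (\<lambda>_. P))
     \<le> (\<integral>\<^sup>+ z. ennreal (G (design I z)) \<partial>PiM I (\<lambda>_. P))"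
proof -
  have "finite J" using J I finite_subset by auto
  then show ?thesis using J
  proof (induction J)
    case (insert i J)
    interpret S: product_sigma_finite "\<lambda>_. P" by standard
    let ?I = "I - {i}"
    have iI: "insert i ?I = I" "i \<notin> ?I" "finite ?I" using insert I by auto
    have JI: "J \<subseteq> ?I" "J \<subseteq> I" using insert by auto
    have m1: "(\<lambda>z. ennreal (G (design I z) * (\<Prod>k\<in>insert i J. tilt w (z k)))) \<in> borel_measurable (PiM (insert i ?I) (\<lambda>_. P))"
      unfolding iI by measurable (use insert.prems in auto)
    have m2: "(\<lambda>z. ennreal (G (design I z) * (\<Prod>k\<in>J. tilt w (z k)))) \<in> borel_measurable (PiM (insert i ?I) (\<lambda>_. P))"
      unfolding iI by measurable (use JI in auto)
    have upd: "design I (z(i := y)) = (design ?I z)(i := X y)" for z y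
      using iI by (auto simp: design_def fun_eq_iff)
    have pr: "(\<Prod>k\<in>J. tilt w ((z(i := y)) k)) = (\<Prod>k\<in>J. tilt w (z k))" for z y
      using insert.hyps by (intro prod.cong) auto
    have "(\<integral>\<^sup>+ z. ennreal (G (design I z) * (\<Prod>k\<in>insert i J. tilt w (z k))) \<partial>PiM I (\<lambda>_. P)) =
       (\<integral>\<^sup>+ z. (\<integral>\<^sup>+ y. ennreal (G (design I (z(i := y))) * (\<Prod>k\<in>insert i J. tilt w ((z(i := y)) k))) \<partial>P) \<partial>PiM ?I (\<lambda>_. P))"
      using S.product_nn_integral_insert[OF iI(3,2) m1] unfolding iI .
    also have "\<dots> \<le> (\<integral>\<^sup>+ z. (\<integral>\<^sup>+ y. ennreal (G (design I (z(i := y))) * (\<Prod>k\<in>J. tilt w ((z(i := y)) k))) \<partial>P) \<partial>PiM ?I (\<lambda>_. P))"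
    proof (rule nn_integral_mono)
      fix z assume z: "z \<in> space (PiM ?I (\<lambda>_. P))"
      let ?f = "\<lambda>x. G ((design ?I z)(i := x)) * (\<Prod>k\<in>J. tilt w (z k))"
      have dz: "design ?I z \<in> space (PiM ?I (\<lambda>_. borel))" by (auto simp: design_def space_PiM)
      have "(\<lambda>x. (design ?I z)(i := x)) \<in> measurable borel (PiM (insert i ?I) (\<lambda>_. borel))"
        by (rule measurable_component_update[OF dz iI(2)])
      then have [measurable]: "(\<lambda>x. (design ?I z)(i := x)) \<in> measurable borel (PiM I (\<lambda>_. borel))" unfolding iI .
      have fm: "?f \<in> borel_measurable borel" by measurable
      have "(\<integral>\<^sup>+ y. ennreal (?f (X y) * exp ((X y \<bullet> w) * e y - (X y \<bullet> w)\<^sup>2 * \<sigma>\<^sup>2 / 2)) \<partial>P) \<le> (\<integral>\<^sup>+ y. ennreal (?f (X y)) \<partial>P)"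
        using G by (intro sub_predictable[OF fm]) (auto intro!: mult_nonneg_nonneg prod_nonneg simp: tilt_def)
      moreover have "G (design I (z(i := y))) * (\<Prod>k\<in>insert i J. tilt w ((z(i := y)) k)) =
          ?f (X y) * exp ((X y \<bullet> w) * e y - (X y \<bullet> w)\<^sup>2 * \<sigma>\<^sup>2 / 2)" for y
        using insert.hyps pr[of z y] by (simp add: upd tilt_def[of w y] mult_ac)
      moreover have "G (design I (z(i := y))) * (\<Prod>k\<in>J. tilt w ((z(i := y)) k)) = ?f (X y)" for y
        using pr[of z y] by (simp add: upd)
      ultimately show "(\<integral>\<^sup>+ y. ennreal (G (design I (z(i := y))) * (\<Prod>k\<in>insert i J. tilt w ((z(i := y)) k))) \<partial>P)
          \<le> (\<integral>\<^sup>+ y. ennreal (G (design I (z(i := y))) * (\<Prod>k\<in>J. tilt w ((z(i := y)) k))) \<partial>P)"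
        by (simp only:)
    qed
    also have "\<dots> = (\<integral>\<^sup>+ z. ennreal (G (design I z) * (\<Prod>k\<in>J. tilt w (z k))) \<partial>PiM I (\<lambda>_. P))"
      using S.product_nn_integral_insert[OF iI(3,2) m2] unfolding iI by simp
    also have "\<dots> \<le> (\<integral>\<^sup>+ z. ennreal (G (design I z)) \<partial>PiM I (\<lambda>_. P))" using insert.IH JI by simp
    finally show ?case .
  qed simp
qed


text \<open>The mixture runs over all directions \<open>w\<close> with the Gaussian density proportional to
  \<open>exp (- \<sigma>\<^sup>2 V(w) / 2)\<close>, where \<open>V\<close> is the squared design form; its covariance adapts to the design,
  so no dimension-dependent price for the conditioning of the design is paid.\<close>

definition form :: "nat \<Rightarrow> (nat \<Rightarrow> 'a) \<Rightarrow> 'a \<Rightarrow> real" where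
  "form n x w = (\<Sum>i=1..n. (x i \<bullet> w)\<^sup>2)"

definition norming :: "nat \<Rightarrow> (nat \<Rightarrow> 'a) \<Rightarrow> ennreal" where
  "norming n x = (\<integral>\<^sup>+ w. ennreal (exp (- (\<sigma>\<^sup>2 * form n x w / 2))) \<partial>lborel)"

definition dens :: "nat \<Rightarrow> 'a \<Rightarrow> (nat \<Rightarrow> 'a) \<Rightarrow> real" where
  "dens n w x = exp (- (\<sigma>\<^sup>2 * form n x w / 2)) / enn2real (norming n x)"

definition mixture :: "nat \<Rightarrow> (nat \<Rightarrow> 'z) \<Rightarrow> ennreal" where
  "mixture n z = (\<integral>\<^sup>+ w. ennreal (dens n w (design {1..n} z) * (\<Prod>i=1..n. tilt w (z i))) \<partial>lborel)"

lemma form_measurable: "(\<lambda>(x, w). form n x w) \<in> borel_measurable (PiM {1..n} (\<lambda>_. borel) \<Otimes>\<^sub>M lborel)"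
  unfolding form_def by measurable

lemma norming_measurable [measurable]: "norming n \<in> borel_measurable (PiM {1..n} (\<lambda>_. borel))"
proof -
  have [measurable]: "(\<lambda>(x, w). form n x w) \<in> borel_measurable (PiM {1..n} (\<lambda>_. borel) \<Otimes>\<^sub>M lborel)"
    by (rule form_measurable)
  have "(\<lambda>(x, w). ennreal (exp (- (\<sigma>\<^sup>2 * form n x w / 2)))) \<in> borel_measurable (PiM {1..n} (\<lambda>_. borel) \<Otimes>\<^sub>M lborel)"
    by measurable
  then have "(\<lambda>x. \<integral>\<^sup>+ w. (\<lambda>(x, w). ennreal (exp (- (\<sigma>\<^sup>2 * form n x w / 2)))) (x, w) \<partial>lborel) \<in> borel_measurable (PiM {1..n} (\<lambda>_. borel))"
    by (rule sigma_finite_measure.borel_measurable_nn_integral_fst[OF lborel.sigma_finite_measure_axioms])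
  then show ?thesis by (simp add: norming_def[abs_def])
qed

lemma dens_measurable_pair: "(\<lambda>(x, w). dens n w x) \<in> borel_measurable (PiM {1..n} (\<lambda>_. borel) \<Otimes>\<^sub>M lborel)"
proof -
  have [measurable]: "(\<lambda>(x, w). form n x w) \<in> borel_measurable (PiM {1..n} (\<lambda>_. borel) \<Otimes>\<^sub>M lborel)"
    by (rule form_measurable)
  show ?thesis unfolding dens_def by measurable
qed

lemma dens_measurable [measurable]: "dens n w \<in> borel_measurable (PiM {1..n} (\<lambda>_. borel))"
  using measurable_Pair1'[of w lborel "PiM {1..n} (\<lambda>_. borel)"] measurable_compose[OF _ dens_measurable_pair, of "\<lambda>x. (x, w)"]
  by simp

lemma mixture_integrand_measurable:
  "(\<lambda>(z, w). ennreal (dens n w (design {1..n} z) * (\<Prod>i=1..n. tilt w (z i)))) \<in> borel_measurable (PiM {1..n} (\<lambda>_. P) \<Otimes>\<^sub>M lborel)"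
proof -
  have [measurable]: "(\<lambda>(z, w). dens n w (design {1..n} z)) \<in> borel_measurable (PiM {1..n} (\<lambda>_. P) \<Otimes>\<^sub>M lborel)"
    using measurable_compose[OF _ dens_measurable_pair, of "\<lambda>(z, w). (design {1..n} z, w)" "PiM {1..n} (\<lambda>_. P) \<Otimes>\<^sub>M lborel" n]
    by (simp add: case_prod_unfold)
  show ?thesis unfolding tilt_def by measurable
qed

lemma mixture_measurable: "mixture n \<in> borel_measurable (PiM {1..n} (\<lambda>_. P))"
proof -
  have "(\<lambda>z. \<integral>\<^sup>+ w. (\<lambda>(z, w). ennreal (dens n w (design {1..n} z) * (\<Prod>i=1..n. tilt w (z i)))) (z, w) \<partial>lborel)
     \<in> borel_measurable (PiM {1..n} (\<lambda>_. P))"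
    by (rule sigma_finite_measure.borel_measurable_nn_integral_fst[OF lborel.sigma_finite_measure_axioms mixture_integrand_measurable])
  then show ?thesis by (simp add: mixture_def[abs_def])
qed

lemma dens_nonneg: "0 \<le> dens n w x" by (simp add: dens_def)

lemma norming_pos: "norming n x \<noteq> 0"
proof
  have [measurable]: "form n x \<in> borel_measurable borel" unfolding form_def[abs_def] by measurable
  assume "norming n x = 0"
  then have "AE w in (lborel :: 'a measure). ennreal (exp (- (\<sigma>\<^sup>2 * form n x w / 2))) = 0"
    unfolding norming_def by (subst (asm) nn_integral_0_iff_AE) measurable
  then have "AE w in (lborel :: 'a measure). False" by (auto simp: ennreal_eq_0_iff not_le)
  then show False by (simp add: AE_iff_null null_sets_def)
qed

text \<open>If the normalizing integral is infinite, its real value is 0 and so is the quotient.\<close>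

lemma dens_integral_le: "(\<integral>\<^sup>+ w. ennreal (dens n w x) \<partial>lborel) \<le> 1"
proof (cases "norming n x = \<infinity>")
  case False
  have [measurable]: "form n x \<in> borel_measurable borel" unfolding form_def[abs_def] by measurable
  let ?N = "enn2real (norming n x)"
  have N: "0 < ?N" "ennreal ?N = norming n x" using False norming_pos[of n x]
    by (auto simp: enn2real_positive_iff top.not_eq_extremum zero_less_iff_neq_zero)
  have "(\<integral>\<^sup>+ w. ennreal (dens n w x) \<partial>lborel) = (\<integral>\<^sup>+ w. ennreal (1 / ?N) * ennreal (exp (- (\<sigma>\<^sup>2 * form n x w / 2))) \<partial>lborel)"
    by (intro nn_integral_cong) (simp add: dens_def ennreal_mult[symmetric])
  also have "\<dots> = ennreal (1 / ?N) * norming n x"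
    unfolding norming_def by (rule nn_integral_cmult) measurable
  also have "\<dots> = ennreal (1 / ?N) * ennreal ?N" by (simp only: N(2))
  also have "\<dots> = ennreal (1 / ?N * ?N)" using N(1) by (intro ennreal_mult[symmetric]) auto
  finally show ?thesis using N(1) by simp
qed (simp add: dens_def)

text \<open>For each fixed direction the tilted product has conditional mean at most 1 given the design, and the
  density depends on the design only.\<close>

lemma mixture_expectation: "(\<integral>\<^sup>+ z. mixture n z \<partial>PiM {1..n} (\<lambda>_. P)) \<le> 1"
proof -
  let ?M = "PiM {1..n} (\<lambda>_::nat. P)"
  interpret M: prob_space ?M by (intro prob_space_PiM prob_space_axioms)
  interpret L: pair_sigma_finite ?M "lborel :: 'a measure" by standard
  have "(\<integral>\<^sup>+ z. mixture n z \<partial>?M) = (\<integral>\<^sup>+ w. \<integral>\<^sup>+ z. ennreal (dens n w (design {1..n} z) * (\<Prod>i=1..n. tilt w (z i))) \<partial>?M \<partial>lborel)"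
    unfolding mixture_def using L.Fubini[OF mixture_integrand_measurable[of n]] by simp
  also have "\<dots> \<le> (\<integral>\<^sup>+ w. \<integral>\<^sup>+ z. ennreal (dens n w (design {1..n} z)) \<partial>?M \<partial>lborel)"
  proof (rule nn_integral_mono)
    fix w :: 'a
    show "(\<integral>\<^sup>+ z. ennreal (dens n w (design {1..n} z) * (\<Prod>i=1..n. tilt w (z i))) \<partial>?M)
        \<le> (\<integral>\<^sup>+ z. ennreal (dens n w (design {1..n} z)) \<partial>?M)"
      by (rule tilt_product_le[OF _ _ dens_measurable dens_nonneg]) auto
  qed
  also have "\<dots> = (\<integral>\<^sup>+ z. \<integral>\<^sup>+ w. ennreal (dens n w (design {1..n} z)) \<partial>lborel \<partial>?M)"
  proof -
    have "(\<lambda>(z, w). dens n w (design {1..n} z)) \<in> borel_measurable (?M \<Otimes>\<^sub>M lborel)"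
      using measurable_compose[OF _ dens_measurable_pair, of "\<lambda>(z, w). (design {1..n} z, w)" "?M \<Otimes>\<^sub>M lborel" n]
      by (simp add: case_prod_unfold)
    then have "(\<lambda>(z, w). ennreal (dens n w (design {1..n} z))) \<in> borel_measurable (?M \<Otimes>\<^sub>M lborel)" by measurable
    from L.Fubini[OF this] show ?thesis by simp
  qed
  also have "\<dots> \<le> (\<integral>\<^sup>+ z. 1 \<partial>?M)" by (intro nn_integral_mono dens_integral_le)
  also have "\<dots> = 1" using M.emeasure_space_1 by simp
  finally show ?thesis .
qed

definition good_noise :: "nat \<Rightarrow> real \<Rightarrow> (nat \<Rightarrow> 'z) set" where
  "good_noise n K = {z \<in> space (PiM {1..n} (\<lambda>_. P)). mixture n z < ennreal K}"

lemma good_noise_sets: "good_noise n K \<in> sets (PiM {1..n} (\<lambda>_. P))"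
  unfolding good_noise_def using mixture_measurable[of n] by measurable

lemma good_noise_prob:
  assumes K: "0 < K" shows "1 - 1 / K \<le> measure (PiM {1..n} (\<lambda>_. P)) (good_noise n K)"
proof -
  let ?M = "PiM {1..n} (\<lambda>_::nat. P)"
  interpret M: prob_space ?M by (intro prob_space_PiM prob_space_axioms)
  have [measurable]: "mixture n \<in> borel_measurable ?M" by (rule mixture_measurable)
  have bad: "space ?M - good_noise n K = {z \<in> space ?M. ennreal K \<le> mixture n z}"
    by (auto simp: good_noise_def not_less)
  let ?B = "{z \<in> space ?M. ennreal K \<le> mixture n z}"
  have "ennreal K * emeasure ?M ?B = (\<integral>\<^sup>+ z. ennreal K * indicator ?B z \<partial>?M)"
    by (rule nn_integral_cmult_indicator[symmetric]) measurable
  also have "\<dots> \<le> (\<integral>\<^sup>+ z. mixture n z \<partial>?M)" by (intro nn_integral_mono) (auto simp: indicator_def)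
  also have "\<dots> \<le> 1" by (rule mixture_expectation)
  finally have "ennreal K * ennreal (measure ?M ?B) \<le> 1" unfolding M.emeasure_eq_measure .
  then have "ennreal (K * measure ?M ?B) \<le> ennreal 1"
    using K by (simp add: ennreal_mult)
  then have "K * measure ?M ?B \<le> 1" by simp
  then have "measure ?M ?B \<le> 1 / K" using K by (simp add: field_simps)
  then show ?thesis using M.prob_compl[OF good_noise_sets[of n K]] bad by simp
qed

text \<open>Completing the square around \<open>\<theta> / (2 \<sigma>\<^sup>2)\<close> pulls \<open>exp (V(\<theta>) / (4 \<sigma>\<^sup>2))\<close> out of the mixture. What
  remains is the Gaussian integral with exponent \<open>\<sigma>\<^sup>2 V\<close> over the one with \<open>\<sigma>\<^sup>2 V / 2\<close>, which is
  \<open>2\<^bsup>-p/2\<^esup>\<close> by scaling, so no determinant has to be computed.\<close>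

lemma good_noise_bound:
  assumes z: "z \<in> good_noise n K" and K: "0 < K" and \<sigma>: "0 < \<sigma>" and a: "0 < a"
    and low: "\<And>v. a * (v \<bullet> v) \<le> form n (\<lambda>i. X (z i)) v"
    and normal: "\<And>w. (\<Sum>i=1..n. (X (z i) \<bullet> \<theta>) * (X (z i) \<bullet> w)) = (\<Sum>i=1..n. (X (z i) \<bullet> w) * e (z i))"
  shows "form n (\<lambda>i. X (z i)) \<theta> \<le> 4 * \<sigma>\<^sup>2 * (ln K + real (DIM('a)) / 2 * ln 2)"
proof -
  let ?V = "form n (\<lambda>i. X (z i))" and ?x = "design {1..n} z"
  have form_eq: "form n ?x = ?V" by (simp add: form_def design_def fun_eq_iff)
  have Vm [measurable]: "?V \<in> borel_measurable borel" unfolding form_def[abs_def] by measurable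
  have V0: "0 \<le> ?V w" for w by (simp add: form_def sum_nonneg)
  define I0 where "I0 = (\<integral>\<^sup>+ w. ennreal (exp (- (\<sigma>\<^sup>2 * ?V w))) \<partial>lborel)"
  define q where "q = ?V \<theta> / (4 * \<sigma>\<^sup>2)"
  have scale: "norming n ?x = ennreal (sqrt 2 ^ DIM('a)) * I0"
  proof -
    have V2: "?V (sqrt 2 *\<^sub>R w) = 2 * ?V w" for w
      by (simp add: form_def power_mult_distrib sum_distrib_left)
    have "norming n ?x = ennreal (sqrt 2 ^ DIM('a)) * (\<integral>\<^sup>+ w. ennreal (exp (- (\<sigma>\<^sup>2 * ?V (sqrt 2 *\<^sub>R w) / 2))) \<partial>lborel)"
      unfolding norming_def form_eq by (rule nn_integral_lborel_scale) auto
    then show ?thesis unfolding V2 I0_def by simp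
  qed
  have I0_fin: "I0 < \<infinity>"
  proof -
    have "I0 \<le> (\<integral>\<^sup>+ (w :: 'a). ennreal (exp (- (\<sigma>\<^sup>2 * a * (w \<bullet> w)))) \<partial>lborel)"
      unfolding I0_def
    proof (rule nn_integral_mono, rule ennreal_leI)
      fix w
      show "exp (- (\<sigma>\<^sup>2 * ?V w)) \<le> exp (- (\<sigma>\<^sup>2 * a * (w \<bullet> w)))"
        using mult_left_mono[OF low[of w], of "\<sigma>\<^sup>2"] by (simp add: mult.assoc)
    qed
    also have "\<dots> < \<infinity>" using \<sigma> a by (intro nn_integral_gaussian_finite) simp
    finally show ?thesis .
  qed
  have N_fin: "norming n ?x \<noteq> \<infinity>" using I0_fin scale by (simp add: ennreal_mult_eq_top_iff)
  let ?N = "enn2real (norming n ?x)"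
  have N: "0 < ?N" "ennreal ?N = norming n ?x" using N_fin norming_pos[of n ?x]
    by (auto simp: enn2real_positive_iff top.not_eq_extremum zero_less_iff_neq_zero)
  have I0_pos: "I0 \<noteq> 0" using norming_pos[of n ?x] scale by auto
  define i0 where "i0 = enn2real I0"
  have i0: "0 < i0" "ennreal i0 = I0" using I0_fin I0_pos
    by (auto simp: i0_def enn2real_positive_iff zero_less_iff_neq_zero)
  have square: "(\<Sum>i=1..n. (X (z i) \<bullet> w) * e (z i)) - \<sigma>\<^sup>2 * ?V w = q - \<sigma>\<^sup>2 * ?V (- (1 / (2 * \<sigma>\<^sup>2)) *\<^sub>R \<theta> + w)" for w
  proof -
    have "?V (- (1 / (2 * \<sigma>\<^sup>2)) *\<^sub>R \<theta> + w) =
        (\<Sum>i=1..n. (1 / (2 * \<sigma>\<^sup>2))\<^sup>2 * (X (z i) \<bullet> \<theta>)\<^sup>2 + (X (z i) \<bullet> w)\<^sup>2 - (1 / \<sigma>\<^sup>2) * ((X (z i) \<bullet> \<theta>) * (X (z i) \<bullet> w)))"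
      unfolding form_def
    proof (intro sum.cong refl)
      fix i
      have sq: "(- k * A + B)\<^sup>2 = k\<^sup>2 * A\<^sup>2 + B\<^sup>2 - (2 * k) * (A * B)" for k A B :: real
        by (simp add: power2_eq_square algebra_simps)
      have "X (z i) \<bullet> (- (1 / (2 * \<sigma>\<^sup>2)) *\<^sub>R \<theta> + w) = - (1 / (2 * \<sigma>\<^sup>2)) * (X (z i) \<bullet> \<theta>) + X (z i) \<bullet> w"
        by (simp only: inner_add_right inner_scaleR_right)
      moreover have "2 * (1 / (2 * \<sigma>\<^sup>2)) = 1 / \<sigma>\<^sup>2" by simp
      ultimately show "(X (z i) \<bullet> (- (1 / (2 * \<sigma>\<^sup>2)) *\<^sub>R \<theta> + w))\<^sup>2 =
        (1 / (2 * \<sigma>\<^sup>2))\<^sup>2 * (X (z i) \<bullet> \<theta>)\<^sup>2 + (X (z i) \<bullet> w)\<^sup>2 - (1 / \<sigma>\<^sup>2) * ((X (z i) \<bullet> \<theta>) * (X (z i) \<bullet> w))"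
        by (simp only: sq)
    qed
    also have "\<dots> = (1 / (2 * \<sigma>\<^sup>2))\<^sup>2 * ?V \<theta> + ?V w - (1 / \<sigma>\<^sup>2) * (\<Sum>i=1..n. (X (z i) \<bullet> w) * e (z i))"
      by (simp only: form_def sum.distrib sum_subtractf sum_distrib_left[symmetric] normal)
    finally have V': "?V (- (1 / (2 * \<sigma>\<^sup>2)) *\<^sub>R \<theta> + w) =
        (1 / (2 * \<sigma>\<^sup>2))\<^sup>2 * ?V \<theta> + ?V w - (1 / \<sigma>\<^sup>2) * (\<Sum>i=1..n. (X (z i) \<bullet> w) * e (z i))" .
    have "s * ((1 / (2 * s))\<^sup>2 * A + B - (1 / s) * D) = A / (4 * s) + s * B - D" if "0 < s" for s A B D :: real
      using that by (simp add: field_simps power2_eq_square)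
    from this[of "\<sigma>\<^sup>2"] show ?thesis unfolding V' q_def using \<sigma> by simp
  qed
  have "mixture n z = (\<integral>\<^sup>+ w. ennreal (exp q / ?N) * ennreal (exp (- (\<sigma>\<^sup>2 * ?V (- (1 / (2 * \<sigma>\<^sup>2)) *\<^sub>R \<theta> + w)))) \<partial>lborel)"
    unfolding mixture_def
  proof (intro nn_integral_cong)
    fix w
    have "(\<Prod>i=1..n. tilt w (z i)) = exp ((\<Sum>i=1..n. (X (z i) \<bullet> w) * e (z i)) - \<sigma>\<^sup>2 * ?V w / 2)"
      by (simp add: tilt_def exp_sum[symmetric] sum_subtractf form_def sum_divide_distrib[symmetric] sum_distrib_left mult.commute)
    then have "dens n w ?x * (\<Prod>i=1..n. tilt w (z i)) = exp ((\<Sum>i=1..n. (X (z i) \<bullet> w) * e (z i)) - \<sigma>\<^sup>2 * ?V w) / ?N"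
      unfolding dens_def form_eq by (simp add: exp_add[symmetric] field_simps)
    also have "\<dots> = exp q / ?N * exp (- (\<sigma>\<^sup>2 * ?V (- (1 / (2 * \<sigma>\<^sup>2)) *\<^sub>R \<theta> + w)))"
      unfolding square by (simp add: exp_diff exp_minus field_simps)
    finally have eq: "dens n w ?x * (\<Prod>i=1..n. tilt w (z i)) =
        exp q / ?N * exp (- (\<sigma>\<^sup>2 * ?V (- (1 / (2 * \<sigma>\<^sup>2)) *\<^sub>R \<theta> + w)))" .
    show "ennreal (dens n w ?x * (\<Prod>i=1..n. tilt w (z i))) =
        ennreal (exp q / ?N) * ennreal (exp (- (\<sigma>\<^sup>2 * ?V (- (1 / (2 * \<sigma>\<^sup>2)) *\<^sub>R \<theta> + w))))"
      unfolding eq using N(1) by (intro ennreal_mult) auto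
  qed
  also have "\<dots> = ennreal (exp q / ?N) * I0"
  proof -
    have sh: "(\<integral>\<^sup>+ w. ennreal (exp (- (\<sigma>\<^sup>2 * ?V (- (1 / (2 * \<sigma>\<^sup>2)) *\<^sub>R \<theta> + w)))) \<partial>lborel) = I0"
      unfolding I0_def by (rule nn_integral_lborel_shift[where f="\<lambda>w. ennreal (exp (- (\<sigma>\<^sup>2 * ?V w)))"]) measurable
    have "(\<lambda>w. ennreal (exp (- (\<sigma>\<^sup>2 * ?V (- (1 / (2 * \<sigma>\<^sup>2)) *\<^sub>R \<theta> + w))))) \<in> borel_measurable lborel"
      by measurable
    from nn_integral_cmult[OF this] show ?thesis by (simp only: sh)
  qed
  also have "\<dots> = ennreal (exp q / ?N) * ennreal i0" by (simp only: i0(2))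
  also have "\<dots> = ennreal (exp q / ?N * i0)" using i0(1) N(1) by (intro ennreal_mult[symmetric]) auto
  finally have "exp q / ?N * i0 < K" using z K i0 N
    by (simp add: good_noise_def ennreal_less_iff)
  moreover have "?N = sqrt 2 ^ DIM('a) * i0" unfolding scale by (simp add: enn2real_mult i0_def)
  ultimately have "exp q < K * sqrt 2 ^ DIM('a)" using i0 by (simp add: field_simps)
  then have "q < ln (K * sqrt 2 ^ DIM('a))" using K by (simp add: ln_less_cancel_iff[symmetric] del: ln_less_cancel_iff)
  also have "\<dots> = ln K + real (DIM('a)) / 2 * ln 2" using K by (simp add: ln_mult ln_realpow ln_sqrt)
  finally show ?thesis using \<sigma> by (simp add: q_def field_simps)
qed

end


section \<open>Least squares\<close>

lemma zero_if_quadratic_nonneg: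
  fixes K L :: real assumes "\<And>s. 0 \<le> s\<^sup>2 * K - 2 * s * L" shows "L = 0"
proof (rule ccontr)
  assume L: "L \<noteq> 0"
  define m where "m = \<bar>K\<bar> + 1"
  have m: "0 < m" "K \<le> m" by (auto simp: m_def)
  have "0 \<le> (L / m)\<^sup>2 * K - 2 * (L / m) * L" by (rule assms)
  also have "\<dots> \<le> (L / m)\<^sup>2 * m - 2 * (L / m) * L" using m by (intro diff_right_mono mult_left_mono) auto
  also have "\<dots> = - (L\<^sup>2 / m)" using m by (simp add: power2_eq_square field_simps)
  also have "\<dots> < 0" using L m by simp
  finally show False by simp
qed

text \<open>The objective is a parabola along the rank-one perturbation of \<open>M\<close> that adds \<open>s w\<close> to row \<open>k\<close>.\<close>

lemma normal_equations:
  fixes M :: "real^'p^'d"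
  assumes "is_ols c0 n z M"
  shows "(\<Sum>i=1..n. (fst (z i) \<bullet> w) * (snd (z i) - c0 - M *v fst (z i)) $ k) = 0"
proof -
  let ?r = "\<lambda>i. snd (z i) - c0 - M *v fst (z i)"
  let ?f = "\<lambda>M :: real^'p^'d. \<Sum>i=1..n. (norm (snd (z i) - c0 - M *v fst (z i)))\<^sup>2"
  define E :: "real^'p^'d" where "E = (\<chi> i j. if i = k then w $ j else 0)"
  have E: "E *v x = (x \<bullet> w) *\<^sub>R axis k 1" for x
    by (simp add: vec_eq_iff matrix_vector_mult_def E_def axis_def inner_vec_def mult.commute)
  have "0 \<le> s\<^sup>2 * (\<Sum>i=1..n. (fst (z i) \<bullet> w)\<^sup>2) - 2 * s * (\<Sum>i=1..n. (fst (z i) \<bullet> w) * ?r i $ k)" for s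
  proof -
    have "?f M \<le> ?f (M + s *\<^sub>R E)"
      using assms by (auto simp: is_ols_def is_arg_min_def not_less)
    also have "?f (M + s *\<^sub>R E) = (\<Sum>i=1..n. (norm (?r i))\<^sup>2 + s\<^sup>2 * (fst (z i) \<bullet> w)\<^sup>2 - 2 * s * ((fst (z i) \<bullet> w) * ?r i $ k))"
    proof (intro sum.cong refl)
      fix i
      have "snd (z i) - c0 - (M + s *\<^sub>R E) *v fst (z i) = ?r i - (s * (fst (z i) \<bullet> w)) *\<^sub>R axis k 1"
        by (simp add: matrix_vector_mult_add_rdistrib scaleR_matrix_vector_assoc[symmetric] E algebra_simps)
      moreover have "(norm (r - t *\<^sub>R axis k 1))\<^sup>2 = (norm r)\<^sup>2 + t\<^sup>2 - 2 * t * r $ k" for r :: "real^'d" and t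
        unfolding power2_norm_eq_inner power2_eq_square[of t]
        by (simp add: inner_diff_left inner_diff_right inner_axis inner_axis' algebra_simps)
      ultimately have "(norm (snd (z i) - c0 - (M + s *\<^sub>R E) *v fst (z i)))\<^sup>2 =
          (norm (?r i))\<^sup>2 + (s * (fst (z i) \<bullet> w))\<^sup>2 - 2 * (s * (fst (z i) \<bullet> w)) * ?r i $ k"
        by (simp only:)
      also have "\<dots> = (norm (?r i))\<^sup>2 + s\<^sup>2 * (fst (z i) \<bullet> w)\<^sup>2 - 2 * s * ((fst (z i) \<bullet> w) * ?r i $ k)"
        by (simp only: power_mult_distrib mult.assoc)
      finally show "(norm (snd (z i) - c0 - (M + s *\<^sub>R E) *v fst (z i)))\<^sup>2 =
          (norm (?r i))\<^sup>2 + s\<^sup>2 * (fst (z i) \<bullet> w)\<^sup>2 - 2 * s * ((fst (z i) \<bullet> w) * ?r i $ k)" .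
    qed
    also have "\<dots> = ?f M + s\<^sup>2 * (\<Sum>i=1..n. (fst (z i) \<bullet> w)\<^sup>2) - 2 * s * (\<Sum>i=1..n. (fst (z i) \<bullet> w) * ?r i $ k)"
      by (simp add: sum.distrib sum_subtractf sum_distrib_left)
    finally show ?thesis by simp
  qed
  then show ?thesis by (rule zero_if_quadratic_nonneg)
qed

definition gram :: "nat \<Rightarrow> (nat \<Rightarrow> (real^'p) \<times> (real^'d)) \<Rightarrow> real^'p^'p" where
  "gram n z = (\<chi> a b. \<Sum>i=1..n. fst (z i) $ a * fst (z i) $ b)"

definition moment :: "real^'d \<Rightarrow> nat \<Rightarrow> (nat \<Rightarrow> (real^'p) \<times> (real^'d)) \<Rightarrow> 'd \<Rightarrow> real^'p" where
  "moment c0 n z k = (\<chi> a. \<Sum>i=1..n. fst (z i) $ a * (snd (z i) - c0) $ k)"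

text \<open>Cramer's rule makes the estimator an explicit measurable function of the sample.\<close>

definition cramer_ols :: "real^'d \<Rightarrow> nat \<Rightarrow> (nat \<Rightarrow> (real^'p) \<times> (real^'d)) \<Rightarrow> real^'p^'d" where
  "cramer_ols c0 n z = (\<chi> k l. det (\<chi> i j. if j = l then moment c0 n z k $ i else gram n z $ i $ j) / det (gram n z))"

lemma gram_form: "(gram n z *v v) $ a = (\<Sum>i=1..n. fst (z i) $ a * (fst (z i) \<bullet> v))"
  unfolding gram_def matrix_vector_mult_def inner_vec_def
  by (simp add: sum_distrib_left sum_distrib_right mult.assoc) (rule sum.swap)

lemma ols_eq_cramer:
  fixes M :: "real^'p^'d"
  assumes ols: "is_ols c0 n z M" and a: "0 < a" and low: "\<And>v. a * (v \<bullet> v) \<le> (\<Sum>i=1..n. (fst (z i) \<bullet> v)\<^sup>2)"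
  shows "M = cramer_ols c0 n z"
proof -
  have "v = 0" if "gram n z *v v = 0" for v
  proof -
    have "(\<Sum>i=1..n. (fst (z i) \<bullet> v)\<^sup>2) = v \<bullet> (gram n z *v v)"
    proof -
      have "(\<Sum>a\<in>UNIV. v $ a * (fst (z i) $ a * c)) = c * (fst (z i) \<bullet> v)" for i c
        by (simp add: inner_vec_def sum_distrib_left mult_ac)
      then show ?thesis
        unfolding inner_vec_def[of v] gram_form sum_distrib_left inner_real_def
        by (subst sum.swap) (simp add: power2_eq_square)
    qed
    then have "a * (v \<bullet> v) \<le> 0" using low[of v] that by simp
    then show "v = 0" using a by (simp add: mult_le_0_iff) (metis inner_ge_zero inner_eq_zero_iff order.antisym)
  qed
  then have "inj (\<lambda>v. gram n z *v v)" using linear_injective_0[OF matrix_vector_mul_linear[of "gram n z"]] by auto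
  then have "invertible (gram n z)" using invertible_left_inverse matrix_left_invertible_injective by blast
  then have det: "det (gram n z) \<noteq> 0" using invertible_det_nz by blast
  have "gram n z *v (M $ k) = moment c0 n z k" for k
  proof -
    have "(gram n z *v (M $ k)) $ a - moment c0 n z k $ a =
        - (\<Sum>i=1..n. (fst (z i) \<bullet> axis a 1) * (snd (z i) - c0 - M *v fst (z i)) $ k)" for a
      unfolding gram_form moment_def
      by (simp add: inner_axis matrix_vector_mul_component inner_commute[of _ "M $ k"] sum_subtractf[symmetric] sum_negf[symmetric] algebra_simps)
    then show ?thesis using normal_equations[OF ols] by (simp add: vec_eq_iff)
  qed
  then have "M $ k = (\<chi> l. det (\<chi> i j. if j = l then moment c0 n z k $ i else gram n z $ i $ j) / det (gram n z))" for k
    using cramer[OF det] by blast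
  then show ?thesis by (simp add: cramer_ols_def vec_eq_iff)
qed

lemma borel_measurable_vecI:
  fixes f :: "'x \<Rightarrow> real^'n"
  assumes "\<And>k. (\<lambda>x. f x $ k) \<in> borel_measurable M"
  shows "f \<in> borel_measurable M"
proof (subst borel_measurable_euclidean_space, intro ballI)
  fix b :: "real^'n" assume "b \<in> Basis"
  then obtain k where "b = axis k 1" by (auto simp: Basis_vec_def)
  then show "(\<lambda>x. f x \<bullet> b) \<in> borel_measurable M" using assms[of k] by (simp add: inner_axis)
qed

lemma borel_measurable_vec_component [measurable (raw)]:
  fixes f :: "'x \<Rightarrow> real^'n"
  assumes "f \<in> borel_measurable M" shows "(\<lambda>x. f x $ k) \<in> borel_measurable M"
  using borel_measurable_inner[OF assms borel_measurable_const[of "axis k 1"]] by (simp add: inner_axis)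

lemma borel_measurable_det:
  fixes f :: "'x \<Rightarrow> real^'n^'n"
  assumes [measurable]: "\<And>i j. (\<lambda>x. f x $ i $ j) \<in> borel_measurable M"
  shows "(\<lambda>x. det (f x)) \<in> borel_measurable M"
  unfolding det_def by measurable

lemma cramer_ols_measurable:
  fixes P :: "((real^'p) \<times> (real^'d)) measure"
  assumes P: "sets P = sets borel"
  shows "(\<lambda>z. cramer_ols c0 n z $ k $ l) \<in> borel_measurable (PiM {1..n} (\<lambda>_. P))"
proof -
  have [measurable_cong]: "sets P = sets (borel \<Otimes>\<^sub>M borel)" using P unfolding borel_prod .
  have m1: "(\<lambda>z. moment c0 n z k $ i) \<in> borel_measurable (PiM {1..n} (\<lambda>_. P))" for i
    unfolding moment_def vec_lambda_beta by measurable
  have m2: "(\<lambda>z. gram n z $ i $ j) \<in> borel_measurable (PiM {1..n} (\<lambda>_. P))" for i j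
    unfolding gram_def vec_lambda_beta by measurable
  have "(\<lambda>z. det (\<chi> i j. if j = l then moment c0 n z k $ i else gram n z $ i $ j)) \<in> borel_measurable (PiM {1..n} (\<lambda>_. P))"
  proof (rule borel_measurable_det)
    fix i j
    show "(\<lambda>z. (\<chi> i j. if j = l then moment c0 n z k $ i else gram n z $ i $ j) $ i $ j) \<in> borel_measurable (PiM {1..n} (\<lambda>_. P))"
      using m1[of i] m2[of i j] by (cases "j = l") simp_all
  qed
  moreover have "(\<lambda>z. det (gram n z)) \<in> borel_measurable (PiM {1..n} (\<lambda>_. P))" by (rule borel_measurable_det[OF m2])
  ultimately show ?thesis unfolding cramer_ols_def vec_lambda_beta by (rule borel_measurable_divide)
qed


section \<open>Decisions away from ties\<close>

lemma closed_lp_opt_costs: "closed {c. x \<in> lp_opt A b c}"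
proof -
  have "{c. x \<in> lp_opt A b c} = (if x \<in> lp_feasible A b then (\<Inter>y\<in>lp_feasible A b. {c. c \<bullet> x \<le> c \<bullet> y}) else {})"
    by (auto simp: lp_opt_iff)
  moreover have "closed (\<Inter>y\<in>lp_feasible A b. {c. c \<bullet> x \<le> c \<bullet> y})"
    by (intro closed_INT ballI closed_Collect_le continuous_intros)
  ultimately show ?thesis by auto
qed

text \<open>Along the segment from \<open>m\<close> to \<open>c\<close>, the costs for which the decision at \<open>m\<close> stays optimal and the
  costs for which some other vertex is optimal are closed and cover; by connectedness a change of
  decision would meet a tie.\<close>

lemma decision_stable:
  assumes lp: "lp_setting A b" and far: "ereal (dist m c) < edist_set m (tie_costs A b)"
    and x0: "x0 \<in> lp_vertices A b" "x0 \<in> lp_opt A b m" and x: "x \<in> lp_vertices A b" "x \<in> lp_opt A b c"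
  shows "x = x0"
proof (rule ccontr)
  assume "x \<noteq> x0"
  let ?A = "{c'. x0 \<in> lp_opt A b c'}" and ?B = "\<Union>v\<in>lp_vertices A b - {x0}. {c'. v \<in> lp_opt A b c'}"
  have "closed ?A" "closed ?B" using finite_lp_vertices by (auto intro!: closed_lp_opt_costs)
  moreover have "closed_segment m c \<subseteq> ?A \<union> ?B"
  proof
    fix c' obtain v where "v \<in> lp_opt A b c'" "v \<in> lp_vertices A b"
      using lp lp_opt_vertex_exists[of A b c'] by (auto simp: lp_setting_def)
    then show "c' \<in> ?A \<union> ?B" by auto
  qed
  moreover have "m \<in> ?A \<inter> closed_segment m c" "c \<in> ?B \<inter> closed_segment m c" using x0 x \<open>x \<noteq> x0\<close> by auto
  ultimately have "?A \<inter> ?B \<inter> closed_segment m c \<noteq> {}"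
    using connected_segment(1)[of m c] unfolding connected_closed by blast
  then obtain c' v where c': "c' \<in> closed_segment m c" "x0 \<in> lp_opt A b c'" "v \<in> lp_vertices A b" "v \<noteq> x0" "v \<in> lp_opt A b c'"
    by blast
  then have "c' \<in> tie_costs A b" using x0(1) unfolding tie_costs_def by blast
  then have "edist_set m (tie_costs A b) \<le> ereal (dist m c')" unfolding edist_set_def by (rule INF_lower)
  also have "\<dots> \<le> ereal (dist m c)" using segment_bound(1)[OF c'(1)] by (simp add: dist_norm norm_minus_commute)
  finally show False using far by simp
qed

lemma lp_opt_unique_off_ties:
  assumes "c \<notin> tie_costs A b" "x \<in> lp_vertices A b" "x \<in> lp_opt A b c" "y \<in> lp_vertices A b" "y \<in> lp_opt A b c"
  shows "x = y"
  using assms unfolding tie_costs_def by blast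

lemma edist_set_le_closed: "closed {v. edist_set v S \<le> ereal r}"
proof (cases "S = {}")
  case True
  then show ?thesis by (simp add: edist_set_def top_ereal_def)
next
  case False
  have "edist_set v S = ereal (infdist v S)" for v
    using False ereal_Inf'[of "dist v ` S"] by (simp add: edist_set_def infdist_def image_image)
  then have "{v. edist_set v S \<le> ereal r} = {v. infdist v S \<le> r}" by simp
  then show ?thesis by (simp add: closed_Collect_le continuous_on_infdist)
qed

text \<open>The estimation error vanishes for noiseless costs, so the margin bound is extended to radius 0 by
  letting the radius decrease.\<close>

lemma margin_at_nonneg_radius:
  fixes Cm \<alpha> r :: real
  assumes C: "0 < Cm" and \<alpha>: "0 < \<alpha>" and r: "0 \<le> r"
    and fin: "finite_measure Q" and meas: "\<And>\<eta>. {\<xi>. edist_set (mu \<xi>) T \<le> ereal \<eta>} \<in> sets Q"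
    and margin: "\<And>\<eta>. 0 < \<eta> \<Longrightarrow> measure Q {\<xi>. edist_set (mu \<xi>) T \<le> ereal \<eta>} \<le> Cm * \<eta> powr \<alpha>"
  shows "measure Q {\<xi>. edist_set (mu \<xi>) T \<le> ereal r} \<le> Cm * r powr \<alpha>"
proof (cases "r = 0")
  case True
  have "measure Q {\<xi>. edist_set (mu \<xi>) T \<le> ereal r} \<le> 0 + e" if e: "0 < e" for e
  proof -
    let ?\<eta> = "(e / Cm) powr (1 / \<alpha>)"
    have "0 < ?\<eta>" using e C by simp
    have "measure Q {\<xi>. edist_set (mu \<xi>) T \<le> ereal r} \<le> measure Q {\<xi>. edist_set (mu \<xi>) T \<le> ereal ?\<eta>}"
      using True \<open>0 < ?\<eta>\<close> by (intro finite_measure.finite_measure_mono[OF fin _ meas])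
        (auto intro: order_trans simp: zero_ereal_def)
    also have "\<dots> \<le> Cm * ?\<eta> powr \<alpha>" by (rule margin) fact
    also have "?\<eta> powr \<alpha> = e / Cm" using \<alpha> e C by (simp add: powr_powr)
    finally show ?thesis using C by simp
  qed
  then have "measure Q {\<xi>. edist_set (mu \<xi>) T \<le> ereal r} \<le> 0" by (rule field_le_epsilon)
  then show ?thesis using True \<alpha> C by simp
next
  case False
  then show ?thesis using margin r by simp
qed

text \<open>The support of a Borel measure. If a closed condition, whatever random parameter it depends on, holds
  almost surely for a fresh point, it holds on the support and hence at all sampled points.\<close>

lemma support_exists:
  fixes Q :: "'a::second_countable_topology measure"
  assumes Q: "sets Q = sets borel"
  shows "\<exists>K. closed K \<and> (AE x in Q. x \<in> K) \<and> (\<forall>F. closed F \<longrightarrow> (AE x in Q. x \<in> F) \<longrightarrow> K \<subseteq> F)"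
proof -
  obtain \<B> :: "'a set set" where \<B>: "countable \<B>" "topological_basis \<B>" using ex_countable_basis by blast
  have op: "open B" if "B \<in> \<B>" for B using \<B>(2) that by (rule topological_basis_open)
  define U where "U = \<Union> {B\<in>\<B>. B \<in> null_sets Q}"
  have cn: "countable {B\<in>\<B>. B \<in> null_sets Q}" using \<B>(1) by (rule countable_subset[rotated]) auto
  have U: "U \<in> null_sets Q" unfolding U_def
    using null_sets_UN'[OF cn, of "\<lambda>B. B" Q] by simp
  have "open U" unfolding U_def using op by auto
  moreover have "AE x in Q. x \<in> - U" using AE_not_in[OF U] by simp
  moreover have "- U \<subseteq> F" if F: "closed F" "AE x in Q. x \<in> F" for F
  proof -
    have sp: "space Q = UNIV" using sets_eq_imp_space_eq[OF Q] by simp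
    have "- F \<in> sets Q" using F(1) Q by (simp add: borel_closed)
    then have "- F \<in> null_sets Q" using F(2) by (subst AE_iff_null_sets) (auto)
    have "- F \<subseteq> U"
    proof
      fix x assume "x \<in> - F"
      then obtain B where B: "B \<in> \<B>" "x \<in> B" "B \<subseteq> - F"
        using topological_basisE[OF \<B>(2), of "- F" x] F(1) by (auto simp: open_Compl)
      then have "B \<in> null_sets Q"
        using null_sets_subset[OF \<open>- F \<in> null_sets Q\<close>, of B] op Q by (auto simp: borel_open)
      then show "x \<in> U" using B by (auto simp: U_def)
    qed
    then show ?thesis by auto
  qed
  ultimately show ?thesis by (intro exI[of _ "- U"]) auto
qed

section \<open>The cost model\<close>

locale cost_model = prob_space P for P :: "((real^'p) \<times> (real^'d)) measure" +
  fixes C :: "(real^'d) set"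
  assumes P_sets: "sets P = sets borel" and C_bounded: "bounded C" and cost: "AE z in P. snd z \<in> C"
begin

lemma P_sets_pair [measurable_cong]: "sets P = sets (borel \<Otimes>\<^sub>M borel)"
  using P_sets unfolding borel_prod .

lemma space_P: "space P = UNIV" using sets_eq_imp_space_eq[OF P_sets] by simp

lemma prob_space_xi: "prob_space (xi_law P)"
  unfolding xi_law_def by (rule prob_space_distr) measurable

lemma sets_xi [measurable_cong]: "sets (xi_law P) = sets borel" by (simp add: xi_law_def)

lemma space_xi: "space (xi_law P) = UNIV" by (simp add: xi_law_def)

lemma AE_xi_iff:
  assumes "{\<xi>. Q \<xi>} \<in> sets borel" shows "(AE \<xi> in xi_law P. Q \<xi>) \<longleftrightarrow> (AE z in P. Q (fst z))"
  unfolding xi_law_def by (rule AE_distr_iff) (use assms in auto)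

lemma measure_xi: "B \<in> sets borel \<Longrightarrow> measure (xi_law P) B = measure P {z. fst z \<in> B}"
  unfolding xi_law_def by (subst measure_distr) (auto simp: space_P vimage_def)

lemma subalgebra_xi: "subalgebra P (xi_algebra P)"
  unfolding subalgebra_def xi_algebra_def
proof (intro conjI)
  have "fst \<in> measurable P borel" by measurable
  then show "sets (vimage_algebra (space P) fst borel) \<subseteq> sets P"
    by (auto simp: sets_vimage_algebra2 dest: measurable_sets)
qed simp

sublocale xi: finite_measure_subalgebra P "xi_algebra P"
  by standard (rule subalgebra_xi)

lemma fst_xi_algebra: "fst \<in> measurable (xi_algebra P) borel"
  unfolding xi_algebra_def by (rule measurable_vimage_algebra1) (simp add: space_P)

lemma xi_measurable: "h \<in> borel_measurable borel \<Longrightarrow> (\<lambda>z. h (fst z)) \<in> borel_measurable (xi_algebra P)"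
  by (rule measurable_compose[OF fst_xi_algebra])

lemma snd_component_integrable: "integrable P (\<lambda>z. snd z $ k)"
proof -
  obtain B where B: "\<And>c. c \<in> C \<Longrightarrow> norm c \<le> B" using C_bounded by (auto simp: bounded_iff)
  have "AE z in P. norm (snd z $ k) \<le> B"
    using cost by eventually_elim (metis B component_le_norm_cart order_trans real_norm_def)
  moreover have "(\<lambda>z. snd z $ k) \<in> borel_measurable P" by measurable
  ultimately show ?thesis by (rule integrable_const_bound)
qed

lemma cost_inner_integrable:
  assumes [measurable]: "h \<in> borel_measurable P" and h: "\<And>z. norm (h z) \<le> D"
  shows "integrable P (\<lambda>z. snd z \<bullet> h z)"
proof -
  obtain B where B: "\<And>c. c \<in> C \<Longrightarrow> norm c \<le> B" using C_bounded by (auto simp: bounded_iff)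
  have "AE z in P. norm (snd z \<bullet> h z) \<le> B * D"
    using cost
  proof eventually_elim
    case (elim z)
    have "norm (snd z \<bullet> h z) \<le> norm (snd z) * norm (h z)" using Cauchy_Schwarz_ineq2[of "snd z" "h z"] by simp
    also have "\<dots> \<le> B * D" using B[OF elim] h[of z] order_trans[OF norm_ge_zero B[OF elim]] by (intro mult_mono) auto
    finally show ?case .
  qed
  moreover have "(\<lambda>z. snd z \<bullet> h z) \<in> borel_measurable P" by measurable
  ultimately show ?thesis by (rule integrable_const_bound)
qed

text \<open>For decisions that depend on the context only, the cost may be replaced by its conditional mean.\<close>

lemma cond_mean_inner:
  assumes mu: "is_cond_mean P mu" and [measurable]: "h \<in> borel_measurable borel" and h: "\<And>\<xi>. norm (h \<xi>) \<le> D"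
  shows "integrable P (\<lambda>z. mu (fst z) \<bullet> h (fst z))"
    and "(\<integral>z. snd z \<bullet> h (fst z) \<partial>P) = (\<integral>z. mu (fst z) \<bullet> h (fst z) \<partial>P)"
proof -
  have mum [measurable]: "mu \<in> borel_measurable borel" using mu by (simp add: is_cond_mean_def)
  have hk: "integrable P (\<lambda>z. h (fst z) $ k * snd z $ k)" for k
  proof (rule Bochner_Integration.integrable_bound[OF integrable_mult_right[OF snd_component_integrable[of k], of D]])
    show "(\<lambda>z. h (fst z) $ k * snd z $ k) \<in> borel_measurable P" by measurable
    have "\<bar>h \<xi> $ k\<bar> \<le> \<bar>D\<bar>" for \<xi> using component_le_norm_cart[of "h \<xi>" k] h[of \<xi>] by simp
    then show "AE z in P. norm (h (fst z) $ k * snd z $ k) \<le> norm (D * snd z $ k)"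
      by (intro AE_I2) (simp add: abs_mult mult_right_mono)
  qed
  have comp: "integrable P (\<lambda>z. mu (fst z) $ k * h (fst z) $ k) \<and>
     (\<integral>z. snd z $ k * h (fst z) $ k \<partial>P) = (\<integral>z. mu (fst z) $ k * h (fst z) $ k \<partial>P)" for k
  proof -
    have hm: "(\<lambda>z. h (fst z) $ k) \<in> borel_measurable (xi_algebra P)"
      by (rule xi_measurable[of "\<lambda>\<xi>. h \<xi> $ k"]) measurable
    note int = hk[of k]
    have sm: "(\<lambda>z. snd z $ k) \<in> borel_measurable P" by measurable
    have ae: "AE z in P. h (fst z) $ k * real_cond_exp P (xi_algebra P) (\<lambda>z. snd z $ k) z = mu (fst z) $ k * h (fst z) $ k"
    proof -
      have "AE z in P. real_cond_exp P (xi_algebra P) (\<lambda>z. snd z $ k) z = mu (fst z) $ k"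
        using mu by (simp add: is_cond_mean_def)
      then show ?thesis by eventually_elim simp
    qed
    have rm: "(\<lambda>z. h (fst z) $ k * real_cond_exp P (xi_algebra P) (\<lambda>z. snd z $ k) z) \<in> borel_measurable P" by measurable
    have mm: "(\<lambda>z. mu (fst z) $ k * h (fst z) $ k) \<in> borel_measurable P" by measurable
    note r = xi.real_cond_exp_intg[OF int hm sm]
    show ?thesis
      using r integrable_cong_AE[OF rm mm ae] integral_cong_AE[OF rm mm ae] by (simp add: mult.commute)
  qed
  show "integrable P (\<lambda>z. mu (fst z) \<bullet> h (fst z))"
    unfolding inner_vec_def inner_real_def using comp by (intro Bochner_Integration.integrable_sum) auto
  show "(\<integral>z. snd z \<bullet> h (fst z) \<partial>P) = (\<integral>z. mu (fst z) \<bullet> h (fst z) \<partial>P)"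
    unfolding inner_vec_def inner_real_def using comp hk by (subst (1 2) Bochner_Integration.integral_sum) (auto simp: mult.commute)
qed

context
  fixes A :: "real^'d^'m" and b :: "real^'m" and xs :: "real^'d \<Rightarrow> real^'d" and mu :: "real^'p \<Rightarrow> real^'d"
  assumes lp: "lp_setting A b" and xs: "lp_oracle A b xs" and mu: "is_cond_mean P mu"
begin

lemma xs_measurable [measurable]: "xs \<in> borel_measurable borel" using xs by (simp add: lp_oracle_def)

lemma mu_measurable [measurable]: "mu \<in> borel_measurable borel" using mu by (simp add: is_cond_mean_def)

lemma xs_feasible: "xs v \<in> lp_feasible A b" using xs by (auto simp: lp_oracle_def lp_opt_iff)

lemma xs_optimal: "y \<in> lp_feasible A b \<Longrightarrow> v \<bullet> xs v \<le> v \<bullet> y" using xs by (auto simp: lp_oracle_def lp_opt_iff)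

lemma xs_bounded: obtains D where "\<And>v. norm (xs v) \<le> D"
  using lp xs_feasible by (auto simp: lp_setting_def bounded_iff)

lemma spo_risk_diff:
  assumes [measurable]: "f \<in> borel_measurable borel" "g \<in> borel_measurable borel"
  shows "integrable P (\<lambda>z. snd z \<bullet> (xs (f (fst z)) - xs (g (fst z))))"
    and "spo_risk P xs f - spo_risk P xs g = (\<integral>z. snd z \<bullet> (xs (f (fst z)) - xs (g (fst z))) \<partial>P)"
proof -
  obtain D where D: "\<And>v. norm (xs v) \<le> D" using xs_bounded by blast
  have i: "integrable P (\<lambda>z. snd z \<bullet> xs (f (fst z)))" "integrable P (\<lambda>z. snd z \<bullet> xs (g (fst z)))"
    "integrable P (\<lambda>z. snd z \<bullet> xs (snd z))"
    by (rule cost_inner_integrable[OF _ D]; measurable)+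
  show "integrable P (\<lambda>z. snd z \<bullet> (xs (f (fst z)) - xs (g (fst z))))"
    unfolding inner_diff_right using i by simp
  show "spo_risk P xs f - spo_risk P xs g = (\<integral>z. snd z \<bullet> (xs (f (fst z)) - xs (g (fst z))) \<partial>P)"
    unfolding spo_risk_def inner_diff_right using i by simp
qed

text \<open>After replacing the cost by its conditional mean, the oracle at the mean minimizes the integrand
  pointwise.\<close>

lemma spo_risk_Bayes:
  assumes [measurable]: "f \<in> borel_measurable borel"
  shows "spo_risk P xs mu \<le> spo_risk P xs f"
proof -
  obtain D where D: "\<And>v. norm (xs v) \<le> D" using xs_bounded by blast
  let ?h = "\<lambda>\<xi>. xs (f \<xi>) - xs (mu \<xi>)"
  have hD: "norm (?h \<xi>) \<le> D + D" for \<xi>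
    using norm_triangle_ineq4[of "xs (f \<xi>)" "xs (mu \<xi>)"] D[of "f \<xi>"] D[of "mu \<xi>"] by linarith
  have hm: "?h \<in> borel_measurable borel" by measurable
  have "spo_risk P xs f - spo_risk P xs mu = (\<integral>z. mu (fst z) \<bullet> ?h (fst z) \<partial>P)"
    unfolding spo_risk_diff(2)[OF assms mu_measurable] by (rule cond_mean_inner(2)[OF mu hm hD])
  also have "\<dots> \<ge> 0"
    using xs_optimal[OF xs_feasible] by (intro Bochner_Integration.integral_nonneg) (simp add: inner_diff_right)
  finally show ?thesis by simp
qed

lemma omega_bound:
  assumes "c \<in> C" "x \<in> lp_feasible A b" "y \<in> lp_feasible A b"
  shows "c \<bullet> (x - y) \<le> omega_X A b C"
proof -
  let ?X = "lp_feasible A b"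
  obtain B where B: "\<And>c. c \<in> C \<Longrightarrow> norm c \<le> B" using C_bounded by (auto simp: bounded_iff)
  obtain D where D: "\<And>x. x \<in> ?X \<Longrightarrow> norm x \<le> D" using lp by (auto simp: lp_setting_def bounded_iff)
  have abs: "\<bar>c \<bullet> x\<bar> \<le> B * D" if "c \<in> C" "x \<in> ?X" for c x
    using Cauchy_Schwarz_ineq2[of c x] B[OF that(1)] D[OF that(2)] mult_mono[of "norm c" B "norm x" D] norm_ge_zero[of c]
      norm_ge_zero[of x] by linarith
  have bdd: "bdd_above ((\<lambda>x. c \<bullet> x) ` ?X)" "bdd_below ((\<lambda>x. c \<bullet> x) ` ?X)" if "c \<in> C" for c
    using abs[OF that] by (auto intro!: bdd_aboveI2[of _ _ "B * D"] bdd_belowI2[of _ "- (B * D)"] simp: abs_le_iff minus_le_iff)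
  let ?g = "\<lambda>c. (SUP x\<in>?X. c \<bullet> x) - (INF x\<in>?X. c \<bullet> x)"
  have ne: "?X \<noteq> {}" using assms(2) by auto
  have "?g c \<le> B * D + B * D" if "c \<in> C" for c
  proof -
    have "(SUP x\<in>?X. c \<bullet> x) \<le> B * D" using abs[OF that] by (intro cSUP_least[OF ne]) (simp add: abs_le_iff)
    moreover have "- (B * D) \<le> (INF x\<in>?X. c \<bullet> x)" 
    proof (rule cINF_greatest[OF ne])
      fix x assume "x \<in> ?X"
      then show "- (B * D) \<le> c \<bullet> x" using abs[OF that, of x] by linarith
    qed
    ultimately show ?thesis by linarith
  qed
  then have "?g c \<le> omega_X A b C" if "c \<in> C" for c
    unfolding omega_X_def using that by (intro cSUP_upper bdd_aboveI2[of _ _ "B * D + B * D"])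
  moreover have "c \<bullet> x \<le> (SUP x\<in>?X. c \<bullet> x)" by (rule cSUP_upper[OF assms(2) bdd(1)[OF assms(1)]])
  moreover have "(INF x\<in>?X. c \<bullet> x) \<le> c \<bullet> y" by (rule cINF_lower[OF bdd(2)[OF assms(1)] assms(3)])
  ultimately show ?thesis using assms(1) by (fastforce simp: inner_diff_right)
qed

lemma spo_risk_le_disagreement:
  assumes [measurable]: "f \<in> borel_measurable borel" "g \<in> borel_measurable borel"
  shows "spo_risk P xs f - spo_risk P xs g \<le> omega_X A b C * measure (xi_law P) {\<xi>. xs (f \<xi>) \<noteq> xs (g \<xi>)}"
proof -
  let ?B = "{\<xi>. xs (f \<xi>) \<noteq> xs (g \<xi>)}"
  have B [measurable]: "?B \<in> sets borel"
  proof -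
    have "{\<xi>\<in>space borel. xs (f \<xi>) \<noteq> xs (g \<xi>)} \<in> sets borel" by measurable
    then show ?thesis by simp
  qed
  have set: "{z. fst z \<in> ?B} \<in> sets P"
    using measurable_sets[OF measurable_fst, of ?B borel borel] B unfolding P_sets_pair by (simp add: space_pair_measure vimage_def)
  have "spo_risk P xs f - spo_risk P xs g = (\<integral>z. snd z \<bullet> (xs (f (fst z)) - xs (g (fst z))) \<partial>P)"
    by (rule spo_risk_diff(2)) measurable
  also have "\<dots> \<le> (\<integral>z. omega_X A b C * indicator {z. fst z \<in> ?B} z \<partial>P)"
  proof (rule integral_mono_AE)
    show "integrable P (\<lambda>z. snd z \<bullet> (xs (f (fst z)) - xs (g (fst z))))" by (rule spo_risk_diff(1)) measurable
    show "integrable P (\<lambda>z. omega_X A b C * indicator {z. fst z \<in> ?B} z)"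
      using set by (intro integrable_mult_right integrable_real_indicator) (auto simp: emeasure_eq_measure)
    show "AE z in P. snd z \<bullet> (xs (f (fst z)) - xs (g (fst z))) \<le> omega_X A b C * indicator {z. fst z \<in> ?B} z"
      using cost by eventually_elim (use omega_bound[OF _ xs_feasible xs_feasible] in \<open>auto simp: indicator_def\<close>)
  qed
  also have "\<dots> = omega_X A b C * measure (xi_law P) ?B" using set by (simp add: measure_xi[OF B])
  finally show ?thesis .
qed

end

end


section \<open>Concentration of the least squares predictor\<close>

lemma ols_radius_nonneg:
  assumes "0 \<le> \<sigma>" "0 < \<kappa>" "0 < \<delta>" "\<delta> < 1" "1 \<le> real d"
  shows "0 \<le> ols_radius \<sigma> \<kappa> d p n \<delta>"
proof -
  have "\<delta> \<le> 4 * real d" using assms by linarith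
  then have "1 \<le> 4 * real d / \<delta>" using assms(3) by (simp add: le_divide_eq)
  then have "0 \<le> real d * (real p + ln (4 * real d / \<delta>)) / real n"
    by (intro divide_nonneg_nonneg mult_nonneg_nonneg add_nonneg_nonneg ln_ge_zero) auto
  then show ?thesis using assms unfolding ols_radius_def
    by (intro mult_nonneg_nonneg divide_nonneg_nonneg real_sqrt_ge_zero) auto
qed

locale ols_model = cost_model P C
  for P :: "((real^'p) \<times> (real^'d)) measure" and C :: "(real^'d) set" +
  fixes c0 :: "real^'d" and Amu :: "real^'p^'d" and \<kappa> \<sigma> :: real
  assumes ols: "bounded_design_ols P c0 Amu \<kappa> \<sigma>"
begin

definition noise :: "'d \<Rightarrow> (real^'p) \<times> (real^'d) \<Rightarrow> real" where
  "noise k z = (snd z - c0 - Amu *v fst z) $ k"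

text \<open>Truncation changes the context on a null set only and makes its norm bound hold everywhere.\<close>

definition covariate :: "(real^'p) \<times> (real^'d) \<Rightarrow> real^'p" where
  "covariate z = (if norm (fst z) \<le> 1 then fst z else 0)"

lemma kappa_pos: "0 < \<kappa>" and sigma_nonneg: "0 \<le> \<sigma>"
  using ols by (auto simp: bounded_design_ols_def Let_def)

lemma AE_norm_le: "AE z in P. norm (fst z) \<le> 1"
  using ols by (simp add: bounded_design_ols_def Let_def)

lemma matrix_vector_measurable [measurable (raw)]:
  fixes M :: "real^'b^'a" and f :: "'x \<Rightarrow> real^'b"
  assumes "f \<in> borel_measurable N" shows "(\<lambda>x. M *v f x) \<in> borel_measurable N"
  by (rule borel_measurable_continuous_on[OF _ assms]) (rule linear_continuous_on[OF matrix_vector_mul_bounded_linear])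

lemma noise_measurable [measurable]: "noise k \<in> borel_measurable P"
  unfolding noise_def by measurable

lemma covariate_measurable [measurable]: "covariate \<in> borel_measurable P"
  unfolding covariate_def by measurable

lemma noise_bounded: obtains B where "AE z in P. \<bar>noise k z\<bar> \<le> B"
proof -
  obtain B where B: "\<And>c. c \<in> C \<Longrightarrow> norm c \<le> B" using C_bounded by (auto simp: bounded_iff)
  have "AE z in P. \<bar>noise k z\<bar> \<le> B + norm c0 + onorm (\<lambda>v. Amu *v v)"
    using cost AE_norm_le
  proof eventually_elim
    case (elim z)
    have on: "norm (Amu *v fst z) \<le> onorm (\<lambda>v. Amu *v v) * norm (fst z)" by (rule onorm) simp
    also have "\<dots> \<le> onorm (\<lambda>v. Amu *v v) * 1"
      using elim(2) by (intro mult_left_mono onorm_pos_le) auto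
    finally have "norm (Amu *v fst z) \<le> onorm (\<lambda>v. Amu *v v)" by simp
    moreover have "\<bar>noise k z\<bar> \<le> norm (snd z - c0 - Amu *v fst z)" unfolding noise_def by (rule component_le_norm_cart)
    moreover have "\<dots> \<le> norm (snd z) + norm c0 + norm (Amu *v fst z)"
      using norm_triangle_ineq4[of "snd z - c0" "Amu *v fst z"] norm_triangle_ineq4[of "snd z" c0] by linarith
    ultimately show ?case using B[OF elim(1)] by linarith
  qed
  then show ?thesis using that by blast
qed

lemma subgaussian: "subgaussian_noise P covariate (noise k) \<sigma>"
proof
  fix l :: real and B :: "(real^'p) set" assume B: "B \<in> sets borel"
  let ?g = "\<lambda>z. exp (l * noise k z)" and ?K = "exp (l\<^sup>2 * \<sigma>\<^sup>2 / 2)"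
  let ?tr = "\<lambda>\<xi> :: real^'p. if norm \<xi> \<le> 1 then \<xi> else 0"
  define S where "S = {z. covariate z \<in> B}"
  have SF: "S \<in> sets (xi_algebra P)"
  proof -
    have "?tr \<in> borel_measurable borel" by measurable
    then have "{\<xi>. ?tr \<xi> \<in> B} \<in> sets borel" using measurable_sets[of ?tr borel borel B] B by (simp add: vimage_def)
    then have "fst -` {\<xi>. ?tr \<xi> \<in> B} \<inter> space P \<in> sets (xi_algebra P)"
      unfolding xi_algebra_def by (rule in_vimage_algebra)
    also have "fst -` {\<xi>. ?tr \<xi> \<in> B} \<inter> space P = S" by (simp add: S_def covariate_def space_P vimage_def)
    finally show ?thesis .
  qed
  then have SP [measurable]: "S \<in> sets P" using subalgebra_xi by (auto simp: subalgebra_def)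
  obtain D where "AE z in P. \<bar>noise k z\<bar> \<le> D" using noise_bounded .
  then have "AE z in P. norm (?g z) \<le> exp (\<bar>l\<bar> * D)"
  proof eventually_elim
    case (elim z)
    have "l * noise k z \<le> \<bar>l\<bar> * \<bar>noise k z\<bar>" using abs_ge_self[of "l * noise k z"] by (simp add: abs_mult)
    also have "\<dots> \<le> \<bar>l\<bar> * D" using elim by (intro mult_left_mono) auto
    finally show ?case by simp
  qed
  then have int: "integrable P ?g" by (rule integrable_const_bound) measurable
  have "norm (axis k 1 :: real^'d) = 1" by simp
  then have "AE z in P. real_cond_exp P (xi_algebra P) (\<lambda>z. exp (l * (axis k 1 \<bullet> (snd z - c0 - Amu *v fst z)))) z \<le> ?K"
    using ols unfolding bounded_design_ols_def Let_def by blast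
  then have ae: "AE z in P. real_cond_exp P (xi_algebra P) ?g z \<le> ?K"
    by (simp add: noise_def inner_axis' algebra_simps)
  have "(\<integral>\<^sup>+ z. indicator B (covariate z) * ennreal (?g z) \<partial>P) = (\<integral>\<^sup>+ z. ennreal (indicator S z * ?g z) \<partial>P)"
    by (intro nn_integral_cong) (simp add: S_def indicator_def)
  also have "\<dots> = ennreal (\<integral>z. indicator S z * ?g z \<partial>P)"
    using integrable_mult_indicator[OF SP int] by (intro nn_integral_eq_integral) (auto simp: indicator_def)
  also have "(\<integral>z. indicator S z * ?g z \<partial>P) = (\<integral>z. indicator S z * real_cond_exp P (xi_algebra P) ?g z \<partial>P)"
    using xi.real_cond_exp_intA[OF int SF] by (simp add: set_lebesgue_integral_def)
  also have "\<dots> \<le> (\<integral>z. indicator S z * ?K \<partial>P)"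
  proof (rule integral_mono_AE)
    show "integrable P (\<lambda>z. indicator S z * real_cond_exp P (xi_algebra P) ?g z)"
      using integrable_mult_indicator[OF SP xi.real_cond_exp_int(1)[OF int]] by simp
    show "integrable P (\<lambda>z. indicator S z * ?K)" by (intro integrable_mult_left) (simp add: emeasure_eq_measure)
    show "AE z in P. indicator S z * real_cond_exp P (xi_algebra P) ?g z \<le> indicator S z * ?K"
      using ae by eventually_elim (auto simp: indicator_def)
  qed
  also have "\<dots> = ?K * measure P S" by simp
  finally have "(\<integral>\<^sup>+ z. indicator B (covariate z) * ennreal (?g z) \<partial>P) \<le> ennreal (?K * measure P S)"
    by (simp add: ennreal_leI)
  also have "\<dots> = ennreal ?K * emeasure P S" by (simp add: ennreal_mult emeasure_eq_measure)
  also have "emeasure P S = (\<integral>\<^sup>+ z. indicator S z \<partial>P)" by simp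
  also have "\<dots> = (\<integral>\<^sup>+ z. indicator B (covariate z) \<partial>P)"
    by (intro nn_integral_cong) (simp add: S_def indicator_def)
  finally show "(\<integral>\<^sup>+ z. indicator B (covariate z) * ennreal (?g z) \<partial>P) \<le> ennreal ?K * (\<integral>\<^sup>+ z. indicator B (covariate z) \<partial>P)" .
qed measurable

lemma second_moment: "\<kappa> * (v \<bullet> v) \<le> (\<integral>z. (covariate z \<bullet> v)\<^sup>2 \<partial>P)"
proof -
  let ?G = "(\<chi> i j. \<integral>z. fst z $ i * fst z $ j \<partial>P) :: real^'p^'p"
  have "0 \<le> v \<bullet> ((?G - \<kappa> *\<^sub>R mat 1) *v v)"
    using ols unfolding bounded_design_ols_def Let_def pos_semidef_mat_def by blast
  then have "\<kappa> * (v \<bullet> v) \<le> v \<bullet> (?G *v v)"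
    by (simp add: matrix_vector_mult_diff_rdistrib scaleR_matrix_vector_assoc[symmetric] inner_diff_right)
  also have "\<dots> = (\<Sum>i\<in>UNIV. \<Sum>j\<in>UNIV. v $ i * v $ j * (\<integral>z. fst z $ i * fst z $ j \<partial>P))"
    by (simp add: inner_vec_def matrix_vector_mult_def sum_distrib_left mult_ac)
  also have "\<dots> = (\<Sum>i\<in>UNIV. \<Sum>j\<in>UNIV. (\<integral>z. v $ i * v $ j * (covariate z $ i * covariate z $ j) \<partial>P))"
  proof (intro sum.cong refl)
    fix i j
    have "AE z in P. fst z $ i * fst z $ j = covariate z $ i * covariate z $ j"
      using AE_norm_le by eventually_elim (simp add: covariate_def)
    then have "(\<integral>z. fst z $ i * fst z $ j \<partial>P) = (\<integral>z. covariate z $ i * covariate z $ j \<partial>P)"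
      by (intro integral_cong_AE) measurable
    then show "v $ i * v $ j * (\<integral>z. fst z $ i * fst z $ j \<partial>P) = (\<integral>z. v $ i * v $ j * (covariate z $ i * covariate z $ j) \<partial>P)"
      by simp
  qed
  also have "\<dots> = (\<integral>z. (\<Sum>i\<in>UNIV. \<Sum>j\<in>UNIV. v $ i * v $ j * (covariate z $ i * covariate z $ j)) \<partial>P)"
  proof -
    have nc: "norm (covariate z) \<le> 1" for z by (simp add: covariate_def)
    have c1: "\<bar>covariate z $ i\<bar> \<le> 1" for z i using component_le_norm_cart[of "covariate z" i] nc[of z] by linarith
    have "norm (covariate z $ i * covariate z $ j) \<le> 1" for z i j
      using mult_mono[OF c1[of z i] c1[of z j]] by (simp add: abs_mult)
    then have int: "integrable P (\<lambda>z. v $ i * v $ j * (covariate z $ i * covariate z $ j))" for i j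
      by (intro integrable_mult_right integrable_const_bound[where B=1]) auto
    then show ?thesis by (simp add: Bochner_Integration.integral_sum Bochner_Integration.integrable_sum)
  qed
  also have "(\<lambda>z. \<Sum>i\<in>UNIV. \<Sum>j\<in>UNIV. v $ i * v $ j * (covariate z $ i * covariate z $ j)) = (\<lambda>z. (covariate z \<bullet> v)\<^sup>2)"
    by (simp add: inner_vec_def power2_eq_square sum_product mult_ac)
  finally show ?thesis .
qed

lemma design: "1 \<le> n \<Longrightarrow> random_design P covariate \<kappa> n"
proof
  show "norm (covariate z) \<le> 1" for z by (simp add: covariate_def)
qed (auto simp: kappa_pos second_moment)

text \<open>For \<open>\<sigma> = 0\<close> the exponential moments at 1 and -1 are at most 1, while \<open>e\<^sup>x + e\<^bsup>-x\<^esup> \<ge> 2\<close> with equality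
  only at 0.\<close>

lemma noise_zero:
  assumes "\<sigma> = 0" shows "AE z in P. noise k z = 0"
proof -
  interpret N: subgaussian_noise P covariate "noise k" \<sigma> by (rule subgaussian)
  have le: "(\<integral>\<^sup>+ z. ennreal (exp (l * noise k z)) \<partial>P) \<le> 1" for l
    using N.sub[of UNIV l] assms emeasure_space_1 by simp
  have "(\<integral>\<^sup>+ z. ennreal (exp (1 * noise k z) + exp (-1 * noise k z) - 2) + 2 \<partial>P) =
      (\<integral>\<^sup>+ z. ennreal (exp (1 * noise k z)) + ennreal (exp (-1 * noise k z)) \<partial>P)"
  proof (intro nn_integral_cong)
    fix z
    have "0 \<le> exp (noise k z) + exp (- noise k z) - 2"
      using exp_ge_add_one_self[of "noise k z"] exp_ge_add_one_self[of "- noise k z"] by linarith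
    then have "ennreal (exp (noise k z) + exp (- noise k z) - 2) + ennreal 2 = ennreal (exp (noise k z) + exp (- noise k z) - 2 + 2)"
      by (intro ennreal_plus[symmetric]) auto
    also have "\<dots> = ennreal (exp (noise k z)) + ennreal (exp (- noise k z))"
      by (subst ennreal_plus[symmetric]) auto
    finally have "ennreal (exp (noise k z) + exp (- noise k z) - 2) + 2 = ennreal (exp (noise k z)) + ennreal (exp (- noise k z))"
      by simp
    then show "ennreal (exp (1 * noise k z) + exp (-1 * noise k z) - 2) + 2 = ennreal (exp (1 * noise k z)) + ennreal (exp (-1 * noise k z))"
      by simp
  qed
  also have "\<dots> = (\<integral>\<^sup>+ z. ennreal (exp (1 * noise k z)) \<partial>P) + (\<integral>\<^sup>+ z. ennreal (exp (-1 * noise k z)) \<partial>P)"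
    by (rule nn_integral_add) measurable
  also have "\<dots> \<le> 1 + 1" by (intro add_mono le)
  finally have "(\<integral>\<^sup>+ z. ennreal (exp (noise k z) + exp (- noise k z) - 2) \<partial>P) + 2 \<le> 2"
    by (subst (asm) nn_integral_add) (auto simp: emeasure_space_1)
  then have "(\<integral>\<^sup>+ z. ennreal (exp (noise k z) + exp (- noise k z) - 2) \<partial>P) = 0"
    using ennreal_add_left_cancel_le[of 2 _ 0] by (simp add: add.commute)
  then have "AE z in P. ennreal (exp (noise k z) + exp (- noise k z) - 2) = 0"
    by (subst (asm) nn_integral_0_iff_AE) measurable
  then show ?thesis
  proof eventually_elim
    case (elim z)
    then have le2: "exp (noise k z) + exp (- noise k z) \<le> 2" by (simp add: ennreal_eq_0_iff)
    have "exp (noise k z) \<le> 1 + 0 \<and> 1 + 0 \<le> exp (noise k z)"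
    proof -
      have "(exp (noise k z) - 1)\<^sup>2 = exp (noise k z) * (exp (noise k z) + exp (- noise k z) - 2)"
        by (simp add: power2_eq_square algebra_simps exp_minus)
      also have "\<dots> \<le> 0" using le2 by (intro mult_nonneg_nonpos) auto
      finally show ?thesis by simp
    qed
    then show "noise k z = 0" by simp
  qed
qed

lemma AE_sample:
  fixes n :: nat
  shows "AE z in P. Q z \<Longrightarrow> AE z in PiM {1..n} (\<lambda>_. P). \<forall>i\<in>{1..n}. Q (z i)"
  by (intro AE_finite_allI AE_PiM_component prob_space_axioms) auto

text \<open>The failure probability is split into \<open>\<delta>/2\<close> for the design and \<open>\<delta>/(2 d)\<close> for each row of the
  estimation error. A row \<open>\<theta>\<close> satisfies \<open>(\<kappa> n / 8) |\<theta>|\<^sup>2 \<le> V(\<theta>) \<le> 4 \<sigma>\<^sup>2 (p + ln (4 d / \<delta>))\<close>, and \<open>8 \<cdot> 4\<close> is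
  the square of \<open>4 sqrt 2\<close>.\<close>

theorem ols_concentration:
  assumes \<delta>: "0 < \<delta>" "\<delta> < 1" and n: "8 / \<kappa> * ln (2 * real CARD('p) / \<delta>) \<le> real n"
  shows "\<exists>E\<in>sets (PiM {1..n} (\<lambda>_. P)). 1 - \<delta> \<le> measure (PiM {1..n} (\<lambda>_. P)) E \<and>
    (\<forall>z\<in>E. \<forall>M. is_ols c0 n z M \<longrightarrow> M = cramer_ols c0 n z \<and>
       (\<forall>\<xi>. norm \<xi> \<le> 1 \<longrightarrow> norm (M *v \<xi> - Amu *v \<xi>) \<le> ols_radius \<sigma> \<kappa> CARD('d) CARD('p) n \<delta>))"
proof -
  let ?M = "PiM {1..n} (\<lambda>_::nat. P)" and ?d = "real CARD('d)" and ?p = "real CARD('p)"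
  interpret M: prob_space ?M by (intro prob_space_PiM prob_space_axioms)
  have dp: "1 \<le> ?d" "1 \<le> ?p" using zero_less_card_finite[where 'a='d] zero_less_card_finite[where 'a='p] by linarith+
  have "\<delta> < 2 * ?p" "\<delta> \<le> 2 * ?d" "\<delta> \<le> 4 * ?d" using \<delta> dp by linarith+
  then have big: "1 < 2 * ?p / \<delta>" "1 \<le> 2 * ?d / \<delta>" "1 \<le> 4 * ?d / \<delta>" using \<delta>(1) by (auto simp: less_divide_eq le_divide_eq)
  have lnp: "0 < ln (2 * ?p / \<delta>)" using big(1) by (rule ln_gt_zero)
  have "0 < 8 / \<kappa> * ln (2 * ?p / \<delta>)" using lnp kappa_pos by simp
  then have n1: "1 \<le> n" using n by (cases n) auto
  interpret D: random_design P covariate \<kappa> n by (rule design[OF n1])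
  interpret N: subgaussian_noise P covariate "noise k" \<sigma> for k by (rule subgaussian)
  let ?K = "2 * ?d / \<delta>"
  have K: "0 < ?K" using \<delta> dp by simp
  have lnK: "0 \<le> ln ?K" using big(2) by (rule ln_ge_zero)
  define E1 where "E1 = D.good_design \<inter> (\<Inter>k. N.good_noise k n ?K)"
  have E1s: "E1 \<in> sets ?M" unfolding E1_def using D.good_design_sets N.good_noise_sets by (intro sets.Int sets.finite_INT) auto
  have ae: "AE z in ?M. \<forall>i\<in>{1..n}. norm (fst (z i)) \<le> 1 \<and> (\<sigma> = 0 \<longrightarrow> (\<forall>k. noise k (z i) = 0))"
  proof (rule AE_sample)
    have "AE z in P. \<sigma> = 0 \<longrightarrow> noise k z = 0" for k using noise_zero by (cases "\<sigma> = 0") auto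
    then have "AE z in P. \<forall>k\<in>UNIV. \<sigma> = 0 \<longrightarrow> noise k z = 0" by (intro AE_finite_allI) auto
    then show "AE z in P. norm (fst z) \<le> 1 \<and> (\<sigma> = 0 \<longrightarrow> (\<forall>k. noise k z = 0))"
      using AE_norm_le by eventually_elim auto
  qed
  then obtain B where B: "{z\<in>space ?M. \<not> (\<forall>i\<in>{1..n}. norm (fst (z i)) \<le> 1 \<and> (\<sigma> = 0 \<longrightarrow> (\<forall>k. noise k (z i) = 0)))} \<subseteq> B"
      "emeasure ?M B = 0" "B \<in> sets ?M" by (rule AE_E)
  define E where "E = E1 - B"
  have Es: "E \<in> sets ?M" using E1s B(3) by (simp add: E_def)
  have "measure ?M (space ?M - E1) \<le> measure ?M (space ?M - D.good_design) + measure ?M (\<Union>k. space ?M - N.good_noise k n ?K)"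
  proof -
    have "space ?M - E1 = (space ?M - D.good_design) \<union> (\<Union>k. space ?M - N.good_noise k n ?K)" by (auto simp: E1_def)
    moreover have "(\<Union>k. space ?M - N.good_noise k n ?K) \<in> sets ?M"
      using N.good_noise_sets by (intro sets.finite_UN sets.compl_sets) auto
    ultimately show ?thesis using measure_Un_le[OF sets.compl_sets[OF D.good_design_sets]] by simp
  qed
  also have "measure ?M (space ?M - D.good_design) \<le> \<delta> / 2"
  proof -
    have "ln (2 * ?p / \<delta>) \<le> \<kappa> * real n / 8" using n kappa_pos by (simp add: field_simps)
    then have "exp (- \<kappa> * real n / 8) \<le> exp (- ln (2 * ?p / \<delta>))" by simp
    also have "\<dots> = \<delta> / (2 * ?p)" using \<delta> dp by (simp add: exp_minus)
    finally have "?p * exp (- \<kappa> * real n / 8) \<le> ?p * (\<delta> / (2 * ?p))" using dp by (intro mult_left_mono) auto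
    also have "\<dots> = \<delta> / 2" using dp by simp
    finally show ?thesis using D.good_design_prob M.prob_compl[OF D.good_design_sets] by simp
  qed
  also have "measure ?M (\<Union>k. space ?M - N.good_noise k n ?K) \<le> \<delta> / 2"
  proof -
    have "measure ?M (\<Union>k. space ?M - N.good_noise k n ?K) \<le> (\<Sum>k\<in>UNIV. measure ?M (space ?M - N.good_noise k n ?K))"
      using N.good_noise_sets by (intro M.finite_measure_subadditive_finite) auto
    also have "\<dots> \<le> (\<Sum>k\<in>(UNIV :: 'd set). 1 / ?K)"
    proof (intro sum_mono)
      fix k
      show "measure ?M (space ?M - N.good_noise k n ?K) \<le> 1 / ?K"
        using N.good_noise_prob[OF K, of n k] M.prob_compl[OF N.good_noise_sets[of k n ?K]] by linarith
    qed
    also have "\<dots> = \<delta> / 2" using dp \<delta> by simp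
    finally show ?thesis .
  qed
  finally have "measure ?M (space ?M - E1) \<le> \<delta>" by simp
  then have "1 - \<delta> \<le> measure ?M E1" using M.prob_compl[OF E1s] by simp
  also have "measure ?M E1 = measure ?M E"
    unfolding E_def using B by (intro measure_Diff_null_set[symmetric] E1s) auto
  finally have prob: "1 - \<delta> \<le> measure ?M E" .
  have main: "M = cramer_ols c0 n z \<and> (norm \<xi> \<le> 1 \<longrightarrow> norm (M *v \<xi> - Amu *v \<xi>) \<le> ols_radius \<sigma> \<kappa> CARD('d) CARD('p) n \<delta>)"
    if z: "z \<in> E" and M: "is_ols c0 n z M" for z M \<xi>
  proof -
    have zs: "z \<in> space ?M" using z sets.sets_into_space[OF Es] by auto
    have "z \<notin> B" using z by (simp add: E_def)
    then have zB: "norm (fst (z i)) \<le> 1 \<and> (\<sigma> = 0 \<longrightarrow> (\<forall>k. noise k (z i) = 0))" if "i \<in> {1..n}" for i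
      using B(1) zs that by blast
    then have cov: "covariate (z i) = fst (z i)" if "i \<in> {1..n}" for i using that by (auto simp: covariate_def)
    let ?a = "\<kappa> * real n / 8"
    have a: "0 < ?a" using kappa_pos n1 by simp
    have low: "?a * (v \<bullet> v) \<le> (\<Sum>i=1..n. (covariate (z i) \<bullet> v)\<^sup>2)" for v
      by (rule D.good_design_lower) (use z in \<open>simp add: E_def E1_def\<close>)
    also have "(\<Sum>i=1..n. (covariate (z i) \<bullet> v)\<^sup>2) = (\<Sum>i=1..n. (fst (z i) \<bullet> v)\<^sup>2)" for v
      using cov by (intro sum.cong) auto
    finally have lowf: "?a * (v \<bullet> v) \<le> (\<Sum>i=1..n. (fst (z i) \<bullet> v)\<^sup>2)" for v .
    define \<theta> where "\<theta> = (\<lambda>k. M $ k - Amu $ k)"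
    have normal: "(\<Sum>i=1..n. (covariate (z i) \<bullet> \<theta> k) * (covariate (z i) \<bullet> w)) = (\<Sum>i=1..n. (covariate (z i) \<bullet> w) * noise k (z i))" for k w
    proof -
      have "(\<Sum>i=1..n. (covariate (z i) \<bullet> w) * noise k (z i)) - (\<Sum>i=1..n. (covariate (z i) \<bullet> \<theta> k) * (covariate (z i) \<bullet> w))
          = (\<Sum>i=1..n. (fst (z i) \<bullet> w) * (snd (z i) - c0 - M *v fst (z i)) $ k)"
        unfolding sum_subtractf[symmetric]
        by (intro sum.cong refl) (simp add: cov noise_def \<theta>_def matrix_vector_mul_component inner_diff_left
            inner_diff_right inner_commute[of "fst _" "_ $ k"] algebra_simps)
      then show ?thesis using normal_equations[OF M, of w k] by simp
    qed
    have bound: "N.form n (\<lambda>i. covariate (z i)) (\<theta> k) \<le> 4 * \<sigma>\<^sup>2 * (ln ?K + ?p / 2 * ln 2)" for k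
    proof (cases "\<sigma> = 0")
      case True
      then have "(\<Sum>i=1..n. (covariate (z i) \<bullet> \<theta> k) * (covariate (z i) \<bullet> \<theta> k)) = 0"
        unfolding normal using zB by (intro sum.neutral) auto
      then show ?thesis using True by (simp add: N.form_def power2_eq_square)
    next
      case False
      have "N.form n (\<lambda>i. covariate (z i)) (\<theta> k) \<le> 4 * \<sigma>\<^sup>2 * (ln ?K + real DIM(real^'p) / 2 * ln 2)"
      proof (rule N.good_noise_bound[OF _ K _ a])
        show "z \<in> N.good_noise k n ?K" using z by (auto simp: E_def E1_def)
        show "0 < \<sigma>" using False sigma_nonneg by simp
        show "?a * (v \<bullet> v) \<le> N.form n (\<lambda>i. covariate (z i)) v" for v using low by (simp add: N.form_def)
      qed (rule normal)
      then show ?thesis by simp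
    qed
    have le1: "ln ?K + ?p / 2 * ln 2 \<le> ?p + ln (4 * ?d / \<delta>)"
    proof -
      have "ln ?K \<le> ln (4 * ?d / \<delta>)" using \<delta> dp by (intro ln_mono) (auto simp: divide_right_mono)
      moreover have "?p / 2 * ln 2 \<le> ?p / 2 * 1" using dp ln_2_less_1 by (intro mult_left_mono) auto
      ultimately show ?thesis using dp by linarith
    qed
    have \<theta>n: "(norm (\<theta> k))\<^sup>2 \<le> 32 * \<sigma>\<^sup>2 / (\<kappa> * real n) * (?p + ln (4 * ?d / \<delta>))" for k
    proof -
      have "?a * (norm (\<theta> k))\<^sup>2 \<le> 4 * \<sigma>\<^sup>2 * (ln ?K + ?p / 2 * ln 2)"
        using low[of "\<theta> k"] bound[of k] by (simp add: N.form_def power2_norm_eq_inner)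
      also have "\<dots> \<le> 4 * \<sigma>\<^sup>2 * (?p + ln (4 * ?d / \<delta>))" using le1 by (intro mult_left_mono) auto
      finally show ?thesis using kappa_pos n1 by (simp add: field_simps)
    qed
    have "norm (M *v \<xi> - Amu *v \<xi>) \<le> ols_radius \<sigma> \<kappa> CARD('d) CARD('p) n \<delta>" if \<xi>: "norm \<xi> \<le> 1"
    proof -
      let ?r = "ols_radius \<sigma> \<kappa> CARD('d) CARD('p) n \<delta>"
      have "(norm (M *v \<xi> - Amu *v \<xi>))\<^sup>2 = (\<Sum>k\<in>UNIV. (\<theta> k \<bullet> \<xi>)\<^sup>2)"
      proof -
        have "(norm v)\<^sup>2 = (\<Sum>k\<in>UNIV. (v $ k)\<^sup>2)" for v :: "real^'d"
          unfolding power2_norm_eq_inner inner_vec_def inner_real_def by (simp only: power2_eq_square)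
        moreover have "(M *v \<xi> - Amu *v \<xi>) $ k = \<theta> k \<bullet> \<xi>" for k
          by (simp add: matrix_vector_mul_component \<theta>_def inner_diff_left)
        ultimately show ?thesis by simp
      qed
      also have "\<dots> \<le> (\<Sum>k\<in>(UNIV :: 'd set). 32 * \<sigma>\<^sup>2 / (\<kappa> * real n) * (?p + ln (4 * ?d / \<delta>)))"
      proof (intro sum_mono)
        fix k
        have "(\<theta> k \<bullet> \<xi>)\<^sup>2 \<le> (\<theta> k \<bullet> \<theta> k) * (\<xi> \<bullet> \<xi>)" by (rule Cauchy_Schwarz_ineq)
        also have "\<dots> \<le> (\<theta> k \<bullet> \<theta> k) * 1" using \<xi> by (intro mult_left_mono) (auto simp: norm_eq_sqrt_inner)
        finally show "(\<theta> k \<bullet> \<xi>)\<^sup>2 \<le> 32 * \<sigma>\<^sup>2 / (\<kappa> * real n) * (?p + ln (4 * ?d / \<delta>))"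
          using \<theta>n[of k] by (simp add: power2_norm_eq_inner)
      qed
      also have "\<dots> = ?r\<^sup>2"
      proof -
        have "0 \<le> ln (4 * ?d / \<delta>)" using big(3) by (rule ln_ge_zero)
        then have "0 \<le> ?d * (?p + ln (4 * ?d / \<delta>)) / real n" using dp by simp
        then show ?thesis using kappa_pos
          by (simp add: ols_radius_def power_mult_distrib power_divide field_simps)
      qed
      finally show ?thesis
      proof (rule power2_le_imp_le)
        show "0 \<le> ?r" using kappa_pos sigma_nonneg dp \<delta> by (intro ols_radius_nonneg) auto
      qed
    qed
    then show ?thesis using ols_eq_cramer[OF M a lowf] by blast
  qed
  show ?thesis using Es prob main by blast
qed

lemma cond_mean_linear:
  assumes mu: "is_cond_mean P mu"
  shows "AE \<xi> in xi_law P. mu \<xi> = c0 + Amu *v \<xi>"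
proof -
  have [measurable]: "mu \<in> borel_measurable borel" using mu by (simp add: is_cond_mean_def)
  let ?F = "xi_algebra P"
  have comp: "AE z in P. mu (fst z) $ k = (c0 + Amu *v fst z) $ k" for k
  proof -
    let ?l = "\<lambda>z. (c0 + Amu *v fst z) $ k"
    obtain B where "AE z in P. \<bar>noise k z\<bar> \<le> B" using noise_bounded .
    then have in1: "integrable P (noise k)" by (intro integrable_const_bound[where B=B]) auto
    have in2: "integrable P ?l"
    proof -
      have "?l = (\<lambda>z. snd z $ k - noise k z)" by (simp add: noise_def fun_eq_iff)
      then show ?thesis using snd_component_integrable[of k] in1 by simp
    qed
    have lF: "?l \<in> borel_measurable ?F" by (rule xi_measurable[of "\<lambda>\<xi>. (c0 + Amu *v \<xi>) $ k"]) measurable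
    have "AE z in P. real_cond_exp P ?F (\<lambda>z. noise k z + ?l z) z = real_cond_exp P ?F (noise k) z + real_cond_exp P ?F ?l z"
      by (rule xi.real_cond_exp_add[OF in1 in2])
    moreover have "(\<lambda>z. noise k z + ?l z) = (\<lambda>z. snd z $ k)" by (simp add: noise_def fun_eq_iff)
    moreover have "AE z in P. real_cond_exp P ?F ?l z = ?l z" by (rule xi.real_cond_exp_F_meas[OF in2 lF])
    moreover have "AE z in P. real_cond_exp P ?F (noise k) z = 0"
      using ols unfolding bounded_design_ols_def Let_def noise_def[abs_def] by blast
    moreover have "AE z in P. real_cond_exp P ?F (\<lambda>z. snd z $ k) z = mu (fst z) $ k"
      using mu by (simp add: is_cond_mean_def)
    ultimately show ?thesis by (auto elim: AE_mp)
  qed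
  have "AE z in P. \<forall>k\<in>UNIV. mu (fst z) $ k = (c0 + Amu *v fst z) $ k" by (intro AE_finite_allI comp) auto
  then have "AE z in P. mu (fst z) = c0 + Amu *v fst z" by eventually_elim (simp add: vec_eq_iff)
  moreover have "{\<xi>. mu \<xi> = c0 + Amu *v \<xi>} \<in> sets borel"
  proof -
    have "{\<xi>\<in>space borel. mu \<xi> = c0 + Amu *v \<xi>} \<in> sets borel" by measurable
    then show ?thesis by simp
  qed
  ultimately show ?thesis by (subst AE_xi_iff)
qed

end


section \<open>Discovery as a stable online scheme\<close>

context strict_discovery
begin

text \<open>Costs outside \<open>C\<close>, where the loop need not terminate, are skipped and count as resolved. This makes
  the step total and measurable; almost every pseudo-cost lies in \<open>C\<close>.\<close>

definition discovery_step :: "real^'d \<Rightarrow> (real^'d) set \<Rightarrow> (real^'d) set" where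
  "discovery_step c D = (if c \<in> C then alg1 A b C R c D else D)"

definition resolved :: "(real^'d) set \<Rightarrow> (real^'d) set" where
  "resolved D = {c. c \<in> C \<longrightarrow> sufficient A b C D c}"

primrec discovery_run :: "(nat \<Rightarrow> real^'d) \<Rightarrow> nat \<Rightarrow> (real^'d) set" where
  "discovery_run cs 0 = {}"
| "discovery_run cs (Suc i) = discovery_step (cs (Suc i)) (discovery_run cs i)"

definition discovery_updates :: "nat \<Rightarrow> (nat \<Rightarrow> real^'d) \<Rightarrow> nat set" where
  "discovery_updates n cs = {i\<in>{1..n}. discovery_run cs i \<noteq> discovery_run cs (i - 1)}"

lemma C_borel: "C \<in> sets borel" using compact_C by (simp add: borel_compact)

lemma discovery_step_datasets: "D \<in> datasets \<Longrightarrow> discovery_step c D \<in> datasets"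
  using alg1[of c D] by (auto simp: discovery_step_def)

lemma discovery_step_superset: "D \<in> datasets \<Longrightarrow> D \<subseteq> discovery_step c D"
  using alg1[of c D] by (auto simp: discovery_step_def)

lemma discovery_run_datasets: "discovery_run cs i \<in> datasets"
  by (induction i) (auto simp: empty_dataset discovery_step_datasets)

lemma discovery_step_measurable:
  assumes D: "D \<in> datasets"
  shows "(\<lambda>c. discovery_step c D) \<in> measurable borel (count_space datasets)"
  unfolding discovery_step_def
proof (rule measurable_If_restrict_space_iff[THEN iffD2])
  show "{c \<in> space borel. c \<in> C} \<in> sets borel" using C_borel by simp
  have "(\<lambda>c. D) \<in> measurable (restrict_space borel {c. c \<notin> C}) (count_space datasets)"
    by (rule measurable_const) (simp add: D)
  then show "(\<lambda>c. alg1 A b C R c D) \<in> measurable (restrict_space borel {c. c \<in> C}) (count_space datasets) \<and>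
      (\<lambda>c. D) \<in> measurable (restrict_space borel {c. c \<notin> C}) (count_space datasets)"
    using alg1_measurable[OF D] by simp
qed

lemma resolved_borel: "resolved D \<in> sets borel"
proof -
  have "{c \<in> C. sufficient A b C D c} \<in> sets costM"
    using sufficient_measurable[of D] by (simp add: pred_def space_costM)
  then have "{c \<in> C. sufficient A b C D c} \<in> sets borel"
    using C_borel by (simp add: sets_restrict_space_iff)
  then have "- C \<union> {c \<in> C. sufficient A b C D c} \<in> sets borel" using C_borel by auto
  also have "- C \<union> {c \<in> C. sufficient A b C D c} = resolved D" by (auto simp: resolved_def)
  finally show ?thesis .
qed

lemma resolved_fixed: "D \<in> datasets \<Longrightarrow> discovery_step c D = D \<Longrightarrow> c \<in> resolved D"
  using alg1_sufficient[of c D] by (auto simp: resolved_def discovery_step_def)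

lemma resolved_mono: "D \<subseteq> D' \<Longrightarrow> resolved D \<subseteq> resolved D'"
  using sufficient_mono by (auto simp: resolved_def)

lemma online_scheme:
  assumes Q: "prob_space Q" and g: "g \<in> borel_measurable Q"
  shows "online_scheme Q datasets {} (\<lambda>x. discovery_step (g x)) (\<lambda>D. {x \<in> space Q. g x \<in> resolved D})"
proof -
  interpret prob_space Q by fact
  show ?thesis
  proof
    fix D assume D: "D \<in> datasets"
    show "(\<lambda>x. discovery_step (g x) D) \<in> measurable Q (count_space datasets)"
      by (rule measurable_compose[OF g discovery_step_measurable[OF D]])
    show "{x \<in> space Q. g x \<in> resolved D} \<in> sets Q"
      using measurable_sets[OF g resolved_borel[of D]] by (simp add: vimage_def Int_def conj_commute)
    show "{y \<in> space Q. g y \<in> resolved D} \<subseteq> {y \<in> space Q. g y \<in> resolved (discovery_step (g x) D)}" for x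
      using resolved_mono[OF discovery_step_superset[OF D]] by auto
  qed (use finite_datasets empty_dataset discovery_step_datasets resolved_fixed in auto)
qed

lemma card_discovery_updates_le: "card (discovery_updates n cs) \<le> card (discovery_run cs n)"
proof (induction n)
  case (Suc n)
  have fin: "finite (discovery_run cs (Suc n))" using dataset_card[OF discovery_run_datasets] by blast
  have sub: "discovery_run cs n \<subseteq> discovery_run cs (Suc n)" using discovery_step_superset[OF discovery_run_datasets] by simp
  show ?case
  proof (cases "discovery_run cs (Suc n) = discovery_run cs n")
    case True
    then have "discovery_updates (Suc n) cs = discovery_updates n cs" by (auto simp: discovery_updates_def le_Suc_eq)
    then show ?thesis using Suc True by simp
  next
    case False
    have "discovery_updates (Suc n) cs \<subseteq> insert (Suc n) (discovery_updates n cs)" by (auto simp: discovery_updates_def le_Suc_eq)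
    then have "card (discovery_updates (Suc n) cs) \<le> card (insert (Suc n) (discovery_updates n cs))"
      by (intro card_mono) (auto simp: discovery_updates_def)
    also have "\<dots> \<le> Suc (card (discovery_updates n cs))" by (rule card_insert_le_m1) auto
    also have "\<dots> \<le> Suc (card (discovery_run cs n))" using Suc by simp
    also have "\<dots> \<le> card (discovery_run cs (Suc n))" 
    proof -
      have "discovery_run cs n \<subset> discovery_run cs (Suc n)" using sub False by (metis psubsetI)
      from psubset_card_mono[OF fin this] show ?thesis by simp
    qed
    finally show ?thesis .
  qed
qed (simp add: discovery_updates_def)

lemma discovery_run_card_le: "card (discovery_run cs n) \<le> dstar A b C"
  using dataset_card[OF discovery_run_datasets] by blast

lemma discovery_run_eq_alg2:
  assumes "\<And>j. j \<in> {1..n} \<Longrightarrow> cs j \<in> C"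
  shows "alg2 A b C R cs n = (discovery_run cs n, discovery_updates n cs)"
proof -
  have st: "alg2_state A b C R cs i = discovery_run cs i" if "i \<le> n" for i
    using that by (induction i) (auto simp: discovery_step_def assms)
  have "alg2_state A b C R cs (i - 1) = discovery_run cs (i - 1)" if "i \<in> {1..n}" for i using st[of "i - 1"] that by auto
  then show ?thesis using st by (auto simp: alg2_def discovery_updates_def)
qed

lemma discovery_run_measurable:
  assumes "\<And>j. j \<in> {1..n} \<Longrightarrow> (\<lambda>\<omega>. cs \<omega> j) \<in> borel_measurable M" and "i \<le> n"
  shows "(\<lambda>\<omega>. discovery_run (cs \<omega>) i) \<in> measurable M (count_space datasets)"
  using assms(2)
proof (induction i)
  case (Suc i)
  then have IH: "(\<lambda>\<omega>. discovery_run (cs \<omega>) i) \<in> measurable M (count_space datasets)" by simp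
  have "(\<lambda>\<omega>. discovery_step (cs \<omega> (Suc i)) D) \<in> measurable M (count_space datasets)" if "D \<in> datasets" for D
    using Suc.prems by (intro measurable_compose[OF assms(1) discovery_step_measurable[OF that]]) auto
  from measurable_compose_countable'[of datasets "\<lambda>D \<omega>. discovery_step (cs \<omega> (Suc i)) D", OF this IH] show ?case
    using finite_datasets by (simp add: countable_finite)
qed (simp add: empty_dataset)

lemma card_discovery_updates_measurable:
  assumes "\<And>j. j \<in> {1..n} \<Longrightarrow> (\<lambda>\<omega>. cs \<omega> j) \<in> borel_measurable M"
  shows "(\<lambda>\<omega>. card (discovery_updates n (cs \<omega>))) \<in> measurable M (count_space UNIV)"
proof -
  have card: "card (discovery_updates n cs') = (\<Sum>i\<in>{1..n}. if discovery_run cs' i \<noteq> discovery_run cs' (i - 1) then 1 else 0)" for cs'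
    by (simp add: discovery_updates_def sum.If_cases Int_def)
  have "Measurable.pred M (\<lambda>\<omega>. discovery_run (cs \<omega>) i \<noteq> discovery_run (cs \<omega>) (i - 1))" if i: "i \<in> {1..n}" for i
  proof -
    have m1: "(\<lambda>\<omega>. discovery_run (cs \<omega>) i) \<in> measurable M (count_space datasets)"
      and m2: "(\<lambda>\<omega>. discovery_run (cs \<omega>) (i - 1)) \<in> measurable M (count_space datasets)"
      using i by (auto intro!: discovery_run_measurable[of n] assms)
    have "{\<omega> \<in> space M. discovery_run (cs \<omega>) i \<noteq> discovery_run (cs \<omega>) (i - 1)} =
        (\<Union>D\<in>datasets. ((\<lambda>\<omega>. discovery_run (cs \<omega>) i) -` {D} \<inter> space M) - ((\<lambda>\<omega>. discovery_run (cs \<omega>) (i - 1)) -` {D} \<inter> space M))"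
      using discovery_run_datasets by auto
    also have "\<dots> \<in> sets M"
      by (intro sets.finite_UN finite_datasets sets.Diff measurable_sets[OF m1] measurable_sets[OF m2]) auto
    finally show ?thesis by (simp add: pred_def)
  qed
  then have "(\<lambda>\<omega>. \<Sum>i\<in>{1..n}. if discovery_run (cs \<omega>) i \<noteq> discovery_run (cs \<omega>) (i - 1) then 1 else 0 :: nat) \<in> measurable M (count_space UNIV)"
    by (intro measurable_sum_nat measurable_If) (auto simp: pred_def)
  then show ?thesis unfolding card .
qed

text \<open>The parameter \<open>z\<close> stands for the regression sample. The compression bound holds for each fixed \<open>z\<close>;
  joint measurability of the bad event lets it be integrated over \<open>z\<close>.\<close>

lemma discovery_bound:
  assumes N: "prob_space N" and Q: "prob_space Q" and n: "1 \<le> n" and \<delta>: "0 < \<delta>" "\<delta> < 1"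
    and g [measurable]: "(\<lambda>(z, x). g z x) \<in> borel_measurable (N \<Otimes>\<^sub>M Q)"
  shows "\<exists>Bad\<in>sets (N \<Otimes>\<^sub>M PiM {1..n} (\<lambda>_. Q)). measure (N \<Otimes>\<^sub>M PiM {1..n} (\<lambda>_. Q)) Bad \<le> \<delta> \<and>
    (\<forall>z y. (z, y) \<in> space (N \<Otimes>\<^sub>M PiM {1..n} (\<lambda>_. Q)) - Bad \<longrightarrow>
       measure Q {x \<in> space Q. g z x \<notin> resolved (discovery_run (\<lambda>j. g z (y j)) n)}
         \<le> 4 / real n * (6 * real (card (discovery_updates n (\<lambda>j. g z (y j)))) + ln (exp 1 / \<delta>)))"
proof -
  interpret N: prob_space N by fact
  interpret Q: prob_space Q by fact
  let ?Y = "PiM {1..n} (\<lambda>_::nat. Q)"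
  interpret Y: prob_space ?Y by (intro prob_space_PiM Q)
  interpret S: pair_prob_space N ?Y by standard
  let ?S = "N \<Otimes>\<^sub>M ?Y"
  let ?cs = "\<lambda>\<omega> j. g (fst \<omega>) (snd \<omega> j)"
  have csm: "(\<lambda>\<omega>. ?cs \<omega> j) \<in> borel_measurable ?S" if "j \<in> {1..n}" for j
  proof -
    have "(\<lambda>\<omega>. (fst \<omega>, snd \<omega> j)) \<in> measurable ?S (N \<Otimes>\<^sub>M Q)"
      using that by (intro measurable_Pair measurable_fst measurable_compose[OF measurable_snd measurable_component_singleton])
    from measurable_compose[OF this g] show ?thesis by simp
  qed
  define thr where "thr = (\<lambda>k::nat. 4 / real n * (6 * real k + ln (exp 1 / \<delta>)))"
  define ms where "ms = (\<lambda>z D. measure Q {x \<in> space Q. g z x \<notin> resolved D})"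
  have msm: "(\<lambda>z. ms z D) \<in> borel_measurable N" for D
  proof -
    let ?B = "{\<omega> \<in> space (N \<Otimes>\<^sub>M Q). (\<lambda>(z, x). g z x) \<omega> \<notin> resolved D}"
    have "?B \<in> sets (N \<Otimes>\<^sub>M Q)"
      using measurable_sets[OF g, of "- resolved D"] resolved_borel[of D] by (simp add: vimage_def Int_def conj_commute borel_comp)
    then have "(\<lambda>z. enn2real (emeasure Q (Pair z -` ?B))) \<in> borel_measurable N"
      by (intro borel_measurable_enn2real Q.measurable_emeasure_Pair)
    then have "(\<lambda>z. measure Q (Pair z -` ?B)) \<in> borel_measurable N" by (simp add: measure_def)
    moreover have "ms z D = measure Q (Pair z -` ?B)" if "z \<in> space N" for z
      unfolding ms_def using that by (intro arg_cong[where f="measure Q"]) (auto simp: space_pair_measure)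
    ultimately show ?thesis by (subst measurable_cong) auto
  qed
  define Bad where "Bad = {\<omega> \<in> space ?S. thr (card (discovery_updates n (?cs \<omega>))) < ms (fst \<omega>) (discovery_run (?cs \<omega>) n)}"
  have Bad: "Bad \<in> sets ?S"
  proof -
    have m1: "(\<lambda>\<omega>. thr (card (discovery_updates n (?cs \<omega>)))) \<in> borel_measurable ?S"
      by (rule measurable_compose[OF card_discovery_updates_measurable[OF csm]]) auto
    have m2: "(\<lambda>\<omega>. ms (fst \<omega>) (discovery_run (?cs \<omega>) n)) \<in> borel_measurable ?S"
    proof (rule measurable_compose_countable'[of datasets "\<lambda>D \<omega>. ms (fst \<omega>) D"])
      show "(\<lambda>\<omega>. ms (fst \<omega>) D) \<in> borel_measurable ?S" for D by (rule measurable_compose[OF measurable_fst msm])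
      show "(\<lambda>\<omega>. discovery_run (?cs \<omega>) n) \<in> measurable ?S (count_space datasets)" by (rule discovery_run_measurable[OF csm order.refl])
    qed (use finite_datasets countable_finite in auto)
    show ?thesis unfolding Bad_def using m1 m2 by (rule borel_measurable_less)
  qed
  have slice: "emeasure ?Y (Pair z -` Bad) \<le> ennreal \<delta>" if z: "z \<in> space N" for z
  proof -
    have gz: "g z \<in> borel_measurable Q" using measurable_compose[OF measurable_Pair1'[OF z] g] by simp
    interpret O: online_scheme Q datasets "{}" "\<lambda>x. discovery_step (g z x)" "\<lambda>D. {x \<in> space Q. g z x \<in> resolved D}"
      by (rule online_scheme[OF Q gz])
    have run: "O.run UNIV y i = discovery_run (\<lambda>j. g z (y j)) i" for y i by (induction i) auto
    then have upd: "O.updates n y = discovery_updates n (\<lambda>j. g z (y j))" for y by (simp add: O.updates_def discovery_updates_def)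
    have miss: "O.miss D = ms z D" for D
      unfolding O.miss_def ms_def by (intro arg_cong[where f="measure Q"]) auto
    obtain Z where Z: "Z \<in> sets ?Y" "measure ?Y Z \<le> \<delta>"
      "\<And>y. y \<in> space ?Y \<Longrightarrow> O.threshold n \<delta> (card (O.updates n y)) < O.miss (O.run UNIV y n) \<Longrightarrow> y \<in> Z"
      by (rule O.compression_bound[OF n \<delta>]) auto
    have "Pair z -` Bad \<subseteq> Z"
      using Z(3) by (auto simp: Bad_def run upd miss O.threshold_def thr_def space_pair_measure)
    then have "emeasure ?Y (Pair z -` Bad) \<le> emeasure ?Y Z" using Z(1) by (rule emeasure_mono)
    also have "\<dots> \<le> ennreal \<delta>" unfolding Y.emeasure_eq_measure using Z(2) by (rule ennreal_leI)
    finally show ?thesis .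
  qed
  have "emeasure ?S Bad = (\<integral>\<^sup>+ z. emeasure ?Y (Pair z -` Bad) \<partial>N)"
    by (rule Y.emeasure_pair_measure_alt[OF Bad])
  also have "\<dots> \<le> (\<integral>\<^sup>+ z. ennreal \<delta> \<partial>N)" by (intro nn_integral_mono slice)
  also have "\<dots> = ennreal \<delta>" by (simp add: N.emeasure_space_1)
  finally have "ennreal (measure ?S Bad) \<le> ennreal \<delta>" unfolding S.emeasure_eq_measure .
  then have "measure ?S Bad \<le> \<delta>" using \<delta> by simp
  moreover have "measure Q {x \<in> space Q. g z x \<notin> resolved (discovery_run (\<lambda>j. g z (y j)) n)}
         \<le> 4 / real n * (6 * real (card (discovery_updates n (\<lambda>j. g z (y j)))) + ln (exp 1 / \<delta>))"
    if "(z, y) \<in> space ?S" "(z, y) \<notin> Bad" for z y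
    using that by (simp add: Bad_def thr_def ms_def not_less)
  ultimately show ?thesis using Bad by (intro bexI[of _ Bad]) auto
qed

end

section \<open>Measurability of linear predictors\<close>

lemma lift_measurable:
  fixes Sig :: "real^'d^'d"
  assumes [measurable]: "\<And>j. (\<lambda>x. s x j) \<in> borel_measurable M"
  shows "(\<lambda>x. lift Sig U t (s x)) \<in> borel_measurable M"
proof -
  define H where "H = mat_inv_upto t (\<lambda>i j. U i \<bullet> (Sig *v U j))"
  have "(\<lambda>x. \<Sum>i<t. (\<Sum>j<t. H i j * s x j) *\<^sub>R U i) \<in> borel_measurable M" by measurable
  then have "(\<lambda>x. Sig *v (\<Sum>i<t. (\<Sum>j<t. H i j * s x j) *\<^sub>R U i)) \<in> borel_measurable M"
    by (rule borel_measurable_continuous_on[OF linear_continuous_on[OF matrix_vector_mul_bounded_linear]])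
  then show ?thesis by (simp add: lift_def Let_def H_def)
qed

lemma lifted_class_measurable: "f \<in> lifted_class c0 Sig U t \<Longrightarrow> f \<in> borel_measurable borel"
  unfolding lifted_class_def by (auto intro!: borel_measurable_add lift_measurable)

lemma lifted_predictor_in_class:
  "lifted_predictor c0 Sig U t (\<lambda>\<xi>. c0 + M *v \<xi>) \<in> lifted_class c0 Sig U t"
proof -
  have "lifted_predictor c0 Sig U t (\<lambda>\<xi>. c0 + M *v \<xi>) = (\<lambda>\<xi>. c0 + lift Sig U t (\<lambda>i. (U i v* M) \<bullet> \<xi>))"
    by (simp add: fun_eq_iff lifted_predictor_def dot_lmul_matrix)
  then show ?thesis unfolding lifted_class_def by (intro CollectI exI[of _ "\<lambda>i. U i v* M"])
qed

lemma cramer_predictor_measurable: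
  fixes P :: "((real^'p) \<times> (real^'d)) measure"
  assumes P: "sets P = sets borel" and Q: "sets Q = sets borel"
  shows "(\<lambda>(z, \<xi>). c0 + cramer_ols c0 n z *v \<xi>) \<in> borel_measurable (PiM {1..n} (\<lambda>_. P) \<Otimes>\<^sub>M Q)"
  unfolding case_prod_unfold
proof (rule borel_measurable_vecI)
  fix k
  let ?N = "PiM {1..n} (\<lambda>_. P) \<Otimes>\<^sub>M Q"
  have [measurable_cong]: "sets Q = sets borel" by (rule Q)
  have [measurable]: "(\<lambda>\<omega>. cramer_ols c0 n (fst \<omega>) $ k $ l) \<in> borel_measurable ?N" for l
    by (rule measurable_compose[OF measurable_fst cramer_ols_measurable[OF P]])
  have [measurable]: "(\<lambda>\<omega>. snd \<omega> $ l) \<in> borel_measurable ?N" for l by measurable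
  have "(\<lambda>\<omega>. c0 $ k + (\<Sum>l\<in>UNIV. cramer_ols c0 n (fst \<omega>) $ k $ l * snd \<omega> $ l)) \<in> borel_measurable ?N"
    by measurable
  then show "(\<lambda>\<omega>. (c0 + cramer_ols c0 n (fst \<omega>) *v snd \<omega>) $ k) \<in> borel_measurable ?N"
    by (simp add: matrix_vector_mult_def)
qed

section \<open>Stage-I guarantee\<close>

theorem theorem30:
  fixes A :: "real^'d^'m" and b :: "real^'m"
    and c0 :: "real^'d" and Sig :: "real^'d^'d"
    and xs :: "real^'d \<Rightarrow> real^'d"
    and R :: "'d tie_rule"
    and Xi :: "(real^'p) set"
    and P :: "((real^'p) \<times> (real^'d)) measure"
    and mu :: "real^'p \<Rightarrow> real^'d"
    and Amu :: "real^'p^'d"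
    and n_mu n_disc :: nat
    and Ahat :: "(nat \<Rightarrow> (real^'p) \<times> (real^'d)) \<Rightarrow> real^'p^'d"
    and Uhat :: "(nat \<Rightarrow> (real^'p) \<times> (real^'d)) \<times> (nat \<Rightarrow> real^'p) \<Rightarrow> nat \<Rightarrow> real^'d"
    and C :: "(real^'d) set"
    and S :: "((nat \<Rightarrow> (real^'p) \<times> (real^'d)) \<times> (nat \<Rightarrow> real^'p)) measure"
    and muhat mutilde :: "(nat \<Rightarrow> (real^'p) \<times> (real^'d)) \<times> (nat \<Rightarrow> real^'p) \<Rightarrow> real^'p \<Rightarrow> real^'d"
    and Dhat :: "(nat \<Rightarrow> (real^'p) \<times> (real^'d)) \<times> (nat \<Rightarrow> real^'p) \<Rightarrow> (real^'d) set"
    and That :: "(nat \<Rightarrow> (real^'p) \<times> (real^'d)) \<times> (nat \<Rightarrow> real^'p) \<Rightarrow> nat set"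
    and tdim :: "(nat \<Rightarrow> (real^'p) \<times> (real^'d)) \<times> (nat \<Rightarrow> real^'p) \<Rightarrow> nat"
    and H :: "(nat \<Rightarrow> (real^'p) \<times> (real^'d)) \<times> (nat \<Rightarrow> real^'p) \<Rightarrow> (real^'p \<Rightarrow> real^'d) set"
    and r C_marg \<alpha> \<kappa> \<sigma> \<delta>\<^sub>\<mu> \<delta> :: real
  defines "C \<equiv> ellipsoid c0 Sig"
    and "S \<equiv> stage1_law P n_mu n_disc"
    and "muhat \<equiv> \<lambda>\<omega> \<xi>. c0 + Ahat (fst \<omega>) *v \<xi>"
    and "Dhat \<equiv> \<lambda>\<omega>. fst (alg2 A b C R (\<lambda>j. muhat \<omega> (snd \<omega> j)) n_disc)"
    and "That \<equiv> \<lambda>\<omega>. snd (alg2 A b C R (\<lambda>j. muhat \<omega> (snd \<omega> j)) n_disc)"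
    and "tdim \<equiv> \<lambda>\<omega>. dim (span (Dhat \<omega>))"
    and "mutilde \<equiv> \<lambda>\<omega>. lifted_predictor c0 Sig (Uhat \<omega>) (tdim \<omega>) (muhat \<omega>)"
    and "H \<equiv> \<lambda>\<omega>. lifted_class c0 Sig (Uhat \<omega>) (tdim \<omega>)"
    and "r \<equiv> ols_radius \<sigma> \<kappa> CARD('d) CARD('p) n_mu \<delta>\<^sub>\<mu>"
  assumes lp: "lp_setting A b"
    and xs: "lp_oracle A b xs"
    and Sig: "pos_def_mat Sig"
    and ties: "valid_tie_rule R"
    and P: "prob_space P" "sets P = sets borel"
    and xi: "AE z in P. fst z \<in> Xi"
    and cost: "AE z in P. snd z \<in> C"
    and mu: "is_cond_mean P mu"
    and ols_est: "\<And>z. z \<in> space (PiM {1..n_mu} (\<lambda>_. P)) \<Longrightarrow> is_ols c0 n_mu z (Ahat z)"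
    and Uhat: "\<And>\<omega>. \<omega> \<in> space S \<Longrightarrow> orthonormal_basis_of (Uhat \<omega>) (span (Dhat \<omega>))"
    and margin_const: "0 < C_marg" "0 < \<alpha>"
    and margin: "\<And>\<eta>. 0 < \<eta> \<Longrightarrow>
          measure (xi_law P) {\<xi>. edist_set (mu \<xi>) (tie_costs A b) \<le> ereal \<eta>} \<le> C_marg * \<eta> powr \<alpha>"
    and margin_as: "AE \<omega> in S. (AE \<xi> in xi_law P. muhat \<omega> \<xi> \<in> C) \<and>
                               (AE \<xi> in xi_law P. mutilde \<omega> \<xi> \<notin> tie_costs A b)"
    and ols: "bounded_design_ols P c0 Amu \<kappa> \<sigma>"
    and conf: "0 < \<delta>\<^sub>\<mu>" "\<delta>\<^sub>\<mu> < 1" "0 < \<delta>" "\<delta> < 1"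
    and n_mu: "8 / \<kappa> * ln (2 * real CARD('p) / \<delta>\<^sub>\<mu>) \<le> real n_mu"
    and n_disc: "1 \<le> n_disc"
  shows "(\<forall>f\<in>borel_measurable borel. spo_risk P xs mu \<le> spo_risk P xs f) \<and>
    (AE \<omega> in S. card (That \<omega>) \<le> card (Dhat \<omega>) \<and> card (Dhat \<omega>) \<le> dstar A b C) \<and>
    (\<exists>E\<in>sets S. 1 - \<delta>\<^sub>\<mu> - \<delta> \<le> measure S E \<and>
      (\<forall>\<omega>\<in>E.
         measure (xi_law P) {\<xi>. xs (mutilde \<omega> \<xi>) \<noteq> xs (mu \<xi>)}
           \<le> 4 / real n_disc * (6 * real (card (That \<omega>)) + ln (exp 1 / \<delta>)) + C_marg * r powr \<alpha> \<and>
         4 / real n_disc * (6 * real (card (That \<omega>)) + ln (exp 1 / \<delta>))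
           \<le> 4 / real n_disc * (6 * real (dstar A b C) + ln (exp 1 / \<delta>)) \<and>
         (\<forall>fhat\<in>argmin_set (spo_risk P xs) (H \<omega>).
            0 \<le> spo_risk P xs fhat - spo_risk P xs mu \<and>
            spo_risk P xs fhat - spo_risk P xs mu
              \<le> omega_X A b C *
                 (4 / real n_disc * (6 * real (dstar A b C) + ln (exp 1 / \<delta>)) + C_marg * r powr \<alpha>))))"
proof -
  have C: "compact C" "convex C" "c0 \<in> C"
    unfolding C_def by (rule compact_ellipsoid[OF Sig] convex_ellipsoid[OF Sig] center_in_ellipsoid)+
  interpret P: prob_space P by (rule P)
  interpret ols_model P C c0 Amu \<kappa> \<sigma>
    by standard (use P(2) compact_imp_bounded[OF C(1)] cost ols in auto)
  interpret D: strict_discovery A b C R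
    by standard (use lp ties C ellipsoid_strict[OF Sig] in \<open>auto simp: C_def\<close>)
  let ?Q = "xi_law P" and ?PM = "PiM {1..n_mu} (\<lambda>_. P)" and ?PY = "PiM {1..n_disc} (\<lambda>_. xi_law P)"
  interpret Q: prob_space ?Q by (rule prob_space_xi)
  interpret PM: prob_space ?PM by (intro prob_space_PiM P.prob_space_axioms)
  interpret PY: prob_space ?PY by (intro prob_space_PiM Q.prob_space_axioms)
  have S: "S = ?PM \<Otimes>\<^sub>M ?PY" by (simp add: S_def stage1_law_def)
  interpret S: pair_prob_space ?PM ?PY by standard
  interpret SS: prob_space S unfolding S by (rule S.prob_space_axioms)
  note [measurable] = mu_measurable[OF lp xs mu] xs_measurable[OF lp xs mu]
  let ?bound = "\<lambda>k :: nat. 4 / real n_disc * (6 * real k + ln (exp 1 / \<delta>))"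
  let ?marg = "C_marg * r powr \<alpha>"

  have Bayes: "\<forall>f\<in>borel_measurable borel. spo_risk P xs mu \<le> spo_risk P xs f"
    using spo_risk_Bayes[OF lp xs mu] by blast

  \<comment> \<open>Almost surely every discovery context lies in the support of the context law, and so its
    pseudo-cost lies in the ellipsoid whenever that of a fresh context does almost surely.\<close>
  from support_exists[OF sets_xi] obtain K where
    K: "closed K \<and> (AE x in ?Q. x \<in> K) \<and> (\<forall>F. closed F \<longrightarrow> (AE x in ?Q. x \<in> F) \<longrightarrow> K \<subseteq> F)"
    by (rule exE)
  note K = K[THEN conjunct1] K[THEN conjunct2, THEN conjunct1]
    K[THEN conjunct2, THEN conjunct2, THEN spec, THEN mp, THEN mp]
  have AE_K: "AE \<omega> in S. \<forall>j\<in>{1..n_disc}. snd \<omega> j \<in> K"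
    unfolding S
  proof (rule S.AE_pair_measure)
    have "{y \<in> space ?PY. y j \<in> K} \<in> sets ?PY" if "j \<in> {1..n_disc}" for j
      using measurable_sets[OF measurable_component_singleton[OF that], of K "\<lambda>_. ?Q"] K(1)
      by (simp add: vimage_def Int_def conj_commute sets_xi borel_closed)
    then have "{y \<in> space ?PY. \<forall>j\<in>{1..n_disc}. y j \<in> K} \<in> sets ?PY"
      by (intro sets.sets_Collect_finite_All) auto
    then have "space ?PM \<times> {y \<in> space ?PY. \<forall>j\<in>{1..n_disc}. y j \<in> K} \<in> sets (?PM \<Otimes>\<^sub>M ?PY)" by auto
    also have "space ?PM \<times> {y \<in> space ?PY. \<forall>j\<in>{1..n_disc}. y j \<in> K} =
        {\<omega> \<in> space (?PM \<Otimes>\<^sub>M ?PY). \<forall>j\<in>{1..n_disc}. snd \<omega> j \<in> K}" by (auto simp: space_pair_measure)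
    finally show "{\<omega> \<in> space (?PM \<Otimes>\<^sub>M ?PY). \<forall>j\<in>{1..n_disc}. snd \<omega> j \<in> K} \<in> sets (?PM \<Otimes>\<^sub>M ?PY)" .
    have "AE y in ?PY. \<forall>j\<in>{1..n_disc}. y j \<in> K"
      using K(2) by (intro AE_finite_allI AE_PiM_component Q.prob_space_axioms) auto
    then show "AE z in ?PM. AE y in ?PY. \<forall>j\<in>{1..n_disc}. snd (z, y) j \<in> K" by simp
  qed
  let ?ok = "\<lambda>\<omega>. ((AE \<xi> in ?Q. muhat \<omega> \<xi> \<in> C) \<and> (AE \<xi> in ?Q. mutilde \<omega> \<xi> \<notin> tie_costs A b)) \<and>
     (\<forall>j\<in>{1..n_disc}. snd \<omega> j \<in> K)"
  have AE_ok: "AE \<omega> in S. ?ok \<omega>" using margin_as AE_K by eventually_elim blast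
  have discovered: "Dhat \<omega> = D.discovery_run (\<lambda>j. muhat \<omega> (snd \<omega> j)) n_disc \<and> That \<omega> = D.discovery_updates n_disc (\<lambda>j. muhat \<omega> (snd \<omega> j))"
    if "?ok \<omega>" for \<omega>
  proof -
    have "continuous_on UNIV (muhat \<omega>)" unfolding muhat_def
      by (intro continuous_intros linear_continuous_on matrix_vector_mul_bounded_linear)
    then have "closed (muhat \<omega> -` C)"
      using compact_imp_closed[OF C(1)] by (simp add: continuous_closed_vimage continuous_on_eq_continuous_at)
    then have "K \<subseteq> muhat \<omega> -` C" using that by (intro K(3)) auto
    then have "alg2 A b C R (\<lambda>j. muhat \<omega> (snd \<omega> j)) n_disc =
        (D.discovery_run (\<lambda>j. muhat \<omega> (snd \<omega> j)) n_disc, D.discovery_updates n_disc (\<lambda>j. muhat \<omega> (snd \<omega> j)))"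
      using that by (intro D.discovery_run_eq_alg2) auto
    then show ?thesis by (simp add: Dhat_def That_def)
  qed
  have cards: "card (That \<omega>) \<le> card (Dhat \<omega>) \<and> card (Dhat \<omega>) \<le> dstar A b C" if "?ok \<omega>" for \<omega>
    using discovered[OF that] D.card_discovery_updates_le D.discovery_run_card_le by simp
  have AE_cards: "AE \<omega> in S. card (That \<omega>) \<le> card (Dhat \<omega>) \<and> card (Dhat \<omega>) \<le> dstar A b C"
    using AE_ok by eventually_elim (rule cards)

  \<comment> \<open>The good event: accurate least squares, no exceptional null set, and a representative
    discovery sample.\<close>
  from ols_concentration[OF conf(1,2) n_mu, folded r_def] obtain E1 where
    E1s: "E1 \<in> sets ?PM" and E1': "1 - \<delta>\<^sub>\<mu> \<le> measure ?PM E1 \<and>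
      (\<forall>z\<in>E1. \<forall>M. is_ols c0 n_mu z M \<longrightarrow> M = cramer_ols c0 n_mu z \<and>
         (\<forall>\<xi>. norm \<xi> \<le> 1 \<longrightarrow> norm (M *v \<xi> - Amu *v \<xi>) \<le> r))"
    by (rule bexE)
  note E1 = E1s E1'[THEN conjunct1]
  have ols_good: "M = cramer_ols c0 n_mu z" "norm \<xi> \<le> 1 \<Longrightarrow> norm (M *v \<xi> - Amu *v \<xi>) \<le> r"
    if "z \<in> E1" "is_ols c0 n_mu z M" for z M \<xi>
    using E1'[THEN conjunct2, THEN bspec, OF that(1), THEN spec, THEN mp, OF that(2)] by auto
  define g where "g = (\<lambda>(z :: nat \<Rightarrow> (real^'p) \<times> (real^'d)) (\<xi> :: real^'p). c0 + cramer_ols c0 n_mu z *v \<xi>)"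
  have g: "(\<lambda>(z, \<xi>). g z \<xi>) \<in> borel_measurable (?PM \<Otimes>\<^sub>M ?Q)"
    unfolding g_def by (rule cramer_predictor_measurable[OF P(2) sets_xi])
  from D.discovery_bound[OF PM.prob_space_axioms Q.prob_space_axioms n_disc conf(3,4) g, folded S] obtain Bad where
    Bs: "Bad \<in> sets S" and Bad': "measure S Bad \<le> \<delta> \<and> (\<forall>z y. (z, y) \<in> space S - Bad \<longrightarrow>
       measure ?Q {\<xi> \<in> space ?Q. g z \<xi> \<notin> D.resolved (D.discovery_run (\<lambda>j. g z (y j)) n_disc)}
         \<le> ?bound (card (D.discovery_updates n_disc (\<lambda>j. g z (y j)))))"
    by (rule bexE)
  note Bad = Bs Bad'[THEN conjunct1] Bad'[THEN conjunct2, THEN spec, THEN spec, THEN mp]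
  obtain B0 where B0: "{\<omega> \<in> space S. \<not> ?ok \<omega>} \<subseteq> B0" "emeasure S B0 = 0" "B0 \<in> sets S"
    using AE_ok by (rule AE_E)
  define E where "E = (E1 \<times> space ?PY - B0) - Bad"
  have E1S: "E1 \<times> space ?PY \<in> sets S" unfolding S using E1(1) by auto
  have E: "E \<in> sets S" unfolding E_def using E1S B0(3) Bad(1) by auto
  have prob: "1 - \<delta>\<^sub>\<mu> - \<delta> \<le> measure S E"
  proof -
    have "measure S (E1 \<times> space ?PY) = measure ?PM E1"
    proof -
      have "emeasure (?PM \<Otimes>\<^sub>M ?PY) (E1 \<times> space ?PY) = emeasure ?PM E1"
        using PY.emeasure_pair_measure_Times[OF E1(1) sets.top] unfolding PY.emeasure_space_1 mult_1_right .
      then show ?thesis unfolding S measure_def by (rule arg_cong)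
    qed
    moreover have "measure S (E1 \<times> space ?PY - B0) = measure S (E1 \<times> space ?PY)"
      using B0 by (intro measure_Diff_null_set E1S) auto
    moreover have "measure S E = measure S (E1 \<times> space ?PY - B0) - measure S ((E1 \<times> space ?PY - B0) \<inter> Bad)"
      unfolding E_def using E1S B0(3) Bad(1) by (intro SS.finite_measure_Diff') auto
    moreover have "measure S ((E1 \<times> space ?PY - B0) \<inter> Bad) \<le> measure S Bad"
      using Bad(1) by (intro SS.finite_measure_mono) auto
    ultimately show ?thesis using E1(2) Bad(2) by linarith
  qed

  have r0: "0 \<le> r"
    unfolding r_def using sigma_nonneg kappa_pos conf zero_less_card_finite[where 'a='d]
    by (intro ols_radius_nonneg) auto
  have edist_sets: "{\<xi>. edist_set (mu \<xi>) (tie_costs A b) \<le> ereal \<eta>} \<in> sets ?Q" for \<eta>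
  proof -
    have "mu -` {v. edist_set v (tie_costs A b) \<le> ereal \<eta>} \<inter> space borel \<in> sets borel"
      using mu_measurable[OF lp xs mu] by (rule measurable_sets) (simp add: borel_closed edist_set_le_closed)
    then show ?thesis by (simp add: sets_xi vimage_def)
  qed
  have near_tie: "measure ?Q {\<xi>. edist_set (mu \<xi>) (tie_costs A b) \<le> ereal r} \<le> ?marg"
    by (rule margin_at_nonneg_radius[OF margin_const r0 Q.finite_measure_axioms edist_sets margin])
  have bound_mono: "?bound k \<le> ?bound l" if "k \<le> l" for k l
    using that by (intro mult_left_mono) auto
  have omega0: "0 \<le> omega_X A b C"
  proof -
    have "xs c0 \<in> lp_feasible A b" by (rule xs_feasible[OF lp xs mu])
    from omega_bound[OF lp xs mu C(3) this this] show ?thesis by simp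
  qed
  have AE_norm_xi: "AE \<xi> in ?Q. norm \<xi> \<le> 1"
    using AE_norm_le by (subst AE_xi_iff) (auto simp: borel_closed closed_Collect_le continuous_on_norm)

  have event: "measure ?Q {\<xi>. xs (mutilde \<omega> \<xi>) \<noteq> xs (mu \<xi>)} \<le> ?bound (card (That \<omega>)) + ?marg \<and>
      ?bound (card (That \<omega>)) \<le> ?bound (dstar A b C) \<and>
      (\<forall>fhat\<in>argmin_set (spo_risk P xs) (H \<omega>).
        0 \<le> spo_risk P xs fhat - spo_risk P xs mu \<and>
        spo_risk P xs fhat - spo_risk P xs mu \<le> omega_X A b C * (?bound (dstar A b C) + ?marg))"
    if \<omega>: "\<omega> \<in> E" for \<omega>
  proof -
    obtain z y where zy: "\<omega> = (z, y)" by (cases \<omega>)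
    have \<omega>S: "\<omega> \<in> space S" using \<omega> sets.sets_into_space[OF E] by auto
    then have zs: "z \<in> space ?PM" by (simp add: S zy space_pair_measure)
    have zE: "z \<in> E1" and nB: "\<omega> \<notin> B0" "\<omega> \<notin> Bad" using \<omega> by (auto simp: E_def zy)
    have ok: "?ok \<omega>" using B0(1) nB(1) \<omega>S by blast
    have isols: "is_ols c0 n_mu z (Ahat z)" by (rule ols_est[OF zs])
    have mh: "muhat \<omega> = g z" using ols_good(1)[OF zE isols] by (simp add: muhat_def g_def zy)
    have disc: "Dhat \<omega> = D.discovery_run (\<lambda>j. g z (y j)) n_disc" "That \<omega> = D.discovery_updates n_disc (\<lambda>j. g z (y j))"
      using discovered[OF ok] unfolding mh by (simp_all add: zy)
    have unresolved: "measure ?Q {\<xi> \<in> space ?Q. muhat \<omega> \<xi> \<notin> D.resolved (Dhat \<omega>)} \<le> ?bound (card (That \<omega>))"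
      unfolding disc mh using nB(2) \<omega>S by (intro Bad(3)) (simp add: zy)
    let ?W = "span (Dhat \<omega>)"
    have U: "orthonormal_basis_of (Uhat \<omega>) ?W" by (rule Uhat[OF \<omega>S])
    have mt: "mutilde \<omega> \<xi> = c0 + lift Sig (Uhat \<omega>) (dim ?W) (\<lambda>i. Uhat \<omega> i \<bullet> (muhat \<omega> \<xi> - c0))" for \<xi>
      by (simp add: mutilde_def lifted_predictor_def tdim_def)
    have agree: "xs (mutilde \<omega> \<xi>) = xs (mu \<xi>)"
      if mC: "muhat \<omega> \<xi> \<in> C" and tie: "mutilde \<omega> \<xi> \<notin> tie_costs A b" and lin: "mu \<xi> = c0 + Amu *v \<xi>"
        and n1: "norm \<xi> \<le> 1" and res: "muhat \<omega> \<xi> \<in> D.resolved (Dhat \<omega>)"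
        and far: "\<not> edist_set (mu \<xi>) (tie_costs A b) \<le> ereal r" for \<xi>
    proof -
      have tC: "mutilde \<omega> \<xi> \<in> C"
        unfolding mt C_def by (rule lifted_cost(2)[OF Sig U subspace_span mC[unfolded C_def]])
      have tq: "q \<bullet> mutilde \<omega> \<xi> = q \<bullet> muhat \<omega> \<xi>" if "q \<in> Dhat \<omega>" for q
        unfolding mt by (rule lifted_cost(1)[OF Sig U subspace_span span_base[OF that]])
      obtain x where x: "x \<in> lp_vertices A b"
        "\<And>c'. c' \<in> consistent_costs C (Dhat \<omega>) (measurements (muhat \<omega> \<xi>)) \<Longrightarrow> x \<in> lp_opt A b c'"
        using res mC by (auto simp: D.resolved_def sufficient_def)
      have xh: "x \<in> lp_opt A b (muhat \<omega> \<xi>)" using mC by (intro x(2)) (simp add: consistent_costs_iff)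
      have xt: "x \<in> lp_opt A b (mutilde \<omega> \<xi>)" using tC tq by (intro x(2)) (simp add: consistent_costs_iff)
      have or: "xs v \<in> lp_vertices A b" "xs v \<in> lp_opt A b v" for v using xs by (auto simp: lp_oracle_def)
      have "norm (Ahat z *v \<xi> - Amu *v \<xi>) \<le> r" by (rule ols_good(2)[OF zE isols n1])
      then have "dist (mu \<xi>) (muhat \<omega> \<xi>) \<le> r"
        by (simp add: lin muhat_def zy dist_norm norm_minus_commute)
      then have "ereal (dist (mu \<xi>) (muhat \<omega> \<xi>)) \<le> ereal r" by simp
      also have "\<dots> < edist_set (mu \<xi>) (tie_costs A b)" using far by simp
      finally have "x = xs (mu \<xi>)" using decision_stable[OF lp _ or x(1) xh] by blast
      moreover have "xs (mutilde \<omega> \<xi>) = x" by (rule lp_opt_unique_off_ties[OF tie or x(1) xt])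
      ultimately show ?thesis by simp
    qed
    have gz: "muhat \<omega> \<in> borel_measurable borel"
      unfolding muhat_def zy fst_conv
      by (intro borel_measurable_continuous_onI continuous_intros linear_continuous_on matrix_vector_mul_bounded_linear)
    let ?A1 = "{\<xi> \<in> space ?Q. muhat \<omega> \<xi> \<notin> D.resolved (Dhat \<omega>)}"
    let ?A2 = "{\<xi>. edist_set (mu \<xi>) (tie_costs A b) \<le> ereal r}"
    have A1: "?A1 \<in> sets ?Q"
    proof -
      have "muhat \<omega> -` (- D.resolved (Dhat \<omega>)) \<inter> space borel \<in> sets borel"
        using gz by (rule measurable_sets) (use D.resolved_borel in \<open>auto intro: borel_comp\<close>)
      then show ?thesis by (simp add: sets_xi space_xi vimage_def)
    qed
    have mtH: "mutilde \<omega> \<in> H \<omega>"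
      unfolding mutilde_def H_def muhat_def by (rule lifted_predictor_in_class)
    have mtm [measurable]: "mutilde \<omega> \<in> borel_measurable borel"
      using mtH unfolding H_def by (rule lifted_class_measurable)
    have "measure ?Q {\<xi>. xs (mutilde \<omega> \<xi>) \<noteq> xs (mu \<xi>)} \<le> measure ?Q (?A1 \<union> ?A2)"
    proof (rule Q.finite_measure_mono_AE)
      show "?A1 \<union> ?A2 \<in> sets ?Q" using A1 edist_sets by auto
      have "AE \<xi> in ?Q. muhat \<omega> \<xi> \<in> C" "AE \<xi> in ?Q. mutilde \<omega> \<xi> \<notin> tie_costs A b" using ok by auto
      then show "AE \<xi> in ?Q. \<xi> \<in> {\<xi>. xs (mutilde \<omega> \<xi>) \<noteq> xs (mu \<xi>)} \<longrightarrow> \<xi> \<in> ?A1 \<union> ?A2"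
        using cond_mean_linear[OF mu] AE_norm_xi
        by eventually_elim (use agree in \<open>auto simp: space_xi\<close>)
    qed
    also have "\<dots> \<le> measure ?Q ?A1 + measure ?Q ?A2" by (rule measure_Un_le[OF A1 edist_sets])
    finally have dis: "measure ?Q {\<xi>. xs (mutilde \<omega> \<xi>) \<noteq> xs (mu \<xi>)} \<le> ?bound (card (That \<omega>)) + ?marg"
      using unresolved near_tie by linarith
    have bm: "?bound (card (That \<omega>)) \<le> ?bound (dstar A b C)" using cards[OF ok] by (intro bound_mono) auto
    have "0 \<le> spo_risk P xs fhat - spo_risk P xs mu \<and>
        spo_risk P xs fhat - spo_risk P xs mu \<le> omega_X A b C * (?bound (dstar A b C) + ?marg)"
      if fhat: "fhat \<in> argmin_set (spo_risk P xs) (H \<omega>)" for fhat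
    proof
      have "fhat \<in> borel_measurable borel"
        using fhat unfolding argmin_set_iff H_def by (blast intro: lifted_class_measurable)
      then show "0 \<le> spo_risk P xs fhat - spo_risk P xs mu" using Bayes by simp
      have "spo_risk P xs fhat \<le> spo_risk P xs (mutilde \<omega>)" using fhat mtH by (simp add: argmin_set_iff)
      then have "spo_risk P xs fhat - spo_risk P xs mu \<le> spo_risk P xs (mutilde \<omega>) - spo_risk P xs mu" by simp
      also have "\<dots> \<le> omega_X A b C * measure ?Q {\<xi>. xs (mutilde \<omega> \<xi>) \<noteq> xs (mu \<xi>)}"
        by (rule spo_risk_le_disagreement[OF lp xs mu mtm mu_measurable[OF lp xs mu]])
      also have "\<dots> \<le> omega_X A b C * (?bound (dstar A b C) + ?marg)"
        using dis bm omega0 by (intro mult_left_mono) auto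
      finally show "spo_risk P xs fhat - spo_risk P xs mu \<le> omega_X A b C * (?bound (dstar A b C) + ?marg)" .
    qed
    then show ?thesis using dis bm by blast
  qed
  show ?thesis using Bayes AE_cards E prob event by blast
qed

end
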